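(* Let $(M,g)$ be a stationary Lorentzian manifold with timelike Killing vector field $\mathcal Y$, and let $\gamma$ be a closed geodesic in $M$ such that the sequence $\mu\big(\gamma^{(N)}\big)$, $N\ge1$, is not bounded. Then there exist positive constants $\bar\alpha,\bar\beta\in\mathbb R$ and an integer $s_0$ such that, for all integers $s\ge s_0$, $$\mu\big(\gamma^{(r+s)}\big)\ge\mu\big(\gamma^{(r)}\big)+s\,\bar\alpha-\bar\beta\qquad\text{for all integers } r>0.$$
   Context: A Lorentzian manifold has metric of index $1$; it is stationary if it carries a timelike Killing field $\mathcal Y$. A closed geodesic is a geodesic $\gamma:[0,1]\to M$ with $\gamma(0)=\gamma(1)$, $\dot\gamma(0)=\dot\gamma(1)$; its $N$-th iterate is $\gamma^{(N)}(t)=\widetilde\gamma(Nt)$, $t\in[0,1]$, where $\widetilde\gamma:\mathbb R\to M$ is the periodic extension of $\gamma$. $\Lambda M$ is the Hilbert manifold of $H^1$ loops $\gamma:[0,1]\to M$, $\gamma(0)=\gamma(1)$; $f(\gamma)=\frac12\int_0^1 g(\dot\gamma,\dot\gamma)\,dt$; $\mathcal N=\{\gamma\in\Lambda M: g(\dot\gamma,\mathcal Y)\ \text{is constant a.e.}\}$, a smooth submanifold of $\Lambda M$ whose tangent space $T_\gamma\mathcal N$ consists of the periodic ($V(0)=V(1)$) $H^1$ vector fields $V$ along $\gamma$ such that $g(\frac{\mathrm D}{\mathrm dt}V,\mathcal Y)-g(V,\frac{\mathrm D}{\mathrm dt}\mathcal Y)$ is constant a.e. For a closed geodesic $\gamma$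 (equivalently, a critical point of $f|_{\mathcal N}$) the index form is $I_\gamma(V,W)=\int_0^1 g(\frac{\mathrm D}{\mathrm dt}V,\frac{\mathrm D}{\mathrm dt}W)+g(R(\dot\gamma,V)\dot\gamma,W)\,dt$, where $R(X,Y)=\nabla_X\nabla_Y-\nabla_Y\nabla_X-\nabla_{[X,Y]}$. The Morse index $\mu(\gamma)$ is the (finite) maximal dimension of a subspace of $T_\gamma\mathcal N$ on which $I_\gamma$ is negative definite. *)

theory Defs
  imports "HOL-Analysis.Analysis" "HOL-Library.Function_Algebras"
begin

section \<open>Linear algebra\<close>

text \<open>Tangent vectors and vector fields along curves are functions below; the pointwise real vector
  space structure makes the library's \<open>subspace\<close> and \<open>dim\<close> available for them.\<close>

instantiation "fun" :: (type, real_vector) real_vector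
begin

definition "scaleR a f = (\<lambda>x. a *\<^sub>R f x)"

instance
  by standard (simp_all add: scaleR_fun_def fun_eq_iff algebra_simps)

end

text \<open>The maximal dimension of a subspace of \<open>S\<close> on which \<open>B\<close> is negative definite. An
  infinite-dimensional \<open>W\<close> has \<open>dim W = 0\<close>, but then its finite-dimensional subspaces already make
  the supremum infinite.\<close>

definition neg_index :: "'v::real_vector set \<Rightarrow> ('v \<Rightarrow> 'v \<Rightarrow> real) \<Rightarrow> enat" where
  "neg_index S B = Sup {enat (dim W) | W. subspace W \<and> W \<subseteq> S \<and> (\<forall>v\<in>W. v \<noteq> 0 \<longrightarrow> B v v < 0)}"


section \<open>Smooth manifolds\<close>

text \<open>Only meaningful for open \<open>S\<close>.\<close>

primrec Ck_on :: "nat \<Rightarrow> 'a::euclidean_space set \<Rightarrow> ('a \<Rightarrow> 'b::real_normed_vector) \<Rightarrow> bool" where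
  "Ck_on 0 S f = continuous_on S f"
| "Ck_on (Suc k) S f =
    (f differentiable_on S \<and> (\<forall>v. Ck_on k S (\<lambda>x. frechet_derivative f (at x) v)))"

definition smooth_on :: "'a::euclidean_space set \<Rightarrow> ('a \<Rightarrow> 'b::real_normed_vector) \<Rightarrow> bool" where
  "smooth_on S f \<longleftrightarrow> (\<forall>k. Ck_on k S f)"

text \<open>A chart is a pair of its domain and its coordinate map. The manifold is the whole topological
  type \<open>'m\<close>; its dimension is \<open>DIM('e)\<close>.\<close>

type_synonym ('m, 'e) chart = "'m set \<times> ('m \<Rightarrow> 'e)"

definition chart_inv :: "('m, 'e) chart \<Rightarrow> 'e \<Rightarrow> 'm" where
  "chart_inv c = inv_into (fst c) (snd c)"

definition smooth_atlas ::
  "('m::{t2_space, second_countable_topology}, 'e::euclidean_space) chart set \<Rightarrow> bool" where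
  "smooth_atlas A \<longleftrightarrow>
    (\<Union>c\<in>A. fst c) = UNIV \<and>
    (\<forall>c\<in>A. open (fst c) \<and> open (snd c ` fst c) \<and>
      homeomorphism (fst c) (snd c ` fst c) (snd c) (chart_inv c)) \<and>
    (\<forall>c\<in>A. \<forall>d\<in>A. smooth_on (snd c ` (fst c \<inter> fst d)) (snd d \<circ> chart_inv c))"

text \<open>A tangent vector at \<open>p\<close> is the family of its components in all charts around \<open>p\<close>, related by
  the differentials of the coordinate changes; components in other charts are set to \<open>0\<close>.
  \<open>coord_vec A c p u\<close> is the tangent vector at \<open>p\<close> with component \<open>u\<close> in the chart \<open>c\<close>.\<close>

type_synonym ('m, 'e) tangent = "('m, 'e) chart \<Rightarrow> 'e"

definition coord_vec ::
  "('m, 'e::euclidean_space) chart set \<Rightarrow> ('m, 'e) chart \<Rightarrow> 'm \<Rightarrow> 'e \<Rightarrow> ('m, 'e) tangent" where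
  "coord_vec A c p u =
    (\<lambda>d. if d \<in> A \<and> p \<in> fst d
         then frechet_derivative (snd d \<circ> chart_inv c) (at (snd c p)) u else 0)"

definition tangent_space ::
  "('m, 'e::euclidean_space) chart set \<Rightarrow> 'm \<Rightarrow> ('m, 'e) tangent set" where
  "tangent_space A p = {v. \<forall>c\<in>A. p \<in> fst c \<longrightarrow> v = coord_vec A c p (v c)}"

definition smooth_vector_field ::
  "('m, 'e::euclidean_space) chart set \<Rightarrow> ('m \<Rightarrow> ('m, 'e) tangent) \<Rightarrow> bool" where
  "smooth_vector_field A Y \<longleftrightarrow>
    (\<forall>p. Y p \<in> tangent_space A p) \<and>
    (\<forall>c\<in>A. smooth_on (snd c ` fst c) (\<lambda>x. Y (chart_inv c x) c))"


section \<open>Lorentzian metrics and Killing fields\<close>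

type_synonym ('m, 'e) metric = "'m \<Rightarrow> ('m, 'e) tangent \<Rightarrow> ('m, 'e) tangent \<Rightarrow> real"

definition metric_coord ::
  "('m, 'e::euclidean_space) chart set \<Rightarrow> ('m, 'e) metric \<Rightarrow> ('m, 'e) chart \<Rightarrow>
    'e \<Rightarrow> 'e \<Rightarrow> 'e \<Rightarrow> real" where
  "metric_coord A g c x u v =
    g (chart_inv c x) (coord_vec A c (chart_inv c x) u) (coord_vec A c (chart_inv c x) v)"

definition lorentzian_metric ::
  "('m, 'e::euclidean_space) chart set \<Rightarrow> ('m, 'e) metric \<Rightarrow> bool" where
  "lorentzian_metric A g \<longleftrightarrow>
    (\<forall>p. \<forall>u\<in>tangent_space A p. \<forall>v\<in>tangent_space A p. g p u v = g p v u) \<and>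
    (\<forall>p. \<forall>u\<in>tangent_space A p. \<forall>v\<in>tangent_space A p. \<forall>w\<in>tangent_space A p. \<forall>a b.
      g p (a *\<^sub>R u + b *\<^sub>R v) w = a * g p u w + b * g p v w) \<and>
    (\<forall>p. \<forall>u\<in>tangent_space A p. (\<forall>v\<in>tangent_space A p. g p u v = 0) \<longrightarrow> u = 0) \<and>
    (\<forall>p. neg_index (tangent_space A p) (g p) = 1) \<and>
    (\<forall>c\<in>A. \<forall>u v. smooth_on (snd c ` fst c) (\<lambda>x. metric_coord A g c x u v))"

definition lorentzian_manifold ::
  "('m::{t2_space, second_countable_topology}, 'e::euclidean_space) chart set \<Rightarrow>
    ('m, 'e) metric \<Rightarrow> bool" where
  "lorentzian_manifold A g \<longleftrightarrow> smooth_atlas A \<and> lorentzian_metric A g"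

text \<open>The last conjunct is the vanishing of the Lie derivative of \<open>g\<close> along \<open>Y\<close>,
  \<open>Y\<^sup>k \<partial>\<^sub>k g\<^sub>i\<^sub>j + g\<^sub>k\<^sub>j \<partial>\<^sub>i Y\<^sup>k + g\<^sub>i\<^sub>k \<partial>\<^sub>j Y\<^sup>k = 0\<close>, in local coordinates.\<close>

definition killing_field ::
  "('m, 'e::euclidean_space) chart set \<Rightarrow> ('m, 'e) metric \<Rightarrow> ('m \<Rightarrow> ('m, 'e) tangent) \<Rightarrow> bool" where
  "killing_field A g Y \<longleftrightarrow>
    smooth_vector_field A Y \<and>
    (\<forall>c\<in>A. \<forall>x\<in>snd c ` fst c. \<forall>u v.
      (let Yc = (\<lambda>y. Y (chart_inv c y) c); dY = frechet_derivative Yc (at x) in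
        frechet_derivative (\<lambda>y. metric_coord A g c y u v) (at x) (Yc x)
        + metric_coord A g c x (dY u) v + metric_coord A g c x u (dY v) = 0))"

definition timelike :: "('m, 'e) metric \<Rightarrow> ('m \<Rightarrow> ('m, 'e) tangent) \<Rightarrow> bool" where
  "timelike g Y \<longleftrightarrow> (\<forall>p. g p (Y p) (Y p) < 0)"


section \<open>Levi-Civita connection and curvature\<close>

text \<open>\<open>\<nabla>\<^sub>u v\<close> for constant coordinate fields \<open>u\<close>, \<open>v\<close>, by the Koszul formula.\<close>

definition christoffel ::
  "('m, 'e::euclidean_space) chart set \<Rightarrow> ('m, 'e) metric \<Rightarrow> ('m, 'e) chart \<Rightarrow>
    'e \<Rightarrow> 'e \<Rightarrow> 'e \<Rightarrow> 'e" where
  "christoffel A g c x u v =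
    (THE z. \<forall>w. metric_coord A g c x z w =
      (frechet_derivative (\<lambda>y. metric_coord A g c y v w) (at x) u
       + frechet_derivative (\<lambda>y. metric_coord A g c y u w) (at x) v
       - frechet_derivative (\<lambda>y. metric_coord A g c y u v) (at x) w) / 2)"

text \<open>Sign convention \<open>R(X,Y) = \<nabla>\<^sub>X \<nabla>\<^sub>Y - \<nabla>\<^sub>Y \<nabla>\<^sub>X - \<nabla>\<^bsub>[X,Y]\<^esub>\<close>, evaluated on constant coordinate fields.\<close>

definition curvature_coord ::
  "('m, 'e::euclidean_space) chart set \<Rightarrow> ('m, 'e) metric \<Rightarrow> ('m, 'e) chart \<Rightarrow>
    'e \<Rightarrow> 'e \<Rightarrow> 'e \<Rightarrow> 'e \<Rightarrow> 'e" where
  "curvature_coord A g c x u v w =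
    (let \<Gamma> = christoffel A g c in
      frechet_derivative (\<lambda>y. \<Gamma> y v w) (at x) u - frechet_derivative (\<lambda>y. \<Gamma> y u w) (at x) v
      + \<Gamma> x u (\<Gamma> x v w) - \<Gamma> x v (\<Gamma> x u w))"

definition curvature ::
  "('m, 'e::euclidean_space) chart set \<Rightarrow> ('m, 'e) metric \<Rightarrow> 'm \<Rightarrow>
    ('m, 'e) tangent \<Rightarrow> ('m, 'e) tangent \<Rightarrow> ('m, 'e) tangent \<Rightarrow> ('m, 'e) tangent" where
  "curvature A g p u v w =
    (\<lambda>c. if c \<in> A \<and> p \<in> fst c then curvature_coord A g c (snd c p) (u c) (v c) (w c) else 0)"


section \<open>Closed geodesics\<close>

text \<open>Curves are parametrized by \<open>[0,1]\<close>; values outside this interval are irrelevant, and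
  derivatives at its end points are one-sided.\<close>

definition velocity ::
  "('m, 'e::euclidean_space) chart set \<Rightarrow> (real \<Rightarrow> 'm) \<Rightarrow> real \<Rightarrow> ('m, 'e) tangent" where
  "velocity A \<gamma> t =
    (\<lambda>c. if c \<in> A \<and> \<gamma> t \<in> fst c then vector_derivative (snd c \<circ> \<gamma>) (at t within {0..1}) else 0)"

text \<open>The covariant derivative along \<open>\<gamma>\<close> of a vector field \<open>V\<close> along \<open>\<gamma>\<close>, at parameters where the
  components of \<open>V\<close> are differentiable.\<close>

definition cov_deriv ::
  "('m, 'e::euclidean_space) chart set \<Rightarrow> ('m, 'e) metric \<Rightarrow> (real \<Rightarrow> 'm) \<Rightarrow>
    (real \<Rightarrow> ('m, 'e) tangent) \<Rightarrow> real \<Rightarrow> ('m, 'e) tangent" where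
  "cov_deriv A g \<gamma> V t =
    (\<lambda>c. if c \<in> A \<and> \<gamma> t \<in> fst c
         then vector_derivative (\<lambda>s. V s c) (at t within {0..1})
              + christoffel A g c (snd c (\<gamma> t)) (velocity A \<gamma> t c) (V t c)
         else 0)"

definition geodesic ::
  "('m::topological_space, 'e::euclidean_space) chart set \<Rightarrow> ('m, 'e) metric \<Rightarrow>
    (real \<Rightarrow> 'm) \<Rightarrow> bool" where
  "geodesic A g \<gamma> \<longleftrightarrow>
    continuous_on {0..1} \<gamma> \<and>
    (\<forall>t\<in>{0..1}. \<forall>c\<in>A. \<gamma> t \<in> fst c \<longrightarrow>
      (snd c \<circ> \<gamma>) differentiable (at t within {0..1}) \<and>
      (\<lambda>s. velocity A \<gamma> s c) differentiable (at t within {0..1})) \<and>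
    (\<forall>t\<in>{0..1}. cov_deriv A g \<gamma> (velocity A \<gamma>) t = 0)"

definition closed_geodesic ::
  "('m::topological_space, 'e::euclidean_space) chart set \<Rightarrow> ('m, 'e) metric \<Rightarrow>
    (real \<Rightarrow> 'm) \<Rightarrow> bool" where
  "closed_geodesic A g \<gamma> \<longleftrightarrow>
    geodesic A g \<gamma> \<and> \<gamma> 0 = \<gamma> 1 \<and> velocity A \<gamma> 0 = velocity A \<gamma> 1"

text \<open>\<open>\<gamma> \<circ> frac\<close> is the 1-periodic extension of the loop \<open>\<gamma>\<close>.\<close>

definition iterate :: "nat \<Rightarrow> (real \<Rightarrow> 'm) \<Rightarrow> real \<Rightarrow> 'm" where
  "iterate N \<gamma> = (\<lambda>t. \<gamma> (frac (real N * t)))"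


section \<open>Index form and Morse index\<close>

text \<open>\<open>f \<in> H\<^sup>1([a,b])\<close>: \<open>f\<close> is an indefinite integral of a square integrable function.\<close>

definition H1_on :: "real \<Rightarrow> real \<Rightarrow> (real \<Rightarrow> 'e::euclidean_space) \<Rightarrow> bool" where
  "H1_on a b f \<longleftrightarrow>
    (\<exists>w. w absolutely_integrable_on {a..b} \<and>
         (\<lambda>t. (norm (w t))\<^sup>2) absolutely_integrable_on {a..b} \<and>
         (\<forall>t\<in>{a..b}. f t = f a + integral {a..t} w))"

text \<open>\<open>T\<^sub>\<gamma>\<Lambda>M\<close>, the periodic \<open>H\<^sup>1\<close> vector fields along \<open>\<gamma>\<close>. Fields are defined on \<open>[0,1]\<close> and are
  extended by \<open>0\<close>, so that distinct functions represent distinct fields.\<close>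

definition periodic_H1_fields ::
  "('m, 'e::euclidean_space) chart set \<Rightarrow> (real \<Rightarrow> 'm) \<Rightarrow> (real \<Rightarrow> ('m, 'e) tangent) set" where
  "periodic_H1_fields A \<gamma> =
    {V. (\<forall>t\<in>{0..1}. V t \<in> tangent_space A (\<gamma> t)) \<and> (\<forall>t. t \<notin> {0..1} \<longrightarrow> V t = 0) \<and>
        (\<forall>c\<in>A. \<forall>a b. 0 \<le> a \<and> a \<le> b \<and> b \<le> 1 \<and> \<gamma> ` {a..b} \<subseteq> fst c \<longrightarrow> H1_on a b (\<lambda>t. V t c)) \<and>
        V 0 = V 1}"

definition tangent_N ::
  "('m, 'e::euclidean_space) chart set \<Rightarrow> ('m, 'e) metric \<Rightarrow> ('m \<Rightarrow> ('m, 'e) tangent) \<Rightarrow>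
    (real \<Rightarrow> 'm) \<Rightarrow> (real \<Rightarrow> ('m, 'e) tangent) set" where
  "tangent_N A g Y \<gamma> =
    {V \<in> periodic_H1_fields A \<gamma>. \<exists>k. AE t in lebesgue. t \<in> {0..1} \<longrightarrow>
       g (\<gamma> t) (cov_deriv A g \<gamma> V t) (Y (\<gamma> t))
       - g (\<gamma> t) (V t) (cov_deriv A g \<gamma> (\<lambda>s. Y (\<gamma> s)) t) = k}"

definition index_form ::
  "('m, 'e::euclidean_space) chart set \<Rightarrow> ('m, 'e) metric \<Rightarrow> (real \<Rightarrow> 'm) \<Rightarrow>
    (real \<Rightarrow> ('m, 'e) tangent) \<Rightarrow> (real \<Rightarrow> ('m, 'e) tangent) \<Rightarrow> real" where
  "index_form A g \<gamma> V W =
    integral {0..1} (\<lambda>t.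
      g (\<gamma> t) (cov_deriv A g \<gamma> V t) (cov_deriv A g \<gamma> W t)
      + g (\<gamma> t) (curvature A g (\<gamma> t) (velocity A \<gamma> t) (V t) (velocity A \<gamma> t)) (W t))"

definition morse_index ::
  "('m, 'e::euclidean_space) chart set \<Rightarrow> ('m, 'e) metric \<Rightarrow> ('m \<Rightarrow> ('m, 'e) tangent) \<Rightarrow>
    (real \<Rightarrow> 'm) \<Rightarrow> enat" where
  "morse_index A g Y \<gamma> = neg_index (tangent_N A g Y \<gamma>) (index_form A g \<gamma>)"

end

theory Submission
  imports Defs
begin

text \<open>
  Call a field in \<open>T\<^sub>\<gamma>\<N>\<close> pinned if it vanishes at \<open>t = 0\<close> and if its constant
  \<open>g(DV, Y) - g(V, DY)\<close> is \<open>0\<close>. Pinned fields form a subspace of codimension at most \<open>dim M + 1\<close>, so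
  the index \<open>\<nu>\<close> of the index form on pinned fields satisfies \<open>\<mu> - (dim M + 1) \<le> \<nu> \<le> \<mu>\<close>. Pinned fields
  along \<open>\<gamma>\<^sup>(\<^sup>r\<^sup>)\<close> and \<open>\<gamma>\<^sup>(\<^sup>s\<^sup>)\<close> can be concatenated to a pinned field along \<open>\<gamma>\<^sup>(\<^sup>r\<^sup>+\<^sup>s\<^sup>)\<close>, and the index form
  is additive up to positive factors, hence \<open>\<nu>(r + s) \<ge> \<nu>(r) + \<nu>(s)\<close>. If \<open>\<mu>\<close> is unbounded, then
  \<open>\<nu>(N) \<ge> 1\<close> for some \<open>N\<close>, so \<open>\<nu>(s) \<ge> \<lfloor>s / N\<rfloor>\<close> and \<open>\<mu>(r + s) \<ge> \<nu>(r) + \<nu>(s) \<ge> \<mu>(r) + s / N - (dim M + 2)\<close>.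

  The metric is only specified on tangent vectors. Rescaling the index form therefore needs that
  covariant derivatives (at almost every parameter) and curvature are tangent vectors, that is, the
  transformation laws of the Christoffel symbols and of the curvature under coordinate changes.
\<close>

section \<open>Calculus\<close>

text \<open>Both pinning conditions are what extension by zero requires. A field along one factor is
  continued by \<open>0\<close> over the rest of \<open>[0,1]\<close>, so it must vanish at the
  junction. Its constant is multiplied by the speed factor of the reparametrization, and the
  continuation has constant \<open>0\<close>; the only constant that fits both is \<open>0\<close>.
  Two conventions shape the rest. The integral of a non-integrable function is \<open>0\<close>, so
  the index form cannot be split over subintervals for arbitrary fields; but the zero field and
  every field with negative index form have integrable density, and no others occur. Moreover the
  index is a supremum in \<open>enat\<close> that is not known to be finite, and \<open>dim\<close>
  is \<open>0\<close> on infinite-dimensional spaces. Estimates are therefore stated as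
  \<open>enat n \<le> neg_index S B\<close> and proved with finite independent sets. Pointwise
  identities are only claimed off a negligible set of parameters, where all derivatives are
  two-sided.\<close>

lemma indefinite_integral_vector_derivative_ae:
  fixes w :: "real \<Rightarrow> 'b::euclidean_space"
  assumes w: "w integrable_on {a..b}"
  obtains N where "negligible N"
    "\<And>x. x \<in> {a<..<b} - N \<Longrightarrow> ((\<lambda>t. integral {a..t} w) has_vector_derivative w x) (at x)"
proof -
  \<comment> \<open>Extension by zero makes \<open>f\<close> integrable on every interval, as the
    differentiation theorem below demands. That theorem controls right difference quotients only;
    the left ones come from the reflected function.\<close>
  define f where "f = (\<lambda>x. if x \<in> {a..b} then w x else 0)"
  have fU: "f integrable_on UNIV"
    using w unfolding f_def by (simp only: integrable_restrict_UNIV)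
  have fI: "f integrable_on cbox u v" for u v
    using fU integrable_on_subcbox by blast
  have fI': "(\<lambda>x. f (- x)) integrable_on cbox u v" for u v
    using fI[of "-v" "-u"] integrable_reflect[of f "-u" "-v"] by simp
  obtain N1 where N1: "negligible N1"
    and R: "\<And>x e. \<lbrakk>x \<notin> N1; 0 < e\<rbrakk> \<Longrightarrow> \<exists>d>0. \<forall>h. 0 < h \<and> h < d \<longrightarrow>
        norm (integral (cbox x (x + h)) f /\<^sub>R h - f x) < e"
    using integrable_ccontinuous_explicit[OF fI] by auto
  obtain N2 where N2: "negligible N2"
    and L: "\<And>x e. \<lbrakk>x \<notin> N2; 0 < e\<rbrakk> \<Longrightarrow> \<exists>d>0. \<forall>h. 0 < h \<and> h < d \<longrightarrow>
        norm (integral (cbox x (x + h)) (\<lambda>x. f (- x)) /\<^sub>R h - f (- x)) < e"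
    using integrable_ccontinuous_explicit[OF fI'] by auto
  have "negligible (uminus ` N2)"
    using N2 by (intro negligible_differentiable_image_negligible) (auto intro!: derivative_intros)
  with N1 have "negligible (N1 \<union> uminus ` N2)" by simp
  moreover have "((\<lambda>t. integral {a..t} w) has_vector_derivative w x) (at x)"
    if x: "x \<in> {a<..<b} - (N1 \<union> uminus ` N2)" for x
  proof -
    have fx: "f x = w x" using x by (auto simp: f_def)
    have ff: "integral {u..v} f = integral {u..v} w" if "a \<le> u" "v \<le> b" for u v
      using that by (intro integral_cong) (auto simp: f_def)
    have sub: "integral {a..v} w - integral {a..u} w = integral {u..v} f"
      if "a \<le> u" "u \<le> v" "v \<le> b" for u v
    proof -
      have "integral {a..u} w + integral {u..v} w = integral {a..v} w"
        using that w by (intro Henstock_Kurzweil_Integration.integral_combine) (auto intro: integrable_on_subinterval)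
      then show ?thesis using ff[of u v] that by (simp add: algebra_simps)
    qed
    show ?thesis
      unfolding has_vector_derivative_def has_derivative_at'
    proof (intro conjI allI impI)
      show "bounded_linear (\<lambda>xa. xa *\<^sub>R w x)" by (rule bounded_linear_scaleR_left)
      fix e :: real assume e: "e > 0"
      obtain d1 where d1: "d1 > 0" and R1: "\<And>h. 0 < h \<Longrightarrow> h < d1 \<Longrightarrow>
          norm (integral {x..x + h} f /\<^sub>R h - f x) < e"
        using R[of x e] x e by auto
      have "- x \<notin> N2" using x by force
      then obtain d2 where d2: "d2 > 0" and L1: "\<And>h. 0 < h \<Longrightarrow> h < d2 \<Longrightarrow>
          norm (integral {-x..-x + h} (\<lambda>x. f (- x)) /\<^sub>R h - f x) < e"
        using L[of "-x" e] e by auto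
      define d where "d = min (min d1 d2) (min (x - a) (b - x))"
      have "d > 0" using d1 d2 x by (auto simp: d_def)
      moreover have "norm (integral {a..y} w - integral {a..x} w - (y - x) *\<^sub>R w x) / norm (y - x) < e"
        if y: "0 < norm (y - x)" "norm (y - x) < d" for y
      proof (cases "y > x")
        case True
        define h where "h = y - x"
        have h: "0 < h" "h < d1" "h < b - x" using True y by (auto simp: h_def d_def)
        have "integral {a..y} w - integral {a..x} w = integral {x..x+h} f"
          using sub[of x y] x h by (auto simp: h_def)
        then have "norm (integral {a..y} w - integral {a..x} w - (y - x) *\<^sub>R w x) / norm (y - x)
          = norm ((integral {x..x + h} f - h *\<^sub>R f x) /\<^sub>R h)"
          using h by (simp add: fx h_def divide_inverse mult.commute)
        also have "\<dots> = norm (integral {x..x + h} f /\<^sub>R h - f x)"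
          using h by (simp add: scaleR_diff_right)
        finally show ?thesis using R1[OF h(1,2)] by simp
      next
        case False
        define h where "h = x - y"
        have h: "0 < h" "h < d2" "h < x - a" using False y by (auto simp: h_def d_def)
        have "integral {a..x} w - integral {a..y} w = integral {y..x} f"
          using sub[of y x] x h by (auto simp: h_def)
        also have "\<dots> = integral {-x..-x+h} (\<lambda>x. f (- x))"
          using integral_reflect_real[of x y f] by (simp add: h_def)
        finally have I: "integral {a..x} w - integral {a..y} w = integral {-x..-x+h} (\<lambda>x. f (- x))" .
        have "norm (integral {a..y} w - integral {a..x} w - (y - x) *\<^sub>R w x)
          = norm (- (integral {-x..-x + h} (\<lambda>x. f (- x)) - h *\<^sub>R f x))"
          unfolding I[symmetric] unfolding fx h_def by (rule arg_cong[where f=norm]) (simp add: algebra_simps)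
        also have "\<dots> = norm (integral {-x..-x + h} (\<lambda>x. f (- x)) - h *\<^sub>R f x)"
          by (rule norm_minus_cancel)
        finally have "norm (integral {a..y} w - integral {a..x} w - (y - x) *\<^sub>R w x) / norm (y - x)
          = norm ((integral {-x..-x + h} (\<lambda>x. f (- x)) - h *\<^sub>R f x) /\<^sub>R h)"
          using h by (simp add: h_def divide_inverse mult.commute)
        also have "\<dots> = norm (integral {-x..-x + h} (\<lambda>x. f (- x)) /\<^sub>R h - f x)"
          using h by (simp add: scaleR_diff_right)
        finally show ?thesis using L1[OF h(1,2)] by simp
      qed
      ultimately show "\<exists>d>0. \<forall>x'. 0 < norm (x' - x) \<and> norm (x' - x) < d \<longrightarrow>
          norm (integral {a..x'} w - integral {a..x} w - (x' - x) *\<^sub>R w x) / norm (x' - x) < e"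
        by blast
    qed
  qed
  ultimately show ?thesis using that by blast
qed

section \<open>Smooth maps and the symmetry of second derivatives\<close>

lemma smooth_on_frechet: "smooth_on S f \<Longrightarrow> smooth_on S (\<lambda>x. frechet_derivative f (at x) v)"
  unfolding smooth_on_def by (metis Ck_on.simps(2))

lemma smooth_on_has_derivative:
  assumes "smooth_on S f" "open S" "x \<in> S"
  shows "(f has_derivative frechet_derivative f (at x)) (at x)"
proof -
  have "Ck_on (Suc 0) S f" using assms(1) unfolding smooth_on_def by blast
  then have "f differentiable (at x)"
    using assms(2,3) by (simp add: differentiable_on_eq_differentiable_at)
  then show ?thesis by (simp add: frechet_derivative_works)
qed

lemma smooth_on_continuous_on: "smooth_on S f \<Longrightarrow> continuous_on S f"
  unfolding smooth_on_def by (metis Ck_on.simps(1))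

text \<open>The mean value theorem is applied twice: along \<open>u\<close> to the increment of
  \<open>f\<close> in direction \<open>v\<close>, then along \<open>v\<close> to the partial
  derivative \<open>f' _ u\<close>. Here \<open>f''\<close> is the derivative of that one partial
  derivative.\<close>

lemma real_second_difference_mvt:
  fixes f :: "'a::euclidean_space \<Rightarrow> real"
  assumes f: "\<And>y. y \<in> ball x r \<Longrightarrow> (f has_derivative f' y) (at y)"
    and f': "\<And>y. y \<in> ball x r \<Longrightarrow> ((\<lambda>y. f' y u) has_derivative f'' y) (at y)"
    and h: "h > 0" "h * (norm u + norm v) < r"
  obtains s t where "0 \<le> s" "s \<le> h" "0 \<le> t" "t \<le> h"
    "f (x + h *\<^sub>R u + h *\<^sub>R v) - f (x + h *\<^sub>R u) - f (x + h *\<^sub>R v) + f x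
      = h\<^sup>2 * f'' (x + s *\<^sub>R u + t *\<^sub>R v) v"
proof -
  have inb: "x + s *\<^sub>R u + t *\<^sub>R v \<in> ball x r" if "0 \<le> s" "s \<le> h" "0 \<le> t" "t \<le> h" for s t
  proof -
    have "norm (s *\<^sub>R u + t *\<^sub>R v) \<le> s * norm u + t * norm v"
      using that norm_triangle_ineq[of "s *\<^sub>R u" "t *\<^sub>R v"] by simp
    also have "\<dots> \<le> h * norm u + h * norm v"
      using that by (intro add_mono mult_right_mono) auto
    also have "\<dots> < r" using h by (simp add: algebra_simps)
    finally have "norm (x - (x + s *\<^sub>R u + t *\<^sub>R v)) < r"
      by (metis add.assoc add_diff_cancel_left' norm_minus_commute)
    then show ?thesis by (simp add: dist_norm)
  qed
  define \<phi> where "\<phi> = (\<lambda>s. f (x + s *\<^sub>R u + h *\<^sub>R v) - f (x + s *\<^sub>R u))"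
  have d1: "(\<phi> has_derivative (\<lambda>k. k * (f' (x + s *\<^sub>R u + h *\<^sub>R v) u - f' (x + s *\<^sub>R u) u))) (at s)"
    if "0 \<le> s" "s \<le> h" for s
  proof -
    note D = f[OF inb[OF that, of h]] f[OF inb[OF that, of 0]]
    have lin: "linear (f' (x + s *\<^sub>R u + h *\<^sub>R v))" "linear (f' (x + s *\<^sub>R u))"
      using D h(1) has_derivative_linear by fastforce+
    have "((\<lambda>s. f (x + s *\<^sub>R u + h *\<^sub>R v)) has_derivative
        (\<lambda>k. f' (x + s *\<^sub>R u + h *\<^sub>R v) (k *\<^sub>R u))) (at s)"
      using h(1) D(1) by (intro has_derivative_compose[of "\<lambda>s. x + s *\<^sub>R u + h *\<^sub>R v" "\<lambda>k. k *\<^sub>R u" s UNIV f])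
        (auto intro!: derivative_eq_intros)
    moreover have "((\<lambda>s. f (x + s *\<^sub>R u)) has_derivative (\<lambda>k. f' (x + s *\<^sub>R u) (k *\<^sub>R u))) (at s)"
      using h(1) D(2) by (intro has_derivative_compose[of "\<lambda>s. x + s *\<^sub>R u" "\<lambda>k. k *\<^sub>R u" s UNIV f])
        (auto intro!: derivative_eq_intros)
    ultimately show ?thesis
      unfolding \<phi>_def using lin by (auto intro!: derivative_eq_intros simp: linear_cmul algebra_simps)
  qed
  have "continuous_on {0..h} \<phi>"
    by (rule continuous_at_imp_continuous_on) (use has_derivative_continuous[OF d1] in auto)
  from mvt[OF h(1) this d1]
  obtain s where s: "0 < s" "s < h"
    "\<phi> h - \<phi> 0 = h * (f' (x + s *\<^sub>R u + h *\<^sub>R v) u - f' (x + s *\<^sub>R u) u)"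
    by (metis diff_zero less_imp_le)
  define \<psi> where "\<psi> = (\<lambda>t. f' (x + s *\<^sub>R u + t *\<^sub>R v) u)"
  have d2: "(\<psi> has_derivative (\<lambda>k. k * f'' (x + s *\<^sub>R u + t *\<^sub>R v) v)) (at t)"
    if "0 \<le> t" "t \<le> h" for t
  proof -
    note D = f'[OF inb[OF _ _ that, of s]]
    have lin: "linear (f'' (x + s *\<^sub>R u + t *\<^sub>R v))" using D s has_derivative_linear by fastforce
    have "(\<psi> has_derivative (\<lambda>k. f'' (x + s *\<^sub>R u + t *\<^sub>R v) (k *\<^sub>R v))) (at t)"
      unfolding \<psi>_def using s D
      by (intro has_derivative_compose[of "\<lambda>t. x + s *\<^sub>R u + t *\<^sub>R v" "\<lambda>k. k *\<^sub>R v" t UNIV "\<lambda>y. f' y u"])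
        (auto intro!: derivative_eq_intros)
    then show ?thesis using lin by (simp add: linear_cmul)
  qed
  have "continuous_on {0..h} \<psi>"
    by (rule continuous_at_imp_continuous_on) (use has_derivative_continuous[OF d2] in auto)
  from mvt[OF h(1) this d2]
  obtain t where t: "0 < t" "t < h" "\<psi> h - \<psi> 0 = h * f'' (x + s *\<^sub>R u + t *\<^sub>R v) v"
    by (metis diff_zero less_imp_le)
  show ?thesis
  proof (rule that[of s t])
    have "f (x + h *\<^sub>R u + h *\<^sub>R v) - f (x + h *\<^sub>R u) - f (x + h *\<^sub>R v) + f x = \<phi> h - \<phi> 0"
      by (simp add: \<phi>_def)
    also have "\<dots> = h * (\<psi> h - \<psi> 0)" using s by (simp add: \<psi>_def)
    also have "\<dots> = h\<^sup>2 * f'' (x + s *\<^sub>R u + t *\<^sub>R v) v" using t by (simp add: power2_eq_square)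
    finally show "f (x + h *\<^sub>R u + h *\<^sub>R v) - f (x + h *\<^sub>R u) - f (x + h *\<^sub>R v) + f x
      = h\<^sup>2 * f'' (x + s *\<^sub>R u + t *\<^sub>R v) v" .
  qed (use s t in auto)
qed

text \<open>The second difference over a parallelogram does not change when its sides are exchanged.
  By the mean value form it equals \<open>h\<close> squared times either mixed derivative at some
  nearby point, and continuity moves both points to \<open>x\<close>.\<close>

lemma real_second_derivative_symmetric:
  fixes f :: "'a::euclidean_space \<Rightarrow> real"
  assumes S: "open S" "x \<in> S"
    and f: "\<And>y. y \<in> S \<Longrightarrow> (f has_derivative f' y) (at y)"
    and f': "\<And>y w. y \<in> S \<Longrightarrow> ((\<lambda>y. f' y w) has_derivative f'' y w) (at y)"
    and cont: "\<And>v w. continuous_on S (\<lambda>y. f'' y v w)"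
  shows "f'' x u v = f'' x v u"
proof (rule ccontr)
  assume ne: "f'' x u v \<noteq> f'' x v u"
  \<comment> \<open>Half the gap: values within \<open>e\<close> of the two sides cannot be
    equal.\<close>
  define e where "e = \<bar>f'' x u v - f'' x v u\<bar> / 2"
  have e: "e > 0" using ne by (simp add: e_def)
  have c: "isCont (\<lambda>y. f'' y v w) x" for v w
    using cont[of v w] S by (simp add: continuous_on_eq_continuous_at)
  obtain d0 where d0: "d0 > 0" "ball x d0 \<subseteq> S" using S open_contains_ball by blast
  obtain d1 where d1: "d1 > 0" "\<And>y. dist y x < d1 \<Longrightarrow> \<bar>f'' y u v - f'' x u v\<bar> < e"
    using c[of u v] e unfolding continuous_at_eps_delta dist_real_def by blast
  obtain d2 where d2: "d2 > 0" "\<And>y. dist y x < d2 \<Longrightarrow> \<bar>f'' y v u - f'' x v u\<bar> < e"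
    using c[of v u] e unfolding continuous_at_eps_delta dist_real_def by blast
  define r where "r = min d0 (min d1 d2)"
  have r: "r > 0" "ball x r \<subseteq> S" using d0 d1 d2 by (auto simp: r_def)
  \<comment> \<open>Keeps \<open>h * (norm u + norm v)\<close> below \<open>r / 2\<close>, so the
    parallelogram stays in \<open>ball x r\<close>; the \<open>+ 1\<close> covers
    \<open>u = v = 0\<close>.\<close>
  define h where "h = r / (2 * (norm u + norm v + 1))"
  have h0: "h > 0" using r by (auto simp: h_def intro!: divide_pos_pos add_nonneg_pos)
  have "h * (norm u + norm v) \<le> h * (norm u + norm v + 1)" using h0 by simp
  also have "\<dots> = r / 2"
    unfolding h_def using norm_ge_zero[of u] norm_ge_zero[of v]
    by (simp add: field_simps add_nonneg_eq_0_iff)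
  finally have h: "h * (norm u + norm v) < r" using r by simp
  have inb: "dist (x + s *\<^sub>R u + t *\<^sub>R v) x < r" if "0 \<le> s" "s \<le> h" "0 \<le> t" "t \<le> h" for s t
  proof -
    have "dist (x + s *\<^sub>R u + t *\<^sub>R v) x = norm (s *\<^sub>R u + t *\<^sub>R v)"
      by (simp add: dist_norm add.assoc)
    also have "\<dots> \<le> s * norm u + t * norm v"
      using that norm_triangle_ineq[of "s *\<^sub>R u" "t *\<^sub>R v"] by simp
    also have "\<dots> \<le> h * norm u + h * norm v"
      using that by (intro add_mono mult_right_mono) auto
    finally show ?thesis using h by (simp add: algebra_simps)
  qed
  have fb: "(f has_derivative f' y) (at y)" "((\<lambda>y. f' y w) has_derivative f'' y w) (at y)"
    if "y \<in> ball x r" for y w using that r f f' by auto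
  obtain s t where st: "0 \<le> s" "s \<le> h" "0 \<le> t" "t \<le> h"
    "f (x + h *\<^sub>R u + h *\<^sub>R v) - f (x + h *\<^sub>R u) - f (x + h *\<^sub>R v) + f x
      = h\<^sup>2 * f'' (x + s *\<^sub>R u + t *\<^sub>R v) u v"
    using real_second_difference_mvt[of x r f f' u "\<lambda>y. f'' y u" h v] fb h0 h by blast
  have h': "h * (norm v + norm u) < r" using h by (simp add: add.commute)
  obtain s' t' where st': "0 \<le> s'" "s' \<le> h" "0 \<le> t'" "t' \<le> h"
    "f (x + h *\<^sub>R v + h *\<^sub>R u) - f (x + h *\<^sub>R v) - f (x + h *\<^sub>R u) + f x
      = h\<^sup>2 * f'' (x + s' *\<^sub>R v + t' *\<^sub>R u) v u"
    using real_second_difference_mvt[of x r f f' v "\<lambda>y. f'' y v" h u] fb h0 h' by blast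
  have "h\<^sup>2 * f'' (x + s *\<^sub>R u + t *\<^sub>R v) u v = h\<^sup>2 * f'' (x + s' *\<^sub>R v + t' *\<^sub>R u) v u"
    unfolding st(5)[symmetric] st'(5)[symmetric] by (simp add: algebra_simps)
  then have eq: "f'' (x + s *\<^sub>R u + t *\<^sub>R v) u v = f'' (x + t' *\<^sub>R u + s' *\<^sub>R v) v u"
    using h0 by (simp add: algebra_simps)
  have "\<bar>f'' (x + s *\<^sub>R u + t *\<^sub>R v) u v - f'' x u v\<bar> < e"
    using d1(2) inb[OF st(1-4)] by (simp add: r_def)
  moreover have "\<bar>f'' (x + t' *\<^sub>R u + s' *\<^sub>R v) v u - f'' x v u\<bar> < e"
    using d2(2) inb[OF st'(3,4,1,2)] by (simp add: r_def)
  ultimately have "\<bar>f'' x u v - f'' x v u\<bar> < 2 * e" using eq by linarith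
  then show False by (simp add: e_def)
qed

lemma second_derivative_symmetric:
  fixes f :: "'a::euclidean_space \<Rightarrow> 'b::euclidean_space"
  assumes f: "smooth_on S f" and S: "open S" "x \<in> S"
  shows "frechet_derivative (\<lambda>y. frechet_derivative f (at y) u) (at x) v
       = frechet_derivative (\<lambda>y. frechet_derivative f (at y) v) (at x) u"
proof (rule euclidean_eqI)
  fix b :: 'b assume "b \<in> Basis"
  let ?f'' = "\<lambda>y u v. frechet_derivative (\<lambda>y. frechet_derivative f (at y) u) (at y) v"
  note f1 = smooth_on_frechet[OF f]
  note f2 = smooth_on_frechet[OF f1]
  show "?f'' x u v \<bullet> b = ?f'' x v u \<bullet> b"
  proof (rule real_second_derivative_symmetric[where S=S and f="\<lambda>y. f y \<bullet> b"
        and f'="\<lambda>y v. frechet_derivative f (at y) v \<bullet> b" and f''="\<lambda>y u v. ?f'' y u v \<bullet> b"])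
    show "((\<lambda>y. f y \<bullet> b) has_derivative (\<lambda>v. frechet_derivative f (at y) v \<bullet> b)) (at y)"
      if "y \<in> S" for y
      using smooth_on_has_derivative[OF f S(1) that] by (intro has_derivative_inner_left)
    show "((\<lambda>y. frechet_derivative f (at y) w \<bullet> b) has_derivative (\<lambda>v. ?f'' y w v \<bullet> b)) (at y)"
      if "y \<in> S" for y w
      using smooth_on_has_derivative[OF f1 S(1) that] by (intro has_derivative_inner_left)
    show "continuous_on S (\<lambda>y. ?f'' y v w \<bullet> b)" for v w
      using smooth_on_continuous_on[OF f2] by (intro continuous_intros)
  qed (use S in auto)
qed

section \<open>Linear maps and linear systems that depend on a parameter\<close>

text \<open>Product rule for linear maps whose differentiability is known only at each fixed
  argument. Expanding the argument in the finite \<open>Basis\<close> reduces it to a finite sum, so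
  no operator norm is involved.\<close>

lemma has_derivative_linear_family:
  fixes G :: "'c::real_normed_vector \<Rightarrow> 'a::euclidean_space \<Rightarrow> 'b::real_normed_vector"
  assumes lin: "eventually (\<lambda>s. linear (G s)) (nhds x)"
    and G: "\<And>a. ((\<lambda>s. G s a) has_derivative DG a) (at x)"
    and X: "(X has_derivative X') (at x)"
  shows "((\<lambda>s. G s (X s)) has_derivative (\<lambda>h. DG (X x) h + G x (X' h))) (at x)"
proof -
  have linx: "linear (G x)" using lin by (rule eventually_nhds_x_imp_x)
  have rep: "linear L \<Longrightarrow> L a = (\<Sum>i\<in>Basis. (a \<bullet> i) *\<^sub>R L i)" for L :: "'a \<Rightarrow> 'b" and a
    by (subst euclidean_representation[of a, symmetric]) (simp add: linear_sum linear_cmul)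
  have ev: "eventually (\<lambda>s. (\<Sum>i\<in>Basis. (Y s \<bullet> i) *\<^sub>R G s i) = G s (Y s)) (nhds x)" for Y
    using lin by eventually_elim (simp add: rep[symmetric])
  have D: "((\<lambda>s. G s (Y s)) has_derivative
      (\<lambda>h. \<Sum>i\<in>Basis. (Y x \<bullet> i) *\<^sub>R DG i h + (Y' h \<bullet> i) *\<^sub>R G x i)) (at x)"
    if Y: "(Y has_derivative Y') (at x)" for Y Y'
  proof -
    have "((\<lambda>s. \<Sum>i\<in>Basis. (Y s \<bullet> i) *\<^sub>R G s i) has_derivative
      (\<lambda>h. \<Sum>i\<in>Basis. (Y x \<bullet> i) *\<^sub>R DG i h + (Y' h \<bullet> i) *\<^sub>R G x i)) (at x)"
      by (intro has_derivative_sum has_derivative_scaleR has_derivative_inner_left Y G)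
    moreover have "eventually (\<lambda>s. (\<Sum>i\<in>Basis. (Y s \<bullet> i) *\<^sub>R G s i) = G s (Y s)) (at x)"
      using ev[of Y] by (simp add: eventually_nhds_conv_at)
    ultimately show ?thesis
      using eventually_nhds_x_imp_x[OF ev[of Y]]
      by (rule has_derivative_transform_eventually) auto
  qed
  \<comment> \<open>Linearity of \<open>DG\<close> in its first argument is derived here, from the
    rule for a constant argument and uniqueness of derivatives.\<close>
  have "((\<lambda>s. G s (X x)) has_derivative (\<lambda>h. \<Sum>i\<in>Basis. (X x \<bullet> i) *\<^sub>R DG i h)) (at x)"
    using D[OF has_derivative_const[of "X x"]] by simp
  then have *: "DG (X x) = (\<lambda>h. \<Sum>i\<in>Basis. (X x \<bullet> i) *\<^sub>R DG i h)"
    using G[of "X x"] has_derivative_unique by blast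
  show ?thesis
    using D[OF X] unfolding * sum.distrib rep[OF linx, of "X' _", symmetric] .
qed

text \<open>The linear rule used twice, first with the left argument frozen. It serves for metric
  coefficients and for Christoffel symbols along a coordinate change.\<close>

lemma has_derivative_bilinear_family:
  fixes F :: "'d::real_normed_vector \<Rightarrow> 'a::euclidean_space \<Rightarrow> 'a \<Rightarrow> 'b::real_normed_vector"
  assumes S: "open S" "p x \<in> S"
    and lin: "\<And>y. y \<in> S \<Longrightarrow> bilinear (F y)"
    and F: "\<And>a b. ((\<lambda>y. F y a b) has_derivative DF a b) (at (p x))"
    and p: "(p has_derivative p') (at x)"
    and X: "(X has_derivative X') (at x)" and Y: "(Y has_derivative Y') (at x)"
  shows "((\<lambda>s. F (p s) (X s) (Y s)) has_derivative
    (\<lambda>h. DF (X x) (Y x) (p' h) + F (p x) (X x) (Y' h) + F (p x) (X' h) (Y x))) (at x)"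
proof -
  have ev: "eventually (\<lambda>s. p s \<in> S) (nhds x)"
    using has_derivative_continuous[OF p] S topological_tendstoD[of p "p x" "at x" S]
    by (simp add: continuous_at eventually_nhds_conv_at)
  have Fp: "((\<lambda>s. F (p s) a b) has_derivative (\<lambda>h. DF a b (p' h))) (at x)" for a b
    using has_derivative_compose[OF p F] .
  have "((\<lambda>s. F (p s) a (Y s)) has_derivative (\<lambda>h. DF a (Y x) (p' h) + F (p x) a (Y' h))) (at x)" for a
    by (rule has_derivative_linear_family[OF _ Fp Y])
      (use ev lin in \<open>auto simp: bilinear_def elim: eventually_mono\<close>)
  note D = has_derivative_linear_family[where G="\<lambda>s a. F (p s) a (Y s)", OF _ this X]
  show ?thesis
    unfolding add.assoc[symmetric]
    by (rule D) (use ev lin in \<open>auto simp: bilinear_def elim: eventually_mono\<close>)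
qed

text \<open>A substitute for Cramer's rule, meant for Christoffel symbols, which are given only as
  solutions of a linear system. After multiplication by a left inverse of \<open>G x\<close> the
  system reads \<open>H s (y s) = E s\<close>, where \<open>H x\<close> is the identity and
  \<open>E x = 0\<close>. Hence \<open>y\<close> differs from \<open>E\<close> by a term of smaller
  order than \<open>norm (s - x)\<close> and has the same derivative. Continuity of \<open>z\<close>
  is not assumed but comes out of the estimate.\<close>

lemma differentiable_linear_solution:
  fixes G :: "'c::real_normed_vector \<Rightarrow> 'a::euclidean_space \<Rightarrow> 'a"
  assumes S: "open S" "x \<in> S"
    and lin: "\<And>s. s \<in> S \<Longrightarrow> linear (G s)" and inj: "inj (G x)"
    and G: "\<And>a. (\<lambda>s. G s a) differentiable (at x)"
    and K: "K differentiable (at x)" and z: "\<And>s. s \<in> S \<Longrightarrow> G s (z s) = K s"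
  shows "z differentiable (at x)"
proof -
  obtain L where L: "linear L" "L \<circ> G x = id"
    using linear_injective_left_inverse[OF lin[OF S(2)] inj] by blast
  have Lx: "L (G x a) = a" for a using L(2) by (metis comp_apply id_apply)
  define H where "H = (\<lambda>s a. L (G s a))"
  have Hlin: "linear (H s)" if "s \<in> S" for s
    using linear_compose[OF lin[OF that] L(1)] by (simp add: H_def comp_def)
  have Ldiff: "(\<lambda>s. L (f s)) differentiable (at x)" if "f differentiable (at x)" for f :: "'c \<Rightarrow> 'a"
    using that L(1) by (metis differentiable_compose linear_imp_differentiable)
  define y where "y = (\<lambda>s. z s - z x)"
  define E where "E = (\<lambda>s. L (K s) - H s (z x))"
  have Hd: "(\<lambda>s. H s a) differentiable (at x)" for a unfolding H_def by (rule Ldiff[OF G])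
  have Ed: "E differentiable (at x)" unfolding E_def
    by (rule differentiable_diff[OF Ldiff[OF K] Hd])
  have Ex: "E x = 0" using z[OF S(2)] by (simp add: E_def H_def)
  have HyE: "H s (y s) = E s" if "s \<in> S" for s
    using linear_diff[OF Hlin[OF that]] z[OF that] by (simp add: E_def y_def H_def)
  \<comment> \<open>Bounds the operator norm of \<open>H s - id\<close> and tends to
    \<open>0\<close>, because finitely many basis vectors determine it.\<close>
  define \<rho> where "\<rho> = (\<lambda>s. \<Sum>i\<in>Basis. norm (H s i - i))"
  have \<rho>0: "\<rho> s \<ge> 0" for s by (auto simp: \<rho>_def intro: sum_nonneg)
  have \<rho>b: "norm (H s a - a) \<le> \<rho> s * norm a" if "s \<in> S" for s a
  proof -
    have "H s a = H s (\<Sum>i\<in>Basis. (a \<bullet> i) *\<^sub>R i)" by (simp add: euclidean_representation)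
    also have "\<dots> = (\<Sum>i\<in>Basis. (a \<bullet> i) *\<^sub>R H s i)"
      by (simp add: linear_sum[OF Hlin[OF that]] linear_cmul[OF Hlin[OF that]])
    finally have "H s a - a = (\<Sum>i\<in>Basis. (a \<bullet> i) *\<^sub>R (H s i - i))"
      by (simp add: scaleR_diff_right sum_subtractf euclidean_representation)
    also have "norm \<dots> \<le> (\<Sum>i\<in>Basis. norm a * norm (H s i - i))"
      by (rule sum_norm_le) (auto intro!: mult_right_mono simp: Basis_le_norm)
    finally show ?thesis by (simp add: \<rho>_def sum_distrib_left mult.commute)
  qed
  have "((\<lambda>s. H s i) \<longlongrightarrow> i) (at x)" for i
    using differentiable_imp_continuous_within[OF Hd[of i]] Lx by (simp add: isCont_def H_def)
  then have "((\<lambda>s. H s i - i) \<longlongrightarrow> 0) (at x)" for i by (simp add: LIM_zero)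
  then have \<rho>lim: "(\<rho> \<longlongrightarrow> 0) (at x)" unfolding \<rho>_def by (intro tendsto_null_sum tendsto_norm_zero)
  \<comment> \<open>Once the deviation from the identity is at most \<open>1/2\<close>, it can be
    absorbed: \<open>norm (y s) \<le> 2 * norm (E s)\<close>.\<close>
  have est: "norm (y s - E s) \<le> 2 * \<rho> s * norm (E s)" if "s \<in> S" "\<rho> s \<le> 1/2" for s
  proof -
    have 1: "norm (E s - y s) \<le> \<rho> s * norm (y s)" using \<rho>b[OF that(1), of "y s"] HyE[OF that(1)] by simp
    have "norm (y s) \<le> norm (E s) + norm (E s - y s)"
      by (metis norm_minus_commute norm_triangle_sub)
    also have "\<dots> \<le> norm (E s) + (1/2) * norm (y s)"
      using 1 mult_right_mono[OF that(2), of "norm (y s)"] by simp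
    finally have "norm (y s) \<le> 2 * norm (E s)" by simp
    then have "\<rho> s * norm (y s) \<le> \<rho> s * (2 * norm (E s))" by (intro mult_left_mono \<rho>0)
    with 1 show ?thesis by (simp add: norm_minus_commute)
  qed
  obtain E' where E': "(E has_derivative E') (at x)" using Ed by (auto simp: differentiable_def)
  have bl: "bounded_linear E'" using E' has_derivative_bounded_linear by blast
  obtain B where B: "\<And>h. norm (E' h) \<le> norm h * B" using bounded_linear.bounded[OF bl] by blast
  have lim: "((\<lambda>s. (E s - E' (s - x)) /\<^sub>R norm (s - x)) \<longlongrightarrow> 0) (at x)"
    using E' Ex unfolding has_derivative_at_within by simp
  have "((\<lambda>s. norm ((E s - E' (s - x)) /\<^sub>R norm (s - x))
      + 2 * \<rho> s * (norm ((E s - E' (s - x)) /\<^sub>R norm (s - x)) + \<bar>B\<bar>)) \<longlongrightarrow> 0 + 2 * 0 * (0 + \<bar>B\<bar>)) (at x)"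
    by (intro tendsto_intros tendsto_norm_zero lim \<rho>lim)
  then have lim2: "((\<lambda>s. norm ((E s - E' (s - x)) /\<^sub>R norm (s - x))
      + 2 * \<rho> s * (norm ((E s - E' (s - x)) /\<^sub>R norm (s - x)) + \<bar>B\<bar>)) \<longlongrightarrow> 0) (at x)" by simp
  have evS: "eventually (\<lambda>s. s \<in> S) (at x)" using S by (simp add: eventually_at_in_open')
  have ev\<rho>: "eventually (\<lambda>s. \<rho> s < 1/2) (at x)" using \<rho>lim by (rule order_tendstoD) simp
  have "((\<lambda>s. (y s - E' (s - x)) /\<^sub>R norm (s - x)) \<longlongrightarrow> 0) (at x)"
  proof (rule Lim_null_comparison[OF _ lim2])
    show "eventually (\<lambda>s. norm ((y s - E' (s - x)) /\<^sub>R norm (s - x)) \<le>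
      norm ((E s - E' (s - x)) /\<^sub>R norm (s - x))
      + 2 * \<rho> s * (norm ((E s - E' (s - x)) /\<^sub>R norm (s - x)) + \<bar>B\<bar>)) (at x)"
      using evS ev\<rho> eventually_neq_at_within[of x x UNIV]
    proof eventually_elim
      case (elim s)
      define n where "n = norm (s - x)"
      have n: "n > 0" using elim by (simp add: n_def)
      have "norm (E' (s - x)) \<le> n * \<bar>B\<bar>"
        using B[of "s - x"] n by (simp add: n_def) (meson abs_ge_self mult_left_mono norm_ge_zero order_trans)
      then have E1: "norm (E s) \<le> norm (E s - E' (s - x)) + n * \<bar>B\<bar>"
        using norm_triangle_sub[of "E s" "E' (s - x)"] by linarith
      have "norm (y s - E' (s - x)) \<le> norm (E s - E' (s - x)) + norm (y s - E s)"
        using norm_triangle_ineq[of "E s - E' (s - x)" "y s - E s"] by simp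
      also have "\<dots> \<le> norm (E s - E' (s - x)) + 2 * \<rho> s * norm (E s)"
        using est[of s] elim by simp
      also have "\<dots> \<le> norm (E s - E' (s - x)) + 2 * \<rho> s * (norm (E s - E' (s - x)) + n * \<bar>B\<bar>)"
        using \<rho>0[of s] E1 by (intro add_left_mono mult_left_mono) auto
      finally have "norm (y s - E' (s - x)) / n \<le>
        (norm (E s - E' (s - x)) + 2 * \<rho> s * (norm (E s - E' (s - x)) + n * \<bar>B\<bar>)) / n"
        using n by (intro divide_right_mono) auto
      also have "\<dots> = norm (E s - E' (s - x)) / n + 2 * \<rho> s * (norm (E s - E' (s - x)) / n + \<bar>B\<bar>)"
        using n by (simp add: field_simps)
      finally show ?case using n by (simp add: n_def[symmetric] divide_inverse mult.commute)
    qed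
  qed
  then have "(y has_derivative E') (at x)"
    unfolding has_derivative_at_within using bl by (simp add: y_def)
  then have "((\<lambda>s. y s + z x) has_derivative E') (at x)"
    by (auto intro!: derivative_eq_intros)
  then show ?thesis by (auto simp: y_def differentiable_def)
qed

section \<open>Levi-Civita connection in coordinates\<close>

text \<open>This and the next two definitions repeat the chart formulas for an arbitrary coefficient
  function \<open>h\<close>, so that transformation laws become statements about a map between two
  open sets of coordinate space.\<close>

definition koszul :: "('e::euclidean_space \<Rightarrow> 'e \<Rightarrow> 'e \<Rightarrow> real) \<Rightarrow> 'e \<Rightarrow> 'e \<Rightarrow> 'e \<Rightarrow> 'e \<Rightarrow> real" where
  "koszul h x u v w =
    (frechet_derivative (\<lambda>y. h y v w) (at x) u
     + frechet_derivative (\<lambda>y. h y u w) (at x) v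
     - frechet_derivative (\<lambda>y. h y u v) (at x) w) / 2"

definition levi_civita :: "('e::euclidean_space \<Rightarrow> 'e \<Rightarrow> 'e \<Rightarrow> real) \<Rightarrow> 'e \<Rightarrow> 'e \<Rightarrow> 'e \<Rightarrow> 'e" where
  "levi_civita h x u v = (THE z. \<forall>w. h x z w = koszul h x u v w)"

definition riemann :: "('e::euclidean_space \<Rightarrow> 'e \<Rightarrow> 'e \<Rightarrow> real) \<Rightarrow> 'e \<Rightarrow> 'e \<Rightarrow> 'e \<Rightarrow> 'e \<Rightarrow> 'e" where
  "riemann h x u v w =
    frechet_derivative (\<lambda>y. levi_civita h y v w) (at x) u
    - frechet_derivative (\<lambda>y. levi_civita h y u w) (at x) v
    + levi_civita h x u (levi_civita h x v w) - levi_civita h x v (levi_civita h x u w)"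

lemma frechet_derivative_eq: "(f has_derivative f') (at x) \<Longrightarrow> frechet_derivative f (at x) = f'"
  by (metis frechet_derivative_at)

lemma bilinear_simps:
  assumes "bilinear B"
  shows "B (x + y) z = B x z + B y z" "B x (y + z) = B x y + B x z"
    "B (x - y) z = B x z - B y z" "B x (y - z) = B x y - B x z"
    "B (c *\<^sub>R x) z = c *\<^sub>R B x z" "B x (c *\<^sub>R z) = c *\<^sub>R B x z"
    "B 0 z = 0" "B x 0 = 0"
  using assms by (simp_all add: bilinear_ladd bilinear_radd bilinear_lsub bilinear_rsub
      bilinear_lmul bilinear_rmul bilinear_lzero bilinear_rzero)

locale smooth_metric =
  fixes S :: "'e::euclidean_space set" and h :: "'e \<Rightarrow> 'e \<Rightarrow> 'e \<Rightarrow> real"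
  assumes open_S: "open S"
    and bil: "x \<in> S \<Longrightarrow> bilinear (h x)"
    and sym: "x \<in> S \<Longrightarrow> h x u v = h x v u"
    and nondeg: "x \<in> S \<Longrightarrow> (\<And>v. h x u v = 0) \<Longrightarrow> u = 0"
    and smooth: "smooth_on S (\<lambda>x. h x u v)"
begin

abbreviation "dh x u v \<equiv> frechet_derivative (\<lambda>y. h y u v) (at x)"
abbreviation "\<Gamma> \<equiv> levi_civita h"

lemma dh: "x \<in> S \<Longrightarrow> ((\<lambda>y. h y u v) has_derivative dh x u v) (at x)"
  by (rule smooth_on_has_derivative[OF smooth open_S])

lemma dh_eqI:
  assumes "x \<in> S" "(f has_derivative f') (at x)" "\<And>y. y \<in> S \<Longrightarrow> f y = h y u v"
  shows "dh x u v = f'"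
  by (rule frechet_derivative_eq, rule has_derivative_transform_within_open[OF assms(2) open_S assms(1)])
    (rule assms(3))

lemma dh_sym: "x \<in> S \<Longrightarrow> dh x u v = dh x v u"
  by (rule dh_eqI[OF _ dh]) (auto simp: sym)

lemma dh_add: "x \<in> S \<Longrightarrow> dh x (u + u') v a = dh x u v a + dh x u' v a"
  using dh_eqI[OF _ has_derivative_add[OF dh[of x u v] dh[of x u' v]], of "u + u'" v]
  by (simp add: bilinear_simps(1)[OF bil])

lemma dh_scaleR: "x \<in> S \<Longrightarrow> dh x (c *\<^sub>R u) v a = c * dh x u v a"
  using dh_eqI[OF _ has_derivative_scaleR_right[OF dh[of x u v], of c], of "c *\<^sub>R u" v]
  by (simp add: bilinear_simps(5)[OF bil])

lemma dh_add': "x \<in> S \<Longrightarrow> dh x v (u + u') a = dh x v u a + dh x v u' a"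
  by (metis dh_add dh_sym)

lemma dh_scaleR': "x \<in> S \<Longrightarrow> dh x v (c *\<^sub>R u) a = c * dh x v u a"
  by (metis dh_scaleR dh_sym)

lemma dh_linear: "x \<in> S \<Longrightarrow> linear (dh x u v)"
  using dh has_derivative_linear by blast

lemma koszul_linear:
  assumes x: "x \<in> S"
  shows "linear (koszul h x u v)" "linear (\<lambda>u. koszul h x u v w)" "linear (\<lambda>v. koszul h x u v w)"
  using dh_add[OF x] dh_scaleR[OF x] dh_add'[OF x] dh_scaleR'[OF x]
  by (auto intro!: linearI simp: koszul_def linear_add[OF dh_linear[OF x]] linear_cmul[OF dh_linear[OF x]]
      algebra_simps add_divide_distrib diff_divide_distrib)

lemma koszul_sym: "x \<in> S \<Longrightarrow> koszul h x u v w = koszul h x v u w"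
  by (simp add: koszul_def dh_sym[of x u v])

text \<open>Lowering an index: the coordinates of \<open>gram x z\<close> are those of the covector
  \<open>h x z\<close>. The equation that defines the connection becomes a square linear
  system.\<close>

definition gram :: "'e \<Rightarrow> 'e \<Rightarrow> 'e" where
  "gram x z = (\<Sum>b\<in>Basis. h x z b *\<^sub>R b)"

lemma gram_inner: "b \<in> Basis \<Longrightarrow> gram x z \<bullet> b = h x z b"
  by (simp add: gram_def inner_sum_left inner_Basis if_distrib sum.If_cases cong: if_cong)

lemma gram_linear: "x \<in> S \<Longrightarrow> linear (gram x)"
  by (auto intro!: linearI simp: gram_def bilinear_simps[OF bil] scaleR_left_distrib sum.distrib scaleR_sum_right)

lemma h_expand: "x \<in> S \<Longrightarrow> h x z w = (\<Sum>b\<in>Basis. (w \<bullet> b) * h x z b)"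
proof -
  assume x: "x \<in> S"
  have lin: "linear (h x z)" using bil[OF x] by (simp add: bilinear_def)
  have "h x z w = h x z (\<Sum>b\<in>Basis. (w \<bullet> b) *\<^sub>R b)" by (simp add: euclidean_representation)
  also have "\<dots> = (\<Sum>b\<in>Basis. (w \<bullet> b) * h x z b)" by (simp add: linear_sum[OF lin] linear_cmul[OF lin])
  finally show ?thesis .
qed

lemma gram_inj: assumes x: "x \<in> S" shows "inj (gram x)"
proof (subst linear_injective_0[OF gram_linear[OF x]], intro allI impI)
  fix z assume "gram x z = 0"
  then have "h x z b = 0" if "b \<in> Basis" for b using gram_inner[OF that, of x z] by simp
  then have "h x z w = 0" for w using h_expand[OF x, of z w] by simp
  then show "z = 0" using nondeg[OF x] by blast
qed

text \<open>Nondegeneracy makes \<open>gram x\<close> injective, hence surjective in finite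
  dimension. Since \<open>levi_civita\<close> is a definite description, its properties all rest on
  this.\<close>

lemma levi_civita_ex1:
  assumes x: "x \<in> S" shows "\<exists>!z. \<forall>w. h x z w = koszul h x u v w"
proof (rule ex_ex1I)
  note lin = koszul_linear(1)[OF x, of u v]
  have "surj (gram x)" by (rule linear_injective_imp_surjective[OF gram_linear[OF x] gram_inj[OF x]]) simp
  then obtain z where z: "gram x z = (\<Sum>b\<in>Basis. koszul h x u v b *\<^sub>R b)" by (metis surjD)
  have hz: "h x z b = koszul h x u v b" if "b \<in> Basis" for b
    using gram_inner[OF that, of x z] that
    by (simp add: z inner_sum_left inner_Basis if_distrib sum.If_cases cong: if_cong)
  have "h x z w = koszul h x u v w" for w
  proof -
    have "koszul h x u v w = koszul h x u v (\<Sum>b\<in>Basis. (w \<bullet> b) *\<^sub>R b)" by (simp add: euclidean_representation)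
    also have "\<dots> = (\<Sum>b\<in>Basis. (w \<bullet> b) * koszul h x u v b)" by (simp add: linear_sum[OF lin] linear_cmul[OF lin])
    finally show ?thesis using h_expand[OF x, of z w] hz by simp
  qed
  then show "\<exists>z. \<forall>w. h x z w = koszul h x u v w" by blast
next
  fix z z' assume "\<forall>w. h x z w = koszul h x u v w" "\<forall>w. h x z' w = koszul h x u v w"
  then have "h x (z - z') w = 0" for w by (simp add: bilinear_simps[OF bil[OF x]])
  then show "z = z'" using nondeg[OF x, of "z - z'"] by simp
qed

lemma levi_civita: "x \<in> S \<Longrightarrow> h x (\<Gamma> x u v) w = koszul h x u v w"
  unfolding levi_civita_def using theI'[OF levi_civita_ex1] by blast

lemma levi_civita_eqI: "x \<in> S \<Longrightarrow> (\<And>w. h x z w = koszul h x u v w) \<Longrightarrow> \<Gamma> x u v = z"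
  unfolding levi_civita_def using the1_equality[OF levi_civita_ex1] by blast

lemma levi_civita_sym: "x \<in> S \<Longrightarrow> \<Gamma> x u v = \<Gamma> x v u"
  by (rule levi_civita_eqI) (auto simp: levi_civita koszul_sym)

lemma levi_civita_bilinear: assumes x: "x \<in> S" shows "bilinear (\<Gamma> x)"
proof -
  have *: "linear (\<Gamma> x u)" for u
    using linear_add[OF koszul_linear(3)[OF x]] linear_cmul[OF koszul_linear(3)[OF x]]
    by (auto intro!: linearI levi_civita_eqI[OF x] simp: bilinear_simps[OF bil[OF x]] levi_civita[OF x])
  have "(\<lambda>u. \<Gamma> x u v) = \<Gamma> x v" for v by (rule ext) (rule levi_civita_sym[OF x])
  then show ?thesis using * by (simp add: bilinear_def)
qed

text \<open>The matrix \<open>gram\<close> and the right-hand side of its linear system are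
  differentiable, the latter because it consists of first derivatives of smooth
  coefficients.\<close>

lemma levi_civita_differentiable:
  assumes x: "x \<in> S" shows "(\<lambda>y. \<Gamma> y u v) differentiable (at x)"
proof (rule differentiable_linear_solution[where G=gram, OF open_S x gram_linear gram_inj[OF x]])
  show "(\<lambda>s. gram s a) differentiable at x" for a
    unfolding gram_def
    by (intro differentiable_sum) (use has_derivative_scaleR_left[OF dh[OF x]] in \<open>auto simp: differentiable_def\<close>)
  have d: "(\<lambda>y. dh y a b c) differentiable at x" for a b c
    using smooth_on_has_derivative[OF smooth_on_frechet[OF smooth] open_S x] by (auto simp: differentiable_def)
  show "(\<lambda>y. \<Sum>b\<in>Basis. koszul h y u v b *\<^sub>R b) differentiable at x"
    unfolding koszul_def divide_inverse
    by (intro differentiable_sum ballI differentiable_scaleR differentiable_const differentiable_mult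
        differentiable_diff differentiable_add d finite_Basis)
  show "gram s (\<Gamma> s u v) = (\<Sum>b\<in>Basis. koszul h s u v b *\<^sub>R b)" if "s \<in> S" for s
    by (simp add: gram_def levi_civita[OF that])
qed

lemma has_derivative_levi_civita:
  "x \<in> S \<Longrightarrow> ((\<lambda>y. \<Gamma> y u v) has_derivative frechet_derivative (\<lambda>y. \<Gamma> y u v) (at x)) (at x)"
  using levi_civita_differentiable frechet_derivative_works by blast

lemma frechet_levi_civita_scaleR:
  assumes x: "x \<in> S"
  shows "frechet_derivative (\<lambda>y. \<Gamma> y (a *\<^sub>R u) (b *\<^sub>R v)) (at x) (c *\<^sub>R w) =
    (a * b * c) *\<^sub>R frechet_derivative (\<lambda>y. \<Gamma> y u v) (at x) w"
proof -
  have "((\<lambda>y. (a * b) *\<^sub>R \<Gamma> y u v) has_derivative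
      (\<lambda>w. (a * b) *\<^sub>R frechet_derivative (\<lambda>y. \<Gamma> y u v) (at x) w)) (at x)"
    by (rule has_derivative_scaleR_right[OF has_derivative_levi_civita[OF x]])
  then have "((\<lambda>y. \<Gamma> y (a *\<^sub>R u) (b *\<^sub>R v)) has_derivative
      (\<lambda>w. (a * b) *\<^sub>R frechet_derivative (\<lambda>y. \<Gamma> y u v) (at x) w)) (at x)"
    by (rule has_derivative_transform_within_open[OF _ open_S x])
      (simp add: bilinear_simps[OF levi_civita_bilinear])
  then show ?thesis
    using has_derivative_linear[OF has_derivative_levi_civita[OF x]]
    by (simp add: frechet_derivative_eq linear_cmul)
qed

text \<open>The scaling part of trilinearity; a reparametrization multiplies the two velocity
  arguments by its speed factor.\<close>

lemma riemann_scaleR: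
  assumes x: "x \<in> S"
  shows "riemann h x (a *\<^sub>R u) (b *\<^sub>R v) (c *\<^sub>R w) = (a * b * c) *\<^sub>R riemann h x u v w"
proof -
  note [simp] = bilinear_simps[OF levi_civita_bilinear[OF x]]
  have "a * b * c = b * c * a" "a * c * b = b * c * a" by auto
  then show ?thesis
    by (simp add: riemann_def frechet_levi_civita_scaleR[OF x] algebra_simps)
qed

end

section \<open>Transformation laws under isometries\<close>

text \<open>Model of a coordinate change. Surjectivity of the differential lets every test vector on
  the target side be written as an image.\<close>

locale metric_isometry = M: smooth_metric S h + N: smooth_metric T k
  for S T :: "'e::euclidean_space set" and h k +
  fixes \<tau> :: "'e \<Rightarrow> 'e"
  assumes \<tau>: "smooth_on S \<tau>" and \<tau>_in: "x \<in> S \<Longrightarrow> \<tau> x \<in> T"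
    and isometry: "x \<in> S \<Longrightarrow>
      h x u v = k (\<tau> x) (frechet_derivative \<tau> (at x) u) (frechet_derivative \<tau> (at x) v)"
    and surj: "x \<in> S \<Longrightarrow> surj (frechet_derivative \<tau> (at x))"
begin

abbreviation "J x u \<equiv> frechet_derivative \<tau> (at x) u"
abbreviation "H x u v \<equiv> frechet_derivative (\<lambda>y. J y u) (at x) v"

lemma J: "x \<in> S \<Longrightarrow> (\<tau> has_derivative J x) (at x)"
  by (rule smooth_on_has_derivative[OF \<tau> M.open_S])

lemma J_linear: "x \<in> S \<Longrightarrow> linear (J x)"
  using J has_derivative_linear by blast

lemma H: "x \<in> S \<Longrightarrow> ((\<lambda>y. J y u) has_derivative H x u) (at x)"
  by (rule smooth_on_has_derivative[OF smooth_on_frechet[OF \<tau>] M.open_S])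

lemma H_sym: "x \<in> S \<Longrightarrow> H x u v = H x v u"
  by (rule second_derivative_symmetric[OF \<tau> M.open_S])

lemma dh_eq:
  assumes x: "x \<in> S"
  shows "M.dh x v w u = N.dh (\<tau> x) (J x v) (J x w) (J x u)
    + k (\<tau> x) (J x v) (H x w u) + k (\<tau> x) (H x v u) (J x w)"
proof -
  note D = has_derivative_bilinear_family[where F=k and p=\<tau>, OF N.open_S \<tau>_in[OF x] N.bil N.dh[OF \<tau>_in[OF x]]
      J[OF x] H[OF x, of v] H[OF x, of w]]
  show ?thesis
    by (rule M.dh_eqI[OF x D, THEN fun_cong]) (auto simp: isometry)
qed

text \<open>Inserting \<open>dh_eq\<close> into the Koszul formula produces six terms with second
  derivatives of \<open>\<tau>\<close>. By the symmetries of \<open>H\<close> and \<open>k\<close>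
  four of them cancel, and the other two add up to
  \<open>2 * k (\<tau> x) (H x u v) w\<close>.\<close>

lemma levi_civita_transform:
  assumes x: "x \<in> S"
  shows "J x (levi_civita h x u v) = H x u v + levi_civita k (\<tau> x) (J x u) (J x v)"
proof -
  note bil = bilinear_simps[OF N.bil[OF \<tau>_in[OF x]]] and sym = N.sym[OF \<tau>_in[OF x]]
  have "levi_civita k (\<tau> x) (J x u) (J x v) = J x (levi_civita h x u v) - H x u v"
  proof (rule N.levi_civita_eqI[OF \<tau>_in[OF x]])
    fix w
    obtain w' where w: "w = J x w'" using surj[OF x] by (metis surjD)
    have "k (\<tau> x) (J x (levi_civita h x u v)) w = koszul h x u v w'"
      by (simp add: w isometry[OF x, symmetric] M.levi_civita[OF x])
    also have "\<dots> = koszul k (\<tau> x) (J x u) (J x v) w + k (\<tau> x) (H x u v) w"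
      using H_sym[OF x, of u v] H_sym[OF x, of u w'] H_sym[OF x, of v w']
        sym[of "J x v" "H x u w'"] sym[of "J x u" "H x v w'"] sym[of "H x u v" "J x w'"]
        sym[of "J x u" "J x v"] sym[of "H x w' v" "J x u"]
      by (simp add: koszul_def dh_eq[OF x] w field_simps)
    finally show "k (\<tau> x) (J x (levi_civita h x u v) - H x u v) w
        = koszul k (\<tau> x) (J x u) (J x v) w"
      by (simp add: bil)
  qed
  then show ?thesis by simp
qed

text \<open>Differentiating the law for the connection gives one for its derivative. Third
  derivatives of \<open>\<tau>\<close> are symmetric in \<open>u\<close> and \<open>v\<close> and
  drop out of the antisymmetric combination; terms with second derivatives cancel by symmetry of
  \<open>H\<close>, partly against the quadratic terms of the curvature.\<close>

lemma riemann_transform: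
  assumes x: "x \<in> S"
  shows "J x (riemann h x u v w) = riemann k (\<tau> x) (J x u) (J x v) (J x w)"
proof -
  let ?H3 = "\<lambda>v w. frechet_derivative (\<lambda>y. H y v w) (at x)"
  let ?G = "levi_civita h" and ?K = "levi_civita k"
  let ?DG = "\<lambda>v w. frechet_derivative (\<lambda>y. ?G y v w) (at x)"
  let ?DK = "\<lambda>v w. frechet_derivative (\<lambda>y. ?K y v w) (at (\<tau> x))"
  note bilK = bilinear_simps[OF N.levi_civita_bilinear[OF \<tau>_in[OF x]]]
  have H3: "((\<lambda>y. H y v w) has_derivative ?H3 v w) (at x)" for v w
    by (rule smooth_on_has_derivative[OF smooth_on_frechet[OF smooth_on_frechet[OF \<tau>]] M.open_S x])
  \<comment> \<open>The first two arguments are exchanged by symmetry of \<open>H\<close> near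
    \<open>x\<close>, the last two by symmetry of the second derivative of
    \<open>J _ w\<close>.\<close>
  have H3_swap: "?H3 v w u = ?H3 u w v" for u v w
  proof -
    have "((\<lambda>y. H y w v) has_derivative ?H3 v w) (at x)" for v w
      by (rule has_derivative_transform_within_open[OF H3 M.open_S x]) (simp add: H_sym)
    then have "?H3 w v = ?H3 v w" for v w using H3 has_derivative_unique by blast
    then show ?thesis
      using second_derivative_symmetric[OF smooth_on_frechet[OF \<tau>, of w] M.open_S x, of u v] by simp
  qed
  \<comment> \<open>Both sides of \<open>levi_civita_transform\<close> are differentiated in
    direction \<open>u\<close>, and the result is solved for this term.\<close>
  have JG: "J x (?DG v w u) = ?H3 v w u + ?DK (J x v) (J x w) (J x u) + ?K (\<tau> x) (J x v) (H x w u)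
      + ?K (\<tau> x) (H x v u) (J x w) - H x (?G x v w) u" for u v w
  proof -
    have lin: "eventually (\<lambda>s. linear (J s)) (nhds x)"
      using eventually_nhds_in_open[OF M.open_S x] by eventually_elim (rule J_linear)
    have L: "((\<lambda>y. J y (?G y v w)) has_derivative (\<lambda>u. H x (?G x v w) u + J x (?DG v w u))) (at x)"
      by (rule has_derivative_linear_family[OF lin H[OF x] M.has_derivative_levi_civita[OF x]])
    have "((\<lambda>y. H y v w + ?K (\<tau> y) (J y v) (J y w)) has_derivative
      (\<lambda>u. ?H3 v w u + (?DK (J x v) (J x w) (J x u) + ?K (\<tau> x) (J x v) (H x w u)
      + ?K (\<tau> x) (H x v u) (J x w)))) (at x)"
      by (intro has_derivative_add H3
        has_derivative_bilinear_family[where F="?K" and p=\<tau>, OF N.open_S \<tau>_in[OF x] N.levi_civita_bilinear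
          N.has_derivative_levi_civita[OF \<tau>_in[OF x]] J[OF x] H[OF x, of v] H[OF x, of w]])
    then have "((\<lambda>y. J y (?G y v w)) has_derivative
      (\<lambda>u. ?H3 v w u + (?DK (J x v) (J x w) (J x u) + ?K (\<tau> x) (J x v) (H x w u)
      + ?K (\<tau> x) (H x v u) (J x w)))) (at x)"
      by (rule has_derivative_transform_within_open[OF _ M.open_S x]) (simp add: levi_civita_transform)
    from fun_cong[OF has_derivative_unique[OF L this], of u]
    show ?thesis by (simp add: algebra_simps)
  qed
  show ?thesis
    unfolding riemann_def
    by (simp add: linear_add[OF J_linear[OF x]] linear_diff[OF J_linear[OF x]] JG
        levi_civita_transform[OF x] bilK H3_swap[of v w u] H_sym[OF x, of w u] H_sym[OF x, of w v]
        H_sym[OF x, of v u] H_sym[OF x, of "?G x v w" u] H_sym[OF x, of "?G x u w" v])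
qed

end

section \<open>Charts, tangent vectors and fields along curves\<close>

lemma Ck_on_subset: "Ck_on k S f \<Longrightarrow> U \<subseteq> S \<Longrightarrow> Ck_on k U f"
  by (induction k arbitrary: f) (auto intro: continuous_on_subset differentiable_on_subset)

lemma smooth_on_subset: "smooth_on S f \<Longrightarrow> U \<subseteq> S \<Longrightarrow> smooth_on U f"
  unfolding smooth_on_def using Ck_on_subset by blast

lemma smooth_metric_subset:
  assumes "smooth_metric S h" "open U" "U \<subseteq> S"
  shows "smooth_metric U h"
proof -
  interpret smooth_metric S h by fact
  show ?thesis
    using assms(2,3) bil sym nondeg smooth_on_subset[OF smooth assms(3)]
    by unfold_locales blast+
qed

lemma has_derivative_transform_nhds:
  assumes "(f has_derivative f') (at x)" "eventually (\<lambda>y. f y = g y) (nhds x)"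
  shows "(g has_derivative f') (at x)"
  using has_derivative_transform_eventually[OF assms(1)] assms(2) eventually_nhds_x_imp_x[OF assms(2)]
  by (simp add: eventually_nhds_conv_at)

text \<open>Indexed by the point of the manifold and not by its coordinates, so that the cocycle
  rule for three charts can be stated without \<open>chart_inv\<close>.\<close>

definition transition :: "('m, 'e::euclidean_space) chart \<Rightarrow> ('m, 'e) chart \<Rightarrow> 'm \<Rightarrow> 'e \<Rightarrow> 'e" where
  "transition c d p = frechet_derivative (snd d \<circ> chart_inv c) (at (snd c p))"

locale atlas =
  fixes A :: "('m::{t2_space, second_countable_topology}, 'e::euclidean_space) chart set"
  assumes atlas: "smooth_atlas A"
begin

lemma chart_at: obtains c where "c \<in> A" "p \<in> fst c"
proof -
  have "p \<in> (\<Union>c\<in>A. fst c)" using atlas unfolding smooth_atlas_def by blast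
  then show ?thesis using that by blast
qed

lemma chart_homeo: "c \<in> A \<Longrightarrow> homeomorphism (fst c) (snd c ` fst c) (snd c) (chart_inv c)"
  and chart_open: "c \<in> A \<Longrightarrow> open (fst c)" "c \<in> A \<Longrightarrow> open (snd c ` fst c)"
  using atlas unfolding smooth_atlas_def by blast+

lemma chart_inv1: "c \<in> A \<Longrightarrow> p \<in> fst c \<Longrightarrow> chart_inv c (snd c p) = p"
  using chart_homeo homeomorphism_apply1 by blast

lemma chart_inv2: "c \<in> A \<Longrightarrow> x \<in> snd c ` fst c \<Longrightarrow> snd c (chart_inv c x) = x"
  using chart_homeo homeomorphism_apply2 by blast

lemma chart_inv_in: "c \<in> A \<Longrightarrow> x \<in> snd c ` fst c \<Longrightarrow> chart_inv c x \<in> fst c"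
  using chart_inv1[of c] by auto

lemma chart_image_open:
  assumes "c \<in> A" "open U" shows "open (snd c ` (fst c \<inter> U))"
proof -
  have "snd c ` (fst c \<inter> U) = snd c ` fst c \<inter> chart_inv c -` U"
    using chart_inv1[OF assms(1)] by force
  moreover have "continuous_on (snd c ` fst c) (chart_inv c)"
    using chart_homeo[OF assms(1)] homeomorphism_cont2 by blast
  ultimately show ?thesis
    using continuous_open_preimage chart_open[OF assms(1)] assms(2) by metis
qed

lemma transition_smooth:
  "c \<in> A \<Longrightarrow> d \<in> A \<Longrightarrow> smooth_on (snd c ` (fst c \<inter> fst d)) (snd d \<circ> chart_inv c)"
  using atlas unfolding smooth_atlas_def by blast

lemma has_derivative_transition:
  assumes "c \<in> A" "d \<in> A" "p \<in> fst c" "p \<in> fst d"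
  shows "((snd d \<circ> chart_inv c) has_derivative transition c d p) (at (snd c p))"
  unfolding transition_def using assms
  by (intro smooth_on_has_derivative[OF transition_smooth chart_image_open[OF _ chart_open(1)]]) auto

lemma transition_linear:
  "c \<in> A \<Longrightarrow> d \<in> A \<Longrightarrow> p \<in> fst c \<Longrightarrow> p \<in> fst d \<Longrightarrow> linear (transition c d p)"
  using has_derivative_transition has_derivative_linear by blast

text \<open>Chain rule on the open image of the triple overlap. Together with
  \<open>transition_self\<close> it makes the differentials invertible.\<close>

lemma transition_comp:
  assumes "c \<in> A" "d \<in> A" "e \<in> A" "p \<in> fst c" "p \<in> fst d" "p \<in> fst e"
  shows "transition d e p (transition c d p u) = transition c e p u"
proof -
  let ?S = "snd c ` (fst c \<inter> (fst d \<inter> fst e))"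
  have S: "open ?S" "snd c p \<in> ?S"
    using assms by (auto intro!: chart_image_open chart_open)
  have "(snd d \<circ> chart_inv c) (snd c p) = snd d p" using chart_inv1 assms by simp
  then have "((snd e \<circ> chart_inv d) \<circ> (snd d \<circ> chart_inv c) has_derivative
      transition d e p \<circ> transition c d p) (at (snd c p))"
    using assms by (intro diff_chain_at has_derivative_transition) (simp_all add: has_derivative_transition)
  then have "((snd e \<circ> chart_inv c) has_derivative transition d e p \<circ> transition c d p) (at (snd c p))"
    by (rule has_derivative_transform_within_open[OF _ S]) (use assms in \<open>auto simp: chart_inv1\<close>)
  from has_derivative_unique[OF this has_derivative_transition]
  show ?thesis using assms by (metis comp_apply)
qed

lemma transition_self:
  assumes "c \<in> A" "p \<in> fst c" shows "transition c c p u = u"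
proof -
  have "((\<lambda>x. x) has_derivative (\<lambda>u. u)) (at (snd c p))" by simp
  then have "((snd c \<circ> chart_inv c) has_derivative (\<lambda>u. u)) (at (snd c p))"
    by (rule has_derivative_transform_within_open[OF _ chart_open(2)])
      (use assms in \<open>auto simp: chart_inv2\<close>)
  from has_derivative_unique[OF this has_derivative_transition]
  show ?thesis using assms by metis
qed

lemma transition_surj:
  assumes "c \<in> A" "d \<in> A" "p \<in> fst c" "p \<in> fst d" shows "surj (transition c d p)"
proof (rule surjI)
  show "transition c d p (transition d c p u) = u" for u
    using assms by (simp add: transition_comp transition_self)
qed

lemma coord_vec_eq:
  "coord_vec A c p u = (\<lambda>d. if d \<in> A \<and> p \<in> fst d then transition c d p u else 0)"
  unfolding coord_vec_def transition_def ..

text \<open>By the cocycle rule, compatibility with one chart around \<open>p\<close> implies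
  compatibility between any two.\<close>

lemma tangent_spaceI:
  assumes c: "c \<in> A" "p \<in> fst c"
    and v: "\<And>d. d \<in> A \<Longrightarrow> p \<in> fst d \<Longrightarrow> v d = transition c d p (v c)"
    and v0: "\<And>d. \<not> (d \<in> A \<and> p \<in> fst d) \<Longrightarrow> v d = 0"
  shows "v \<in> tangent_space A p"
proof -
  have "v = coord_vec A d p (v d)" if d: "d \<in> A" "p \<in> fst d" for d
  proof
    fix e
    show "v e = coord_vec A d p (v d) e"
    proof (cases "e \<in> A \<and> p \<in> fst e")
      case True
      then show ?thesis using v[of e] v[OF d] c d by (simp add: coord_vec_eq transition_comp)
    next
      case False
      then show ?thesis using v0 by (auto simp: coord_vec_eq)
    qed
  qed
  then show ?thesis unfolding tangent_space_def by blast
qed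

lemma coord_vec_in: "c \<in> A \<Longrightarrow> p \<in> fst c \<Longrightarrow> coord_vec A c p u \<in> tangent_space A p"
  by (rule tangent_spaceI[of c]) (auto simp: coord_vec_eq transition_comp)

lemma coord_vec_self: "c \<in> A \<Longrightarrow> p \<in> fst c \<Longrightarrow> coord_vec A c p u c = u"
  by (simp add: coord_vec_eq transition_self)

lemma tangent_eq: "v \<in> tangent_space A p \<Longrightarrow> c \<in> A \<Longrightarrow> p \<in> fst c \<Longrightarrow> coord_vec A c p (v c) = v"
  unfolding tangent_space_def by auto

lemma tangent_transition:
  "v \<in> tangent_space A p \<Longrightarrow> c \<in> A \<Longrightarrow> p \<in> fst c \<Longrightarrow> d \<in> A \<Longrightarrow> p \<in> fst d \<Longrightarrow>
    v d = transition c d p (v c)"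
  using tangent_eq[of v p c] by (metis coord_vec_eq)

lemma tangent_outside:
  assumes "v \<in> tangent_space A p" "\<not> (d \<in> A \<and> p \<in> fst d)" shows "v d = 0"
proof -
  obtain c where "c \<in> A" "p \<in> fst c" using chart_at .
  with tangent_eq[OF assms(1) this] assms(2) show ?thesis by (metis coord_vec_eq)
qed

lemma subspace_tangent_space: "subspace (tangent_space A p)"
proof -
  obtain c where c: "c \<in> A" "p \<in> fst c" using chart_at .
  note lin = transition_linear[OF c(1) _ c(2)]
  have out: "u d = 0" if "\<not> (d \<in> A \<and> p \<in> fst d)" "u \<in> tangent_space A p" for u d
    using tangent_outside[OF that(2,1)] .
  show ?thesis
    unfolding subspace_def
  proof (intro conjI ballI allI)
    show "0 \<in> tangent_space A p"
      by (rule tangent_spaceI[OF c]) (auto simp: linear_0[OF lin])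
    show "u + v \<in> tangent_space A p" if "u \<in> tangent_space A p" "v \<in> tangent_space A p" for u v
      by (rule tangent_spaceI[OF c])
        (use that in \<open>simp_all add: linear_add[OF lin] out tangent_transition[of _ p c, OF _ c]\<close>)
    show "a *\<^sub>R u \<in> tangent_space A p" if "u \<in> tangent_space A p" for a u
      by (rule tangent_spaceI[OF c])
        (use that in \<open>simp_all add: scaleR_fun_def linear_cmul[OF lin] out tangent_transition[of _ p c, OF _ c]\<close>)
  qed
qed

lemma coord_vec_linear:
  assumes "c \<in> A" "p \<in> fst c"
  shows "coord_vec A c p (a *\<^sub>R u + b *\<^sub>R v) = a *\<^sub>R coord_vec A c p u + b *\<^sub>R coord_vec A c p v"
  using transition_linear[OF assms(1) _ assms(2)]
  by (auto simp: coord_vec_eq fun_eq_iff scaleR_fun_def linear_add linear_cmul)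

end

locale lorentzian = atlas A
  for A :: "('m::{t2_space, second_countable_topology}, 'e::euclidean_space) chart set" +
  fixes g :: "('m, 'e) metric"
  assumes metric: "lorentzian_metric A g"
begin

lemma g_sym: "u \<in> tangent_space A p \<Longrightarrow> v \<in> tangent_space A p \<Longrightarrow> g p u v = g p v u"
  by (rule metric[unfolded lorentzian_metric_def, THEN conjunct1, rule_format])

lemma g_linear:
  "u \<in> tangent_space A p \<Longrightarrow> v \<in> tangent_space A p \<Longrightarrow> w \<in> tangent_space A p \<Longrightarrow>
    g p (a *\<^sub>R u + b *\<^sub>R v) w = a * g p u w + b * g p v w"
  by (rule metric[unfolded lorentzian_metric_def, THEN conjunct2, THEN conjunct1, rule_format])

lemma g_nondeg:
  "u \<in> tangent_space A p \<Longrightarrow> (\<And>v. v \<in> tangent_space A p \<Longrightarrow> g p u v = 0) \<Longrightarrow> u = 0"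
  using metric[unfolded lorentzian_metric_def, THEN conjunct2, THEN conjunct2, THEN conjunct1] by blast

lemma g_smooth: "c \<in> A \<Longrightarrow> smooth_on (snd c ` fst c) (\<lambda>x. metric_coord A g c x u v)"
  using metric unfolding lorentzian_metric_def by simp

lemma g_scaleR:
  assumes "u \<in> tangent_space A p" "w \<in> tangent_space A p"
  shows "g p (a *\<^sub>R u) w = a * g p u w" "g p w (a *\<^sub>R u) = a * g p w u"
proof -
  show "g p (a *\<^sub>R u) w = a * g p u w" using g_linear[OF assms(1,1,2), of a 0] by simp
  then show "g p w (a *\<^sub>R u) = a * g p w u"
    using assms g_sym subspace_scale[OF subspace_tangent_space] by metis
qed

lemma g_zero: "w \<in> tangent_space A p \<Longrightarrow> g p 0 w = 0"
  using g_scaleR(1)[of w p w 0] by simp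

lemma smooth_metric_chart: assumes c: "c \<in> A" shows "smooth_metric (snd c ` fst c) (metric_coord A g c)"
proof
  show "open (snd c ` fst c)" by (rule chart_open(2)[OF c])
  show "smooth_on (snd c ` fst c) (\<lambda>x. metric_coord A g c x u v)" for u v by (rule g_smooth[OF c])
  fix x assume x: "x \<in> snd c ` fst c"
  define p where "p = chart_inv c x"
  have p: "p \<in> fst c" "x = snd c p" using chart_inv_in[OF c x] chart_inv2[OF c x] by (auto simp: p_def)
  have mc: "metric_coord A g c x u v = g p (coord_vec A c p u) (coord_vec A c p v)" for u v
    by (simp add: metric_coord_def p_def)
  note T = coord_vec_in[OF c p(1)]
  show s: "metric_coord A g c x u v = metric_coord A g c x v u" for u v
    unfolding mc by (rule g_sym[OF T T])
  have "metric_coord A g c x (a *\<^sub>R u + b *\<^sub>R v) w = a * metric_coord A g c x u w + b * metric_coord A g c x v w"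
    for a b u v w
    unfolding mc coord_vec_linear[OF c p(1)] by (rule g_linear[OF T T T])
  from this[of 1 _ 1] this[of _ _ 0]
  have lin: "linear (\<lambda>u. metric_coord A g c x u w)" for w by (intro linearI) auto
  moreover have "metric_coord A g c x w = (\<lambda>u. metric_coord A g c x u w)" for w by (rule ext) (rule s)
  ultimately have "linear (metric_coord A g c x w)" for w by metis
  with lin show "bilinear (metric_coord A g c x)" by (simp add: bilinear_def)
  show "u = 0" if "\<And>v. metric_coord A g c x u v = 0" for u
  proof -
    have "coord_vec A c p u = 0"
    proof (rule g_nondeg[OF T])
      fix v assume "v \<in> tangent_space A p"
      then show "g p (coord_vec A c p u) v = 0"
        using that[of "v c"] mc[of u "v c"] tangent_eq[OF _ c p(1)] by metis
    qed
    then show ?thesis using coord_vec_self[OF c p(1), of u] by (simp add: zero_fun_def)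
  qed
qed

text \<open>The transition differential relates the components of one tangent vector in
  \<open>c\<close> and \<open>d\<close>, so both coefficient functions evaluate \<open>g\<close> on
  the same pair of vectors. This makes the transformation laws available for overlapping
  charts.\<close>

lemma chart_isometry:
  assumes c: "c \<in> A" and d: "d \<in> A"
  shows "metric_isometry (snd c ` (fst c \<inter> fst d)) (snd d ` fst d)
    (metric_coord A g c) (metric_coord A g d) (snd d \<circ> chart_inv c)"
proof -
  interpret M: smooth_metric "snd c ` (fst c \<inter> fst d)" "metric_coord A g c"
    by (rule smooth_metric_subset[OF smooth_metric_chart[OF c] chart_image_open[OF c chart_open(1)[OF d]]]) auto
  interpret N: smooth_metric "snd d ` fst d" "metric_coord A g d" by (rule smooth_metric_chart[OF d])
  show ?thesis
  proof
    show "smooth_on (snd c ` (fst c \<inter> fst d)) (snd d \<circ> chart_inv c)" by (rule transition_smooth[OF c d])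
    fix x assume "x \<in> snd c ` (fst c \<inter> fst d)"
    then obtain p where p: "p \<in> fst c" "p \<in> fst d" "x = snd c p" by auto
    note cp = c p(1) and dp = d p(2)
    have \<tau>: "(snd d \<circ> chart_inv c) x = snd d p" using p c by (simp add: chart_inv1)
    then show "(snd d \<circ> chart_inv c) x \<in> snd d ` fst d" using p by simp
    show "surj (frechet_derivative (snd d \<circ> chart_inv c) (at x))"
      using transition_surj[OF c d p(1,2)] by (simp add: transition_def p)
    have "coord_vec A d p (transition c d p u) = coord_vec A c p u" for u
      using tangent_eq[OF coord_vec_in[OF cp] dp, of u] d p by (simp add: coord_vec_eq)
    then show "metric_coord A g c x u v = metric_coord A g d ((snd d \<circ> chart_inv c) x)
      (frechet_derivative (snd d \<circ> chart_inv c) (at x) u)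
      (frechet_derivative (snd d \<circ> chart_inv c) (at x) v)" for u v
      unfolding \<tau> using p c d by (simp add: transition_def[symmetric] metric_coord_def chart_inv1)
  qed
qed

section \<open>Connection and curvature on the manifold\<close>

lemma christoffel_eq: "christoffel A g c = levi_civita (metric_coord A g c)"
  by (simp add: fun_eq_iff christoffel_def levi_civita_def koszul_def)

lemma curvature_coord_eq: "curvature_coord A g c = riemann (metric_coord A g c)"
  by (intro ext) (simp only: curvature_coord_def riemann_def christoffel_eq Let_def)

lemma christoffel_bilinear:
  assumes "c \<in> A" "p \<in> fst c" shows "bilinear (christoffel A g c (snd c p))"
  unfolding christoffel_eq
  using smooth_metric.levi_civita_bilinear[OF smooth_metric_chart[OF assms(1)]] assms(2) by blast

lemma christoffel_transition:
  assumes "c \<in> A" "d \<in> A" "p \<in> fst c" "p \<in> fst d"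
  shows "transition c d p (christoffel A g c (snd c p) u v) =
    frechet_derivative (\<lambda>y. frechet_derivative (snd d \<circ> chart_inv c) (at y) u) (at (snd c p)) v
    + christoffel A g d (snd d p) (transition c d p u) (transition c d p v)"
  using metric_isometry.levi_civita_transform[OF chart_isometry[OF assms(1,2)], of "snd c p" u v] assms
  by (simp add: christoffel_eq transition_def chart_inv1)

lemma curvature_in:
  assumes "u \<in> tangent_space A p" "v \<in> tangent_space A p" "w \<in> tangent_space A p"
  shows "curvature A g p u v w \<in> tangent_space A p"
proof -
  obtain c where c: "c \<in> A" "p \<in> fst c" using chart_at .
  show ?thesis
  proof (rule tangent_spaceI[OF c])
    fix d assume d: "d \<in> A" "p \<in> fst d"
    have "riemann (metric_coord A g d) (snd d p) (transition c d p (u c)) (transition c d p (v c))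
        (transition c d p (w c)) = transition c d p (riemann (metric_coord A g c) (snd c p) (u c) (v c) (w c))"
      using metric_isometry.riemann_transform[OF chart_isometry[OF c(1) d(1)], of "snd c p" "u c" "v c" "w c"] c d
      by (simp add: transition_def chart_inv1)
    then show "curvature A g p u v w d = transition c d p (curvature A g p u v w c)"
      using c d tangent_transition[OF assms(1) c d] tangent_transition[OF assms(2) c d]
        tangent_transition[OF assms(3) c d]
      by (simp add: curvature_def curvature_coord_eq)
  qed (auto simp: curvature_def)
qed

lemma curvature_scaleR:
  "curvature A g p (a *\<^sub>R u) (b *\<^sub>R v) (c *\<^sub>R w) = (a * b * c) *\<^sub>R curvature A g p u v w"
  by (auto simp: fun_eq_iff curvature_def scaleR_fun_def curvature_coord_eq
      intro!: smooth_metric.riemann_scaleR[OF smooth_metric_chart])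

section \<open>Velocity and covariant derivative at regular parameters\<close>

text \<open>Confined to the open interval, where the one-sided derivatives in
  \<open>velocity\<close> and \<open>cov_deriv\<close> are ordinary ones and the chain rule applies.
  Break points of iterates will go into a negligible exceptional set.\<close>

definition regular_at :: "(real \<Rightarrow> 'm) \<Rightarrow> real \<Rightarrow> bool" where
  "regular_at \<sigma> t \<longleftrightarrow> 0 < t \<and> t < 1 \<and> isCont \<sigma> t \<and>
    (\<forall>c\<in>A. \<sigma> t \<in> fst c \<longrightarrow> (snd c \<circ> \<sigma>) differentiable (at t))"

lemma at_within_01: "0 < t \<Longrightarrow> t < 1 \<Longrightarrow> (at t within {0..1::real}) = at t"
  by (rule at_within_Icc_at)

lemma regular_at_interval: "regular_at \<sigma> t \<Longrightarrow> 0 < t \<and> t < 1"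
  by (simp add: regular_at_def)

lemma regular_eventually_chart:
  assumes "regular_at \<sigma> t" "c \<in> A" "\<sigma> t \<in> fst c"
  shows "eventually (\<lambda>s. \<sigma> s \<in> fst c) (nhds t)"
  using assms chart_open(1)[OF assms(2)] topological_tendstoD[of \<sigma> "\<sigma> t" "at t" "fst c"]
  by (simp add: regular_at_def continuous_at eventually_nhds_conv_at)

lemma has_vector_derivative_velocity:
  assumes "regular_at \<sigma> t" "c \<in> A" "\<sigma> t \<in> fst c"
  shows "((snd c \<circ> \<sigma>) has_vector_derivative velocity A \<sigma> t c) (at t)"
  using assms unfolding regular_at_def velocity_def
  by (simp add: at_within_01 vector_derivative_works[symmetric])

lemma velocity_in:
  assumes r: "regular_at \<sigma> t" shows "velocity A \<sigma> t \<in> tangent_space A (\<sigma> t)"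
proof -
  obtain c where c: "c \<in> A" "\<sigma> t \<in> fst c" using chart_at .
  show ?thesis
  proof (rule tangent_spaceI[OF c])
    fix d assume d: "d \<in> A" "\<sigma> t \<in> fst d"
    have "((snd d \<circ> chart_inv c) \<circ> (snd c \<circ> \<sigma>) has_derivative
        transition c d (\<sigma> t) \<circ> (\<lambda>h. h *\<^sub>R velocity A \<sigma> t c)) (at t)"
      using has_vector_derivative_velocity[OF r c] has_derivative_transition[OF c(1) d(1) c(2) d(2)]
      by (intro diff_chain_at) (auto simp: has_vector_derivative_def)
    moreover have "eventually (\<lambda>s. ((snd d \<circ> chart_inv c) \<circ> (snd c \<circ> \<sigma>)) s = (snd d \<circ> \<sigma>) s) (nhds t)"
      using regular_eventually_chart[OF r c] by eventually_elim (simp add: chart_inv1 c)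
    ultimately have "((snd d \<circ> \<sigma>) has_derivative
        transition c d (\<sigma> t) \<circ> (\<lambda>h. h *\<^sub>R velocity A \<sigma> t c)) (at t)"
      by (rule has_derivative_transform_nhds)
    then have "((snd d \<circ> \<sigma>) has_vector_derivative transition c d (\<sigma> t) (velocity A \<sigma> t c)) (at t)"
      using linear_cmul[OF transition_linear[OF c(1) d(1) c(2) d(2)]]
      by (simp add: has_vector_derivative_def comp_def)
    then show "velocity A \<sigma> t d = transition c d (\<sigma> t) (velocity A \<sigma> t c)"
      using has_vector_derivative_velocity[OF r d] vector_derivative_unique_at by blast
  qed (auto simp: velocity_def)
qed

text \<open>Tangency is required near \<open>t\<close>, since a change of chart differentiates the
  relation between the components of \<open>V\<close>.\<close>

definition differentiable_field_at :: "(real \<Rightarrow> 'm) \<Rightarrow> (real \<Rightarrow> ('m, 'e) tangent) \<Rightarrow> real \<Rightarrow> bool" where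
  "differentiable_field_at \<sigma> V t \<longleftrightarrow>
    eventually (\<lambda>s. V s \<in> tangent_space A (\<sigma> s)) (nhds t) \<and>
    (\<forall>c\<in>A. \<sigma> t \<in> fst c \<longrightarrow> (\<lambda>s. V s c) differentiable (at t))"

text \<open>Near \<open>t\<close> the \<open>d\<close>-components arise from the
  \<open>c\<close>-components by \<open>transition c d\<close> at a moving base point. The product
  rule gives one term for the base point and one for the field.\<close>

lemma field_derivative_transition:
  assumes r: "regular_at \<sigma> t" and c: "c \<in> A" "\<sigma> t \<in> fst c" and d: "d \<in> A" "\<sigma> t \<in> fst d"
    and T: "eventually (\<lambda>s. V s \<in> tangent_space A (\<sigma> s)) (nhds t)"
    and V: "((\<lambda>s. V s c) has_vector_derivative V') (at t)"
  shows "((\<lambda>s. V s d) has_vector_derivative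
    frechet_derivative (\<lambda>y. frechet_derivative (snd d \<circ> chart_inv c) (at y) (V t c)) (at (snd c (\<sigma> t)))
      (velocity A \<sigma> t c) + transition c d (\<sigma> t) V') (at t)"
proof -
  interpret metric_isometry "snd c ` (fst c \<inter> fst d)" "snd d ` fst d"
    "metric_coord A g c" "metric_coord A g d" "snd d \<circ> chart_inv c"
    by (rule chart_isometry[OF c(1) d(1)])
  let ?x = "snd c (\<sigma> t)"
  have x: "?x \<in> snd c ` (fst c \<inter> fst d)" using c d by blast
  have ev: "eventually (\<lambda>s. \<sigma> s \<in> fst c \<inter> fst d) (nhds t)"
    using regular_eventually_chart[OF r c] regular_eventually_chart[OF r d] by eventually_elim simp
  have "((\<lambda>s. transition c d (\<sigma> s) (V s c)) has_derivative
      (\<lambda>h. H ?x (V t c) (h *\<^sub>R velocity A \<sigma> t c) + transition c d (\<sigma> t) (h *\<^sub>R V'))) (at t)"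
  proof (rule has_derivative_linear_family[where G="\<lambda>s. transition c d (\<sigma> s)" and X="\<lambda>s. V s c"
        and DG="\<lambda>a h. H ?x a (h *\<^sub>R velocity A \<sigma> t c)" and X'="\<lambda>h. h *\<^sub>R V'"])
    show "eventually (\<lambda>s. linear (transition c d (\<sigma> s))) (nhds t)"
      using ev by eventually_elim (use c d transition_linear in blast)
    show "((\<lambda>s. transition c d (\<sigma> s) a) has_derivative
        (\<lambda>h. H ?x a (h *\<^sub>R velocity A \<sigma> t c))) (at t)" for a
    proof -
      have "((\<lambda>s. snd c (\<sigma> s)) has_derivative (\<lambda>h. h *\<^sub>R velocity A \<sigma> t c)) (at t)"
        using has_vector_derivative_velocity[OF r c] by (simp add: has_vector_derivative_def comp_def)
      from has_derivative_compose[OF this H[OF x, of a]]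
      show ?thesis by (simp only: transition_def)
    qed
    show "((\<lambda>s. V s c) has_derivative (\<lambda>h. h *\<^sub>R V')) (at t)"
      using V by (simp add: has_vector_derivative_def)
  qed
  moreover have "eventually (\<lambda>s. transition c d (\<sigma> s) (V s c) = V s d) (nhds t)"
    using ev T by eventually_elim (use c d tangent_transition in fastforce)
  ultimately have "((\<lambda>s. V s d) has_derivative
      (\<lambda>h. H ?x (V t c) (h *\<^sub>R velocity A \<sigma> t c) + transition c d (\<sigma> t) (h *\<^sub>R V'))) (at t)"
    by (rule has_derivative_transform_nhds)
  moreover have "linear (H ?x (V t c))" using H[OF x] has_derivative_linear by blast
  ultimately show ?thesis
    using transition_linear[OF c(1) d(1) c(2) d(2)]
    by (simp add: has_vector_derivative_def linear_cmul scaleR_add_right)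
qed

lemma differentiable_field_atI:
  assumes "regular_at \<sigma> t" and c: "c \<in> A" "\<sigma> t \<in> fst c"
    and "eventually (\<lambda>s. V s \<in> tangent_space A (\<sigma> s)) (nhds t)"
    and "(\<lambda>s. V s c) differentiable (at t)"
  shows "differentiable_field_at \<sigma> V t"
  unfolding differentiable_field_at_def
proof (intro conjI ballI impI)
  fix d assume "d \<in> A" "\<sigma> t \<in> fst d"
  then show "(\<lambda>s. V s d) differentiable at t"
    using field_derivative_transition[OF assms(1) c _ _ assms(4) assms(5)[unfolded vector_derivative_works]]
      differentiableI_vector by blast
qed (rule assms(4))

text \<open>The second derivative of the coordinate change enters from
  \<open>field_derivative_transition\<close> and, with opposite sign, from
  \<open>christoffel_transition\<close>. Its two arguments occur there in different orders, hence
  the appeal to symmetry.\<close>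

lemma cov_deriv_in:
  assumes r: "regular_at \<sigma> t" and V: "differentiable_field_at \<sigma> V t"
  shows "cov_deriv A g \<sigma> V t \<in> tangent_space A (\<sigma> t)"
proof -
  obtain c where c: "c \<in> A" "\<sigma> t \<in> fst c" using chart_at .
  have t01: "at t within {0..1} = at t" using r by (auto simp: regular_at_def at_within_01)
  have T: "eventually (\<lambda>s. V s \<in> tangent_space A (\<sigma> s)) (nhds t)"
    using V by (simp add: differentiable_field_at_def)
  have Tt: "V t \<in> tangent_space A (\<sigma> t)" using T by (rule eventually_nhds_x_imp_x)
  let ?V' = "\<lambda>c. vector_derivative (\<lambda>s. V s c) (at t)"
  have D: "((\<lambda>s. V s c) has_vector_derivative ?V' c) (at t)" if "c \<in> A" "\<sigma> t \<in> fst c" for c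
    using V that by (auto simp: differentiable_field_at_def vector_derivative_works[symmetric])
  show ?thesis
  proof (rule tangent_spaceI[OF c])
    fix d assume d: "d \<in> A" "\<sigma> t \<in> fst d"
    let ?J = "transition c d (\<sigma> t)"
    let ?H = "\<lambda>u v. frechet_derivative (\<lambda>y. frechet_derivative (snd d \<circ> chart_inv c) (at y) u) (at (snd c (\<sigma> t))) v"
    have Vd: "?V' d = ?H (V t c) (velocity A \<sigma> t c) + ?J (?V' c)"
      using D[OF d] field_derivative_transition[OF r c d T D[OF c]] vector_derivative_unique_at by blast
    have "?H (V t c) (velocity A \<sigma> t c) = ?H (velocity A \<sigma> t c) (V t c)"
      using c d by (intro second_derivative_symmetric[OF transition_smooth chart_image_open]) (auto simp: chart_open)
    moreover have "velocity A \<sigma> t d = ?J (velocity A \<sigma> t c)" "V t d = ?J (V t c)"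
      using tangent_transition[OF velocity_in[OF r] c d] tangent_transition[OF Tt c d] by auto
    ultimately show "cov_deriv A g \<sigma> V t d = ?J (cov_deriv A g \<sigma> V t c)"
      using c d Vd christoffel_transition[OF c(1) d(1) c(2) d(2), of "velocity A \<sigma> t c" "V t c"]
      by (simp add: cov_deriv_def t01 linear_add[OF transition_linear[OF c(1) d(1) c(2) d(2)]])
  qed (auto simp: cov_deriv_def)
qed

lemma cov_deriv_linear:
  assumes r: "regular_at \<sigma> t" and V: "differentiable_field_at \<sigma> V t" and W: "differentiable_field_at \<sigma> W t"
  shows "cov_deriv A g \<sigma> (a *\<^sub>R V + b *\<^sub>R W) t = a *\<^sub>R cov_deriv A g \<sigma> V t + b *\<^sub>R cov_deriv A g \<sigma> W t"
proof
  fix c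
  have t01: "at t within {0..1} = at t" using r by (auto simp: regular_at_def at_within_01)
  show "cov_deriv A g \<sigma> (a *\<^sub>R V + b *\<^sub>R W) t c = (a *\<^sub>R cov_deriv A g \<sigma> V t + b *\<^sub>R cov_deriv A g \<sigma> W t) c"
  proof (cases "c \<in> A \<and> \<sigma> t \<in> fst c")
    case True
    then have "((\<lambda>s. V s c) has_vector_derivative vector_derivative (\<lambda>s. V s c) (at t)) (at t)"
      "((\<lambda>s. W s c) has_vector_derivative vector_derivative (\<lambda>s. W s c) (at t)) (at t)"
      using V W by (auto simp: differentiable_field_at_def vector_derivative_works[symmetric])
    then have "((\<lambda>s. a *\<^sub>R V s c + b *\<^sub>R W s c) has_vector_derivative
        a *\<^sub>R vector_derivative (\<lambda>s. V s c) (at t) + b *\<^sub>R vector_derivative (\<lambda>s. W s c) (at t)) (at t)"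
      by (auto intro!: derivative_eq_intros)
    then have "vector_derivative (\<lambda>s. a *\<^sub>R V s c + b *\<^sub>R W s c) (at t) =
        a *\<^sub>R vector_derivative (\<lambda>s. V s c) (at t) + b *\<^sub>R vector_derivative (\<lambda>s. W s c) (at t)"
      by (rule vector_derivative_at)
    then show ?thesis
      using True by (simp add: cov_deriv_def t01 scaleR_fun_def bilinear_simps[OF christoffel_bilinear] algebra_simps)
  next
    case False
    then show ?thesis by (auto simp: cov_deriv_def scaleR_fun_def)
  qed
qed

end

section \<open>Dimension counts for negative definite subspaces\<close>

text \<open>Linearity is asked on \<open>W\<close> only, because the constant of a field, one of the
  functionals used later, is controlled only there. If \<open>W\<close> has infinite dimension, the
  inequality holds as \<open>dim W = 0\<close>.\<close>

lemma dim_kernel_ge: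
  fixes W :: "'v::real_vector set"
  assumes W: "subspace W"
    and \<phi>: "\<And>a b u v. u \<in> W \<Longrightarrow> v \<in> W \<Longrightarrow> \<phi> (a *\<^sub>R u + b *\<^sub>R v) = a * \<phi> u + b * (\<phi> v :: real)"
  shows "subspace {v \<in> W. \<phi> v = 0}" "dim W \<le> dim {v \<in> W. \<phi> v = 0} + 1"
proof -
  let ?K = "{v \<in> W. \<phi> v = 0}"
  have add: "\<phi> (u + v) = \<phi> u + \<phi> v" if "u \<in> W" "v \<in> W" for u v
    using \<phi>[OF that, of 1 1] by simp
  have scale: "\<phi> (a *\<^sub>R u) = a * \<phi> u" if "u \<in> W" for a u
    using \<phi>[OF that that, of a 0] by simp
  have "\<phi> 0 = 0" using scale[of 0 0] subspace_0[OF W] by simp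
  then show "subspace ?K"
    using W add scale by (auto simp: subspace_def)
  show "dim W \<le> dim ?K + 1"
  proof (cases "?K = W")
    case False
    then obtain w where w: "w \<in> W" "\<phi> w \<noteq> 0" by blast
    obtain B where B: "B \<subseteq> W" "independent B" "W \<subseteq> span B" "card B = dim W"
      using real_vector.basis_exists .
    obtain C where C: "C \<subseteq> ?K" "independent C" "?K \<subseteq> span C" "card C = dim ?K"
      using real_vector.basis_exists .
    show ?thesis
    proof (cases "finite B")
      case True
      have "C \<subseteq> span B" using C(1) B(3) by blast
      then have fC: "finite C" using real_vector.independent_span_bound[OF True C(2)] by blast
      have "W \<subseteq> span (insert w C)"
      proof
        fix v assume v: "v \<in> W"
        \<comment> \<open>Projection onto the kernel along \<open>w\<close>.\<close>
        have "v - (\<phi> v / \<phi> w) *\<^sub>R w \<in> ?K"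
          using \<phi>[OF v w(1), of 1 "- (\<phi> v / \<phi> w)"] w v W by (simp add: subspace_diff subspace_scale)
        then have "v - (\<phi> v / \<phi> w) *\<^sub>R w \<in> span C" using C(3) by blast
        then show "v \<in> span (insert w C)" by (auto simp: span_insert)
      qed
      then have "dim W \<le> card (insert w C)" using fC by (intro real_vector.dim_le_card) auto
      also have "\<dots> \<le> card C + 1" by (simp add: card_insert_le_m1 fC card_insert_if)
      finally show ?thesis using C(4) by simp
    next
      case False
      then show ?thesis using B(4) by simp
    qed
  qed simp
qed

lemma dim_kernel_family_ge:
  fixes W :: "'v::real_vector set"
  assumes "finite I" and W: "subspace W"
    and \<phi>: "\<And>i a b u v. i \<in> I \<Longrightarrow> u \<in> W \<Longrightarrow> v \<in> W \<Longrightarrow>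
      \<phi> i (a *\<^sub>R u + b *\<^sub>R v) = a * \<phi> i u + b * (\<phi> i v :: real)"
  shows "subspace {v \<in> W. \<forall>i\<in>I. \<phi> i v = 0} \<and> dim W \<le> dim {v \<in> W. \<forall>i\<in>I. \<phi> i v = 0} + card I"
  using assms(1) \<phi>
proof (induction I rule: finite_induct)
  case empty
  then show ?case using W by simp
next
  case (insert i I)
  let ?K = "{v \<in> W. \<forall>i\<in>I. \<phi> i v = 0}"
  have IH: "subspace ?K" "dim W \<le> dim ?K + card I" using insert by auto
  have eq: "{v \<in> W. \<forall>i\<in>insert i I. \<phi> i v = 0} = {v \<in> ?K. \<phi> i v = 0}" by auto
  have "subspace {v \<in> ?K. \<phi> i v = 0}" "dim ?K \<le> dim {v \<in> ?K. \<phi> i v = 0} + 1"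
    using dim_kernel_ge[OF IH(1), of "\<phi> i"] insert.prems by blast+
  then show ?case using IH(2) insert unfolding eq by simp
qed

lemma independent_Un_disjoint_span:
  fixes C :: "'v::real_vector set"
  assumes "finite D" "independent C" "independent D" "span C \<inter> span D = {0}"
  shows "independent (C \<union> D)"
  using assms
proof (induction D rule: finite_induct)
  case (insert x D)
  have D: "independent D" "x \<notin> span D" using insert.prems(2) insert.hyps(2) by (auto simp: real_vector.independent_insert)
  have sub: "span D \<subseteq> span (insert x D)" by (rule span_mono) auto
  then have "span C \<inter> span D = {0}" using insert.prems(3) span_zero by blast
  then have ind: "independent (C \<union> D)" using insert D by blast
  have "x \<notin> span (C \<union> D)"
  proof
    assume "x \<in> span (C \<union> D)"
    then obtain a b where ab: "a \<in> span C" "b \<in> span D" "x = a + b" by (auto simp: span_Un)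
    have "x \<in> span (insert x D)" by (simp add: span_base)
    then have "x - b \<in> span (insert x D)" using ab(2) sub by (intro span_diff) auto
    then have "x - b \<in> span C \<inter> span (insert x D)" using ab by simp
    then have "x = b" using insert.prems(3) by auto
    then show False using ab D by simp
  qed
  then show ?case using ind by (simp add: real_vector.independent_insertI)
qed simp

text \<open>\<open>B\<close> does not always span \<open>V\<close>: in infinite dimension
  \<open>dim V = 0\<close> and the empty set serves.\<close>

lemma finite_independent_subset:
  fixes V :: "'v::real_vector set"
  obtains B where "finite B" "B \<subseteq> V" "independent B" "card B = dim V"
proof -
  obtain B where B: "B \<subseteq> V" "independent B" "V \<subseteq> span B" "card B = dim V"
    using real_vector.basis_exists .
  show ?thesis
  proof (cases "finite B")
    case True
    then show ?thesis using B that by blast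
  next
    case False
    then show ?thesis using B that[of "{}"] real_vector.independent_empty by simp
  qed
qed

section \<open>The index of a form and direct sums\<close>

abbreviation negative_definite :: "'v::real_vector set \<Rightarrow> ('v \<Rightarrow> 'v \<Rightarrow> real) \<Rightarrow> bool" where
  "negative_definite W B \<equiv> \<forall>v\<in>W. v \<noteq> 0 \<longrightarrow> B v v < 0"

text \<open>Turns a lower bound for the supremum into a witness: if all members were at most
  \<open>m\<close>, the supremum could not reach \<open>Suc m\<close>. This also covers an infinite
  supremum. For \<open>n = 0\<close> the witness is \<open>{0}\<close>.\<close>

lemma le_neg_index_iff:
  fixes S :: "'v::real_vector set"
  assumes "0 \<in> S"
  shows "enat n \<le> neg_index S B \<longleftrightarrow> (\<exists>W. subspace W \<and> W \<subseteq> S \<and> negative_definite W B \<and> n \<le> dim W)"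
proof
  assume n: "enat n \<le> neg_index S B"
  show "\<exists>W. subspace W \<and> W \<subseteq> S \<and> negative_definite W B \<and> n \<le> dim W"
  proof (cases n)
    case 0
    then show ?thesis using assms by (intro exI[of _ "{0}"]) auto
  next
    case (Suc m)
    show ?thesis
    proof (rule ccontr)
      assume "\<not> ?thesis"
      then have "neg_index S B \<le> enat m"
        unfolding neg_index_def using Suc by (intro Sup_least) (auto simp: not_le less_Suc_eq_le)
      then have "enat n \<le> enat m" using n by (rule order_trans[rotated])
      then show False using Suc by simp
    qed
  qed
next
  assume "\<exists>W. subspace W \<and> W \<subseteq> S \<and> negative_definite W B \<and> n \<le> dim W"
  then obtain W where W: "subspace W" "W \<subseteq> S" "negative_definite W B" "n \<le> dim W" by blast
  then have "enat (dim W) \<le> neg_index S B" unfolding neg_index_def by (intro Sup_upper) auto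
  then show "enat n \<le> neg_index S B" using W(4) by (meson enat_ord_simps(1) order_trans)
qed

lemma neg_index_mono: "S \<subseteq> S' \<Longrightarrow> neg_index S B \<le> neg_index S' B"
  unfolding neg_index_def by (rule Sup_subset_mono) auto

text \<open>Abstract form of superadditivity. In \<open>neg\<close> only diagonal values occur, and
  only for vectors that are zero or have a negative value; for these the integrals of the
  application are known to exist.\<close>

lemma neg_index_direct_sum:
  fixes S1 :: "'a::real_vector set" and S2 :: "'b::real_vector set" and S :: "'v::real_vector set"
  assumes S: "0 \<in> S1" "0 \<in> S2" "0 \<in> S" and f: "linear f1" "linear f2"
    and inS: "\<And>v1 v2. v1 \<in> S1 \<Longrightarrow> v2 \<in> S2 \<Longrightarrow> f1 v1 + f2 v2 \<in> S"
    and direct: "\<And>v1 v2. v1 \<in> S1 \<Longrightarrow> v2 \<in> S2 \<Longrightarrow> f1 v1 + f2 v2 = 0 \<Longrightarrow> v1 = 0 \<and> v2 = 0"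
    and neg: "\<And>v1 v2. v1 \<in> S1 \<Longrightarrow> v2 \<in> S2 \<Longrightarrow> v1 = 0 \<or> B1 v1 v1 < 0 \<Longrightarrow> v2 = 0 \<or> B2 v2 v2 < 0 \<Longrightarrow>
      v1 \<noteq> 0 \<or> v2 \<noteq> 0 \<Longrightarrow> B (f1 v1 + f2 v2) (f1 v1 + f2 v2) < 0"
    and n: "enat n1 \<le> neg_index S1 B1" "enat n2 \<le> neg_index S2 B2"
  shows "enat (n1 + n2) \<le> neg_index S B"
proof -
  obtain W1 where W1: "subspace W1" "W1 \<subseteq> S1" "negative_definite W1 B1" "n1 \<le> dim W1"
    using n(1) unfolding le_neg_index_iff[OF S(1)] by blast
  obtain W2 where W2: "subspace W2" "W2 \<subseteq> S2" "negative_definite W2 B2" "n2 \<le> dim W2"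
    using n(2) unfolding le_neg_index_iff[OF S(2)] by blast
  obtain C1 where C1: "finite C1" "C1 \<subseteq> W1" "independent C1" "card C1 = dim W1" using finite_independent_subset .
  obtain C2 where C2: "finite C2" "C2 \<subseteq> W2" "independent C2" "card C2 = dim W2" using finite_independent_subset .
  have sp: "span C1 \<subseteq> W1" "span C2 \<subseteq> W2"
    using C1 C2 W1 W2 by (simp_all add: span_minimal)
  have in1: "inj_on f1 (span C1)"
  proof (rule inj_onI)
    fix x y assume "x \<in> span C1" "y \<in> span C1" "f1 x = f1 y"
    then have "x - y \<in> S1" "f1 (x - y) + f2 0 = 0"
      using sp W1 f by (auto simp: linear_diff linear_0 intro!: subsetD[OF W1(2)] subspace_diff)
    then show "x = y" using direct[of "x - y" 0] S by simp
  qed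
  have in2: "inj_on f2 (span C2)"
  proof (rule inj_onI)
    fix x y assume "x \<in> span C2" "y \<in> span C2" "f2 x = f2 y"
    then have "x - y \<in> S2" "f1 0 + f2 (x - y) = 0"
      using sp W2 f by (auto simp: linear_diff linear_0 intro!: subsetD[OF W2(2)] subspace_diff)
    then show "x = y" using direct[of 0 "x - y"] S by simp
  qed
  \<comment> \<open>The span of this finite set replaces the sum of the images of \<open>W1\<close>
    and \<open>W2\<close>, so that its dimension is a plain cardinality.\<close>
  let ?C = "f1 ` C1 \<union> f2 ` C2"
  have s1: "span (f1 ` C1) = f1 ` span C1" and s2: "span (f2 ` C2) = f2 ` span C2"
    using f by (simp_all add: linear_span_image)
  have disj: "x1 = 0 \<and> x2 = 0" if "x1 \<in> span C1" "x2 \<in> span C2" "f1 x1 = f2 x2" for x1 x2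
  proof -
    have "- x2 \<in> S2" using that sp W2 by (meson subsetD subspace_neg)
    then show ?thesis using direct[of x1 "- x2"] that sp W1 f by (auto simp: linear_neg)
  qed
  have int: "span (f1 ` C1) \<inter> span (f2 ` C2) = {0}"
    unfolding s1 s2 using disj f span_zero[of C1] span_zero[of C2]
    by (auto simp: linear_0 image_iff) (metis linear_0)+
  have ind: "independent ?C"
    using C1 C2 f in1 in2 int
    by (intro independent_Un_disjoint_span finite_imageI linear_independent_injective_image) auto
  have "card (f1 ` C1) = card C1" "card (f2 ` C2) = card C2"
    using in1 in2 span_superset by (metis card_image inj_on_subset)+
  moreover have "f1 ` C1 \<inter> f2 ` C2 = {}"
  proof -
    have "f1 ` C1 \<inter> f2 ` C2 \<subseteq> {0}" using int by (metis Int_mono span_superset)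
    moreover have "0 \<notin> f1 ` C1"
      using real_vector.dependent_zero[of "f1 ` C1"] real_vector.independent_mono[OF ind, of "f1 ` C1"] by auto
    moreover have "X \<inter> Y = {}" if "X \<inter> Y \<subseteq> {0}" "0 \<notin> X" for X Y :: "'v set" using that by blast
    ultimately show ?thesis by simp
  qed
  ultimately have "card ?C = dim W1 + dim W2" using C1 C2 by (simp add: card_Un_disjoint)
  then have dim: "dim (span ?C) = dim W1 + dim W2"
    using ind by (simp add: real_vector.dim_eq_card_independent)
  have mem: "\<exists>v1\<in>W1. \<exists>v2\<in>W2. v = f1 v1 + f2 v2" if "v \<in> span ?C" for v
    using that sp by (auto simp: span_Un s1 s2)
  have "span ?C \<subseteq> S" using mem inS W1 W2 by blast
  moreover have "negative_definite (span ?C) B"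
  proof (intro ballI impI)
    fix v assume "v \<in> span ?C" "v \<noteq> 0"
    then obtain v1 v2 where v: "v1 \<in> W1" "v2 \<in> W2" "v = f1 v1 + f2 v2" "v1 \<noteq> 0 \<or> v2 \<noteq> 0"
      using mem f by (metis linear_0 add_0)
    then show "B v v < 0" using W1 W2 by (auto intro!: neg)
  qed
  ultimately show ?thesis
    using dim W1(4) W2(4) le_neg_index_iff[OF S(3)] by (metis add_mono subspace_span)
qed

section \<open>\<open>H\<^sup>1\<close> functions on an interval\<close>

lemma has_integral_affine_real:
  fixes f :: "real \<Rightarrow> 'b::euclidean_space"
  assumes "(f has_integral I) {m * a + c..m * b + c}" "m > 0"
  shows "((\<lambda>t. f (m * t + c)) has_integral I /\<^sub>R m) {a..b}"
proof -
  have eq: "((m * t + c) - c) /\<^sub>R m = t" for t using assms(2) by simp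
  show ?thesis
    using has_integral_affinity'[of f I "m * a + c" "m * b + c" m c] assms unfolding eq by simp
qed

lemma absolutely_integrable_affine:
  fixes f :: "real \<Rightarrow> 'b::euclidean_space"
  assumes "f absolutely_integrable_on {m * a + c..m * b + c}" "m > 0"
  shows "(\<lambda>t. f (m * t + c)) absolutely_integrable_on {a..b}"
proof -
  have "f integrable_on {m * a + c..m * b + c}" "(\<lambda>x. norm (f x)) integrable_on {m * a + c..m * b + c}"
    using assms(1) by (simp_all add: absolutely_integrable_on_def)
  from this[THEN integrable_integral, THEN has_integral_affine_real, OF assms(2)]
  show ?thesis unfolding absolutely_integrable_on_def integrable_on_def by blast
qed

lemma H1_on_affine:
  assumes f: "H1_on (m * a + c) (m * b + c) f" and m: "m > 0"
  shows "H1_on a b (\<lambda>t. f (m * t + c))"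
proof -
  obtain w where w: "w absolutely_integrable_on {m * a + c..m * b + c}"
      "(\<lambda>t. (norm (w t))\<^sup>2) absolutely_integrable_on {m * a + c..m * b + c}"
      "\<And>t. t \<in> {m * a + c..m * b + c} \<Longrightarrow> f t = f (m * a + c) + integral {m * a + c..t} w"
    using f unfolding H1_on_def by blast
  define w' where "w' = (\<lambda>t. m *\<^sub>R w (m * t + c))"
  have 1: "w' absolutely_integrable_on {a..b}"
    unfolding w'_def
    by (rule absolutely_integrable_scaleR_left[OF absolutely_integrable_affine[OF w(1) m]])
  have "(\<lambda>t. (norm (w (m * t + c)))\<^sup>2) absolutely_integrable_on {a..b}"
    by (rule absolutely_integrable_affine[OF w(2) m])
  from absolutely_integrable_scaleR_left[OF this, of "m\<^sup>2"]
  have 2: "(\<lambda>t. (norm (w' t))\<^sup>2) absolutely_integrable_on {a..b}"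
    by (simp add: w'_def power_mult_distrib)
  have 3: "f (m * t + c) = f (m * a + c) + integral {a..t} w'" if t: "t \<in> {a..b}" for t
  proof -
    have in_ab: "m * t + c \<in> {m * a + c..m * b + c}" using t m by auto
    then have "{m * a + c..m * t + c} \<subseteq> {m * a + c..m * b + c}" by auto
    then have "w integrable_on {m * a + c..m * t + c}"
      using w(1) by (auto intro: integrable_on_subinterval simp: absolutely_integrable_on_def)
    from has_integral_cmul[OF has_integral_affine_real[OF integrable_integral[OF this] m], of m] m
    have "(w' has_integral integral {m * a + c..m * t + c} w) {a..t}" by (simp add: w'_def)
    then have "integral {a..t} w' = integral {m * a + c..m * t + c} w" by (rule integral_unique)
    then show ?thesis using w(3)[OF in_ab] by simp
  qed
  show ?thesis unfolding H1_on_def using 1 2 3 by blast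
qed

text \<open>The weak derivatives are pieced together. There is no jump at \<open>k\<close>, because
  \<open>f k\<close> is both the end value of the first piece and the initial value of the
  second.\<close>

lemma H1_on_glue:
  assumes ab: "a \<le> k" "k \<le> b" and f1: "H1_on a k f" and f2: "H1_on k b f"
  shows "H1_on a b f"
proof -
  obtain w1 where w1: "w1 absolutely_integrable_on {a..k}"
      "(\<lambda>t. (norm (w1 t))\<^sup>2) absolutely_integrable_on {a..k}"
      "\<And>t. t \<in> {a..k} \<Longrightarrow> f t = f a + integral {a..t} w1"
    using f1 unfolding H1_on_def by blast
  obtain w2 where w2: "w2 absolutely_integrable_on {k..b}"
      "(\<lambda>t. (norm (w2 t))\<^sup>2) absolutely_integrable_on {k..b}"
      "\<And>t. t \<in> {k..b} \<Longrightarrow> f t = f k + integral {k..t} w2"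
    using f2 unfolding H1_on_def by blast
  define w where "w = (\<lambda>t. if t \<le> k then w1 t else w2 t)"
  have n: "negligible {k}" by simp
  have 1: "w absolutely_integrable_on {a..b}"
  proof (rule absolutely_integrable_on_combine[OF _ _ ab])
    show "w absolutely_integrable_on {a..k}"
      by (rule absolutely_integrable_spike[OF w1(1) n]) (auto simp: w_def)
    show "w absolutely_integrable_on {k..b}"
      by (rule absolutely_integrable_spike[OF w2(1) n]) (auto simp: w_def)
  qed
  have 2: "(\<lambda>t. (norm (w t))\<^sup>2) absolutely_integrable_on {a..b}"
  proof (rule absolutely_integrable_on_combine[OF _ _ ab])
    show "(\<lambda>t. (norm (w t))\<^sup>2) absolutely_integrable_on {a..k}"
      by (rule absolutely_integrable_spike[OF w1(2) n]) (auto simp: w_def)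
    show "(\<lambda>t. (norm (w t))\<^sup>2) absolutely_integrable_on {k..b}"
      by (rule absolutely_integrable_spike[OF w2(2) n]) (auto simp: w_def)
  qed
  have 3: "f t = f a + integral {a..t} w" if t: "t \<in> {a..b}" for t
  proof (cases "t \<le> k")
    case True
    then have "integral {a..t} w = integral {a..t} w1" by (intro integral_cong) (auto simp: w_def)
    then show ?thesis using w1(3)[of t] t True by simp
  next
    case False
    have "integral {k..t} w = integral {k..t} w2"
      by (rule integral_spike[OF n]) (auto simp: w_def)
    moreover have "integral {a..k} w = integral {a..k} w1" by (intro integral_cong) (auto simp: w_def)
    moreover have "integral {a..k} w + integral {k..t} w = integral {a..t} w"
      using False ab t 1
      by (intro Henstock_Kurzweil_Integration.integral_combine)
        (auto simp: absolutely_integrable_on_def intro: integrable_on_subinterval)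
    ultimately show ?thesis using w1(3)[of k] w2(3)[of t] ab t False by (simp add: algebra_simps)
  qed
  show ?thesis unfolding H1_on_def using 1 2 3 by blast
qed

lemma H1_on_zero: "(\<And>t. t \<in> {a..b} \<Longrightarrow> f t = 0) \<Longrightarrow> a \<le> b \<Longrightarrow> H1_on a b f"
  unfolding H1_on_def by (auto intro!: exI[of _ "\<lambda>_. 0"])

lemma H1_on_linear:
  assumes "H1_on a b f" "H1_on a b f'" shows "H1_on a b (\<lambda>t. r *\<^sub>R f t + s *\<^sub>R f' t)"
proof -
  obtain w where w: "w absolutely_integrable_on {a..b}"
      "(\<lambda>t. (norm (w t))\<^sup>2) absolutely_integrable_on {a..b}"
      "\<And>t. t \<in> {a..b} \<Longrightarrow> f t = f a + integral {a..t} w"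
    using assms(1) unfolding H1_on_def by blast
  obtain w' where w': "w' absolutely_integrable_on {a..b}"
      "(\<lambda>t. (norm (w' t))\<^sup>2) absolutely_integrable_on {a..b}"
      "\<And>t. t \<in> {a..b} \<Longrightarrow> f' t = f' a + integral {a..t} w'"
    using assms(2) unfolding H1_on_def by blast
  define q where "q = (\<lambda>t. r *\<^sub>R w t + s *\<^sub>R w' t)"
  have 1: "q absolutely_integrable_on {a..b}"
    unfolding q_def by (intro set_integral_add absolutely_integrable_scaleR_left w w')
  \<comment> \<open>Square integrability of the sum follows by domination, from
    \<open>(x + y)^2 \<le> 2 x^2 + 2 y^2\<close>.\<close>
  have qb: "(norm (q t))\<^sup>2 \<le> 2 * r\<^sup>2 * (norm (w t))\<^sup>2 + 2 * s\<^sup>2 * (norm (w' t))\<^sup>2" for t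
  proof -
    have "norm (q t) \<le> \<bar>r\<bar> * norm (w t) + \<bar>s\<bar> * norm (w' t)"
      unfolding q_def using norm_triangle_ineq[of "r *\<^sub>R w t" "s *\<^sub>R w' t"] by simp
    then have "(norm (q t))\<^sup>2 \<le> (\<bar>r\<bar> * norm (w t) + \<bar>s\<bar> * norm (w' t))\<^sup>2"
      by (rule power_mono) simp
    also have "\<dots> \<le> 2 * (\<bar>r\<bar> * norm (w t))\<^sup>2 + 2 * (\<bar>s\<bar> * norm (w' t))\<^sup>2"
      using sum_squares_bound[of "\<bar>r\<bar> * norm (w t)" "\<bar>s\<bar> * norm (w' t)"] by (simp add: power2_sum)
    finally show ?thesis by (simp add: power_mult_distrib)
  qed
  have bnd: "(\<lambda>t. 2 * r\<^sup>2 * (norm (w t))\<^sup>2 + 2 * s\<^sup>2 * (norm (w' t))\<^sup>2) integrable_on {a..b}"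
    using w(2) w'(2) by (intro integrable_add integrable_on_mult_right) (auto simp: absolutely_integrable_on_def)
  have "q \<in> borel_measurable (lebesgue_on {a..b})"
    using 1 by (intro integrable_imp_measurable) (simp add: absolutely_integrable_on_def)
  then have "(\<lambda>t. (norm (q t))\<^sup>2) \<in> borel_measurable (lebesgue_on {a..b})"
    by measurable
  from measurable_bounded_by_integrable_imp_absolutely_integrable[OF this _ bnd]
  have 2: "(\<lambda>t. (norm (q t))\<^sup>2) absolutely_integrable_on {a..b}" using qb by simp
  have 3: "r *\<^sub>R f t + s *\<^sub>R f' t = r *\<^sub>R f a + s *\<^sub>R f' a + integral {a..t} q" if t: "t \<in> {a..b}" for t
  proof -
    have "w integrable_on {a..t}" "w' integrable_on {a..t}"
      using w(1) w'(1) t by (auto simp: absolutely_integrable_on_def intro: integrable_on_subinterval)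
    then have "integral {a..t} q = r *\<^sub>R integral {a..t} w + s *\<^sub>R integral {a..t} w'"
      unfolding q_def by (simp add: integral_add integrable_cmul)
    then show ?thesis using w(3)[OF t] w'(3)[OF t] by (simp add: algebra_simps)
  qed
  show ?thesis unfolding H1_on_def using 1 2 3 by blast
qed

lemma H1_on_differentiable_ae:
  assumes "H1_on a b f"
  obtains N where "negligible N" "\<And>x. x \<in> {a<..<b} - N \<Longrightarrow> f differentiable (at x)"
proof -
  obtain w where w: "w absolutely_integrable_on {a..b}"
      "\<And>t. t \<in> {a..b} \<Longrightarrow> f t = f a + integral {a..t} w"
    using assms unfolding H1_on_def by blast
  have "w integrable_on {a..b}" using w(1) by (simp add: absolutely_integrable_on_def)
  then obtain N where N: "negligible N"
    "\<And>x. x \<in> {a<..<b} - N \<Longrightarrow> ((\<lambda>t. integral {a..t} w) has_vector_derivative w x) (at x)"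
    using indefinite_integral_vector_derivative_ae by blast
  show ?thesis
  proof (rule that[OF N(1)])
    fix x assume x: "x \<in> {a<..<b} - N"
    have "((\<lambda>t. f a + integral {a..t} w) has_derivative (\<lambda>h. h *\<^sub>R w x)) (at x)"
      using N(2)[OF x] by (auto simp: has_vector_derivative_def intro!: derivative_eq_intros)
    then have "(f has_derivative (\<lambda>h. h *\<^sub>R w x)) (at x)"
      by (rule has_derivative_transform_within_open[OF _ open_greaterThanLessThan[of a b]])
        (use x in auto, rule w(2)[symmetric], auto)
    then show "f differentiable (at x)" by (auto simp: differentiable_def)
  qed
qed

section \<open>Behaviour under affine reparametrization\<close>

lemma scaleR_fun_apply: "(a *\<^sub>R f) x = a *\<^sub>R f x"
  by (simp add: scaleR_fun_def)

lemma AE_lebesgue_interval_iff: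
  "(AE t in lebesgue. t \<in> {0..1::real} \<longrightarrow> P t) \<longleftrightarrow> (\<exists>E. negligible E \<and> (\<forall>t\<in>{0..1} - E. P t))"
proof
  assume "AE t in lebesgue. t \<in> {0..1::real} \<longrightarrow> P t"
  then obtain N where "N \<in> null_sets lebesgue" "{t \<in> space lebesgue. \<not> (t \<in> {0..1} \<longrightarrow> P t)} \<subseteq> N"
    unfolding eventually_ae_filter by blast
  then show "\<exists>E. negligible E \<and> (\<forall>t\<in>{0..1} - E. P t)"
    by (intro exI[of _ N]) (auto simp: negligible_iff_null_sets)
next
  assume "\<exists>E. negligible E \<and> (\<forall>t\<in>{0..1} - E. P t)"
  then obtain E where "negligible E" "\<forall>t\<in>{0..1} - E. P t" by blast
  then show "AE t in lebesgue. t \<in> {0..1::real} \<longrightarrow> P t"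
    unfolding eventually_ae_filter by (intro bexI[of _ E]) (auto simp: negligible_iff_null_sets)
qed

lemma interval_diff_negligible_nonempty:
  assumes "negligible E" obtains t where "t \<in> {0..1::real} - E"
proof -
  have "\<not> negligible {0..1::real}" using negligible_interval(1)[of "0::real" 1] by simp
  then have "\<not> {0..1} \<subseteq> E" using negligible_subset[OF assms] by blast
  then show ?thesis using that by blast
qed

lemma negligible_affine_preimage:
  fixes m :: real assumes "negligible E" "m > 0" shows "negligible {t. m * t + c \<in> E}"
proof -
  have "{t. m * t + c \<in> E} \<subseteq> (\<lambda>y. (y - c) / m) ` E"
    using assms(2) by (auto simp: image_iff intro!: bexI[of _ "m * _ + c"])
  moreover have "negligible ((\<lambda>y. (y - c) / m) ` E)"
    using assms by (intro negligible_differentiable_image_negligible)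
      (auto intro!: derivative_intros simp: differentiable_on_def)
  ultimately show ?thesis using negligible_subset by blast
qed

lemma has_vector_derivative_affine:
  fixes f :: "real \<Rightarrow> 'b::real_normed_vector"
  assumes "(f1 has_vector_derivative v) (at (m * t + c))" "t \<in> {p<..<q}"
    and "\<And>s. s \<in> {p<..<q} \<Longrightarrow> f s = f1 (m * s + c)"
  shows "(f has_vector_derivative m *\<^sub>R v) (at t)"
proof -
  have "((\<lambda>s. m * s + c) has_derivative (\<lambda>h. m * h)) (at t)" by (auto intro!: derivative_eq_intros)
  from has_derivative_compose[OF this assms(1)[unfolded has_vector_derivative_def]]
  have "((\<lambda>s. f1 (m * s + c)) has_derivative (\<lambda>h. (m * h) *\<^sub>R v)) (at t)" .
  then have "(f has_derivative (\<lambda>h. (m * h) *\<^sub>R v)) (at t)"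
    by (rule has_derivative_transform_within_open[OF _ open_greaterThanLessThan[of p q] assms(2)])
      (simp add: assms(3))
  then show ?thesis by (simp add: has_vector_derivative_def mult.commute)
qed

context lorentzian
begin

section \<open>Fields along curves and the integrand of the index form\<close>

definition regular_curve :: "(real \<Rightarrow> 'm) \<Rightarrow> bool" where
  "regular_curve \<sigma> \<longleftrightarrow> (\<exists>E. negligible E \<and> (\<forall>t\<in>{0..1} - E. regular_at \<sigma> t))"

text \<open>Restricted to the diagonal, as negative definiteness only concerns values
  \<open>B v v\<close>.\<close>

definition index_density :: "(real \<Rightarrow> 'm) \<Rightarrow> (real \<Rightarrow> ('m, 'e) tangent) \<Rightarrow> real \<Rightarrow> real" where
  "index_density \<sigma> V t =
    g (\<sigma> t) (cov_deriv A g \<sigma> V t) (cov_deriv A g \<sigma> V t)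
    + g (\<sigma> t) (curvature A g (\<sigma> t) (velocity A \<sigma> t) (V t) (velocity A \<sigma> t)) (V t)"

lemma index_form_density: "index_form A g \<sigma> V V = integral {0..1} (index_density \<sigma> V)"
  unfolding index_form_def index_density_def ..

lemma periodic_tangent: "V \<in> periodic_H1_fields A \<sigma> \<Longrightarrow> t \<in> {0..1} \<Longrightarrow> V t \<in> tangent_space A (\<sigma> t)"
  by (simp add: periodic_H1_fields_def)

lemma periodic_outside: "V \<in> periodic_H1_fields A \<sigma> \<Longrightarrow> t \<notin> {0..1} \<Longrightarrow> V t = 0"
  by (simp add: periodic_H1_fields_def)

lemma periodic_H1:
  "V \<in> periodic_H1_fields A \<sigma> \<Longrightarrow> c \<in> A \<Longrightarrow> 0 \<le> a \<Longrightarrow> a \<le> b \<Longrightarrow> b \<le> 1 \<Longrightarrow> \<sigma> ` {a..b} \<subseteq> fst c \<Longrightarrow>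
    H1_on a b (\<lambda>t. V t c)"
  unfolding periodic_H1_fields_def by blast

lemma subspace_periodic_H1_fields: "subspace (periodic_H1_fields A \<sigma>)"
proof -
  have lin: "a *\<^sub>R V + b *\<^sub>R W \<in> periodic_H1_fields A \<sigma>"
    if V: "V \<in> periodic_H1_fields A \<sigma>" and W: "W \<in> periodic_H1_fields A \<sigma>" for a b V W
    unfolding periodic_H1_fields_def
  proof (safe)
    show "(a *\<^sub>R V + b *\<^sub>R W) t \<in> tangent_space A (\<sigma> t)" if "t \<in> {0..1}" for t
      using periodic_tangent[OF V that] periodic_tangent[OF W that]
      by (simp add: scaleR_fun_apply subspace_add subspace_scale subspace_tangent_space)
    show "(a *\<^sub>R V + b *\<^sub>R W) t = 0" if "t \<notin> {0..1}" for t
      using periodic_outside[OF V that] periodic_outside[OF W that] by (simp add: scaleR_fun_apply)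
    show "(a *\<^sub>R V + b *\<^sub>R W) 0 = (a *\<^sub>R V + b *\<^sub>R W) 1"
      using V W by (simp add: scaleR_fun_apply periodic_H1_fields_def)
    fix X Z x y assume h: "(X, Z) \<in> A" "0 \<le> x" "x \<le> y" "y \<le> 1" "\<sigma> ` {x..y} \<subseteq> fst (X, Z)"
    have "H1_on x y (\<lambda>t. a *\<^sub>R V t (X, Z) + b *\<^sub>R W t (X, Z))"
      by (rule H1_on_linear[OF periodic_H1[OF V h] periodic_H1[OF W h]])
    then show "H1_on x y (\<lambda>t. (a *\<^sub>R V + b *\<^sub>R W) t (X, Z))" by (simp add: scaleR_fun_apply)
  qed
  have 0: "0 \<in> periodic_H1_fields A \<sigma>"
    using subspace_0[OF subspace_tangent_space] by (auto simp: periodic_H1_fields_def intro!: H1_on_zero)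
  show ?thesis
    unfolding subspace_def using 0 lin[of _ _ 1 1] lin[of _ 0 _ 0] by auto
qed

lemma periodic_differentiable_ae:
  assumes \<sigma>: "regular_curve \<sigma>" and V: "V \<in> periodic_H1_fields A \<sigma>"
  obtains E where "negligible E" "\<And>t. t \<in> {0..1} - E \<Longrightarrow> regular_at \<sigma> t \<and> differentiable_field_at \<sigma> V t"
proof -
  obtain E0 where E0: "negligible E0" "\<And>t. t \<in> {0..1} - E0 \<Longrightarrow> regular_at \<sigma> t"
    using \<sigma> unfolding regular_curve_def by blast
  \<comment> \<open>The atlas may be uncountable, but countably many rational intervals, each mapped into one chart,
    cover the regular parameters, and differentiability in one chart passes to all charts.\<close>
  define I where "I = {(a, b). a \<in> \<rat> \<and> b \<in> \<rat> \<and> 0 \<le> a \<and> a \<le> b \<and> b \<le> 1 \<and> (\<exists>c\<in>A. \<sigma> ` {a..b} \<subseteq> fst c)}"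
  have "\<exists>c N. c \<in> A \<and> \<sigma> ` {fst i..snd i} \<subseteq> fst c \<and> negligible N \<and>
      (\<forall>x\<in>{fst i<..<snd i} - N. (\<lambda>t. V t c) differentiable (at x))" if "i \<in> I" for i
  proof -
    obtain c where c: "c \<in> A" "\<sigma> ` {fst i..snd i} \<subseteq> fst c" "0 \<le> fst i" "fst i \<le> snd i" "snd i \<le> 1"
      using \<open>i \<in> I\<close> by (auto simp: I_def)
    obtain N where "negligible N" "\<And>x. x \<in> {fst i<..<snd i} - N \<Longrightarrow> (\<lambda>t. V t c) differentiable (at x)"
      using H1_on_differentiable_ae[OF periodic_H1[OF V c(1,3,4,5,2)]] by blast
    then show ?thesis using c by blast
  qed
  then obtain C N where CN: "\<And>i. i \<in> I \<Longrightarrow> C i \<in> A \<and> \<sigma> ` {fst i..snd i} \<subseteq> fst (C i) \<and> negligible (N i) \<and>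
      (\<forall>x\<in>{fst i<..<snd i} - N i. (\<lambda>t. V t (C i)) differentiable (at x))"
    by metis
  have "I \<subseteq> \<rat> \<times> \<rat>" by (auto simp: I_def)
  then have "countable I" by (rule countable_subset) (intro countable_SIGMA countable_rat)
  then have neg: "negligible (E0 \<union> (\<Union>i\<in>I. N i))"
    using E0 CN by (intro negligible_Un negligible_countable_Union) auto
  show ?thesis
  proof (rule that[OF neg])
    fix t assume t: "t \<in> {0..1} - (E0 \<union> (\<Union>i\<in>I. N i))"
    then have r: "regular_at \<sigma> t" using E0 by blast
    then have t01: "0 < t" "t < 1" by (auto simp: regular_at_def)
    obtain c where c: "c \<in> A" "\<sigma> t \<in> fst c" using chart_at .
    obtain e where e: "e > 0" "\<And>s. dist s t < e \<Longrightarrow> \<sigma> s \<in> fst c"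
      using regular_eventually_chart[OF r c] unfolding eventually_nhds_metric by blast
    obtain a where a: "a \<in> \<rat>" "max 0 (t - e) < a" "a < t"
      using Rats_dense_in_real[of "max 0 (t - e)" t] t01 e by auto
    obtain b where b: "b \<in> \<rat>" "t < b" "b < min 1 (t + e)"
      using Rats_dense_in_real[of t "min 1 (t + e)"] t01 e by auto
    have "\<sigma> ` {a..b} \<subseteq> fst c"
    proof
      fix y assume "y \<in> \<sigma> ` {a..b}"
      then obtain s where s: "s \<in> {a..b}" "y = \<sigma> s" by blast
      then have "dist s t < e" using a b by (auto simp: dist_real_def)
      then show "y \<in> fst c" using e s by blast
    qed
    then have "(a, b) \<in> I" using a b c by (auto simp: I_def)
    note C = CN[OF this, simplified]
    have tab: "t \<in> {a<..<b} - N (a, b)" using a b t \<open>(a, b) \<in> I\<close> by auto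
    have "differentiable_field_at \<sigma> V t"
    proof (rule differentiable_field_atI[OF r, of "C (a, b)"])
      show "C (a, b) \<in> A" using C by blast
      have "t \<in> {a..b}" using tab by auto
      then show "\<sigma> t \<in> fst (C (a, b))" using C by blast
      show "(\<lambda>s. V s (C (a, b))) differentiable (at t)" using C tab by auto
      have "eventually (\<lambda>s. s \<in> {0<..<1}) (nhds t)"
        using t01 by (intro eventually_nhds_in_open) auto
      then show "eventually (\<lambda>s. V s \<in> tangent_space A (\<sigma> s)) (nhds t)"
        by eventually_elim (auto intro!: periodic_tangent[OF V])
    qed
    then show "regular_at \<sigma> t \<and> differentiable_field_at \<sigma> V t" using r by blast
  qed
qed

lemma zero_differentiable_field: "differentiable_field_at \<sigma> 0 t"
  using subspace_0[OF subspace_tangent_space] by (simp add: differentiable_field_at_def)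

lemma cov_deriv_zero: "regular_at \<sigma> t \<Longrightarrow> cov_deriv A g \<sigma> 0 t = 0"
  using cov_deriv_linear[OF _ zero_differentiable_field zero_differentiable_field, of \<sigma> t 0 0] by simp

lemma index_density_zero:
  assumes "regular_at \<sigma> t" shows "index_density \<sigma> 0 t = 0"
proof -
  have "curvature A g (\<sigma> t) (velocity A \<sigma> t) 0 (velocity A \<sigma> t) = 0"
    using curvature_scaleR[of "\<sigma> t" 1 "velocity A \<sigma> t" 0 0 1 "velocity A \<sigma> t"] by simp
  then show ?thesis
    using g_zero[OF subspace_0[OF subspace_tangent_space]] assms
    by (simp add: index_density_def cov_deriv_zero)
qed

text \<open>Derivatives at \<open>t\<close> only see an open interval around it. For an iterate
  compared with \<open>\<gamma>\<close> this is a stretch between consecutive break points.\<close>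

lemma rescale:
  assumes m: "m > 0" and t: "t \<in> {p<..<q}" "0 \<le> p" "q \<le> 1"
    and \<sigma>: "\<And>s. s \<in> {p<..<q} \<Longrightarrow> \<sigma> s = \<sigma>1 (m * s + c)"
    and r: "regular_at \<sigma>1 (m * t + c)"
  shows regular_rescale: "regular_at \<sigma> t"
    and velocity_rescale: "velocity A \<sigma> t = m *\<^sub>R velocity A \<sigma>1 (m * t + c)"
proof -
  have \<sigma>t: "\<sigma> t = \<sigma>1 (m * t + c)" using \<sigma> t by simp
  have D: "((snd d \<circ> \<sigma>) has_vector_derivative m *\<^sub>R velocity A \<sigma>1 (m * t + c) d) (at t)"
    if "d \<in> A" "\<sigma> t \<in> fst d" for d
  proof (rule has_vector_derivative_affine[OF _ t(1)])
    show "((snd d \<circ> \<sigma>1) has_vector_derivative velocity A \<sigma>1 (m * t + c) d) (at (m * t + c))"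
      using has_vector_derivative_velocity[OF r that(1)] that(2) \<sigma>t by simp
  qed (simp add: \<sigma>)
  have "isCont (\<lambda>s. \<sigma>1 (m * s + c)) t"
    using r by (intro isCont_o2[where f="\<lambda>s. m * s + c" and g=\<sigma>1]) (auto simp: regular_at_def intro!: continuous_intros)
  moreover have "eventually (\<lambda>s. s \<in> {p<..<q}) (nhds t)"
    using t by (intro eventually_nhds_in_open) auto
  then have "eventually (\<lambda>s. \<sigma> s = \<sigma>1 (m * s + c)) (nhds t)"
    by eventually_elim (rule \<sigma>)
  ultimately have "isCont \<sigma> t" by (simp add: isCont_cong[of \<sigma> "\<lambda>s. \<sigma>1 (m * s + c)"])
  then show reg: "regular_at \<sigma> t"
    unfolding regular_at_def using t D differentiableI_vector by fastforce
  show "velocity A \<sigma> t = m *\<^sub>R velocity A \<sigma>1 (m * t + c)"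
  proof
    fix d
    show "velocity A \<sigma> t d = (m *\<^sub>R velocity A \<sigma>1 (m * t + c)) d"
    proof (cases "d \<in> A \<and> \<sigma> t \<in> fst d")
      case True
      then show ?thesis
        using vector_derivative_unique_at[OF has_vector_derivative_velocity[OF reg] D] by (simp add: scaleR_fun_apply)
    next
      case False
      then show ?thesis using \<sigma>t by (auto simp: velocity_def scaleR_fun_apply)
    qed
  qed
qed

text \<open>The derivative of the components and the Christoffel term each contribute one factor
  \<open>m\<close>, the latter through the velocity.\<close>

lemma cov_deriv_rescale:
  assumes m: "m > 0" and t: "t \<in> {p<..<q}" "0 \<le> p" "q \<le> 1"
    and \<sigma>: "\<And>s. s \<in> {p<..<q} \<Longrightarrow> \<sigma> s = \<sigma>1 (m * s + c)"
    and r: "regular_at \<sigma>1 (m * t + c)"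
    and U: "\<And>s. s \<in> {p<..<q} \<Longrightarrow> U s = V (m * s + c)"
    and V: "differentiable_field_at \<sigma>1 V (m * t + c)"
  shows "cov_deriv A g \<sigma> U t = m *\<^sub>R cov_deriv A g \<sigma>1 V (m * t + c)"
proof -
  have reg: "regular_at \<sigma> t" "velocity A \<sigma> t = m *\<^sub>R velocity A \<sigma>1 (m * t + c)"
    by (rule rescale[OF m t \<sigma> r], assumption)+
  have \<sigma>t: "\<sigma> t = \<sigma>1 (m * t + c)" and Ut: "U t = V (m * t + c)" using \<sigma> U t by simp_all
  let ?V' = "\<lambda>d. vector_derivative (\<lambda>s. V s d) (at (m * t + c))"
  have D: "((\<lambda>s. U s d) has_vector_derivative m *\<^sub>R ?V' d) (at t)" if "d \<in> A" "\<sigma> t \<in> fst d" for d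
  proof (rule has_vector_derivative_affine[OF _ t(1)])
    show "((\<lambda>s. V s d) has_vector_derivative ?V' d) (at (m * t + c))"
      using V that \<sigma>t by (auto simp: differentiable_field_at_def vector_derivative_works[symmetric])
  qed (simp add: U)
  have at: "at t within {0..1} = at t" "at (m * t + c) within {0..1} = at (m * t + c)"
    using r reg(1) by (auto simp: regular_at_def at_within_01)
  show "cov_deriv A g \<sigma> U t = m *\<^sub>R cov_deriv A g \<sigma>1 V (m * t + c)"
  proof
    fix d
    show "cov_deriv A g \<sigma> U t d = (m *\<^sub>R cov_deriv A g \<sigma>1 V (m * t + c)) d"
    proof (cases "d \<in> A \<and> \<sigma> t \<in> fst d")
      case True
      then have "christoffel A g d (snd d (\<sigma> t)) (m *\<^sub>R velocity A \<sigma>1 (m * t + c) d) (V (m * t + c) d) =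
          m *\<^sub>R christoffel A g d (snd d (\<sigma> t)) (velocity A \<sigma>1 (m * t + c) d) (V (m * t + c) d)"
        using bilinear_simps(5)[OF christoffel_bilinear] by blast
      then show ?thesis
        using True \<sigma>t Ut vector_derivative_at[OF D[of d]]
        by (simp add: cov_deriv_def at scaleR_fun_apply reg(2) scaleR_add_right)
    next
      case False
      then show ?thesis using \<sigma>t by (auto simp: cov_deriv_def scaleR_fun_apply)
    qed
  qed
qed

text \<open>The first term contains two covariant derivatives and the second two velocities, hence
  the square. Moving the factors out of \<open>g\<close> uses that all its arguments are tangent
  vectors.\<close>

lemma index_density_rescale:
  assumes m: "m > 0" and t: "t \<in> {p<..<q}" "0 \<le> p" "q \<le> 1"
    and \<sigma>: "\<And>s. s \<in> {p<..<q} \<Longrightarrow> \<sigma> s = \<sigma>1 (m * s + c)"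
    and r: "regular_at \<sigma>1 (m * t + c)"
    and U: "\<And>s. s \<in> {p<..<q} \<Longrightarrow> U s = V (m * s + c)"
    and V: "differentiable_field_at \<sigma>1 V (m * t + c)"
  shows "index_density \<sigma> U t = m\<^sup>2 * index_density \<sigma>1 V (m * t + c)"
proof -
  let ?u = "m * t + c"
  have \<sigma>t: "\<sigma> t = \<sigma>1 ?u" and Ut: "U t = V ?u" using \<sigma> U t by simp_all
  have Vu: "V ?u \<in> tangent_space A (\<sigma>1 ?u)"
    using V eventually_nhds_x_imp_x unfolding differentiable_field_at_def by fast
  note C = cov_deriv_in[OF r V] and v = velocity_in[OF r]
  have K: "curvature A g (\<sigma>1 ?u) (m *\<^sub>R velocity A \<sigma>1 ?u) (V ?u) (m *\<^sub>R velocity A \<sigma>1 ?u) =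
      m\<^sup>2 *\<^sub>R curvature A g (\<sigma>1 ?u) (velocity A \<sigma>1 ?u) (V ?u) (velocity A \<sigma>1 ?u)"
    using curvature_scaleR[of "\<sigma>1 ?u" m "velocity A \<sigma>1 ?u" 1 "V ?u" m "velocity A \<sigma>1 ?u"]
    by (simp add: power2_eq_square)
  have cov: "cov_deriv A g \<sigma> U t = m *\<^sub>R cov_deriv A g \<sigma>1 V ?u"
    by (rule cov_deriv_rescale[OF m t \<sigma> r U V])
  have vel: "velocity A \<sigma> t = m *\<^sub>R velocity A \<sigma>1 ?u"
    by (rule velocity_rescale[OF m t \<sigma> r])
  show ?thesis
    unfolding index_density_def cov vel \<sigma>t Ut K
    using g_scaleR[OF C C, of m] g_scaleR(1)[OF C subspace_scale[OF subspace_tangent_space C], of m m]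
      g_scaleR(1)[OF curvature_in[OF v Vu v] Vu, of "m\<^sup>2"]
    by (simp add: power2_eq_square algebra_simps)
qed

text \<open>A non-integrable function has integral \<open>0\<close> by convention, so a negative
  value of the index form is itself a proof of integrability.\<close>

lemma index_density_integrable:
  assumes \<sigma>: "regular_curve \<sigma>" and V: "V = 0 \<or> index_form A g \<sigma> V V < 0"
  shows "index_density \<sigma> V integrable_on {0..1}"
proof (cases "V = 0")
  case True
  obtain E where "negligible E" "\<And>t. t \<in> {0..1} - E \<Longrightarrow> regular_at \<sigma> t"
    using \<sigma> unfolding regular_curve_def by blast
  then show ?thesis
    using True by (intro integrable_spike[OF integrable_0, of E]) (auto simp: index_density_zero)
next
  case False
  then show ?thesis
    using V not_integrable_integral[of "index_density \<sigma> V"] by (force simp: index_form_density)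
qed

lemma index_form_zero:
  assumes "regular_curve \<sigma>" shows "index_form A g \<sigma> 0 0 = 0"
proof -
  obtain E where E: "negligible E" "\<And>t. t \<in> {0..1} - E \<Longrightarrow> regular_at \<sigma> t"
    using assms unfolding regular_curve_def by blast
  have "integral {0..1} (index_density \<sigma> 0) = integral {0..1::real} (\<lambda>_. 0)"
    by (rule integral_spike[OF E(1)]) (simp add: index_density_zero E(2))
  then show ?thesis by (simp add: index_form_density)
qed

lemma index_density_has_integral_rescale:
  assumes m: "m > 0" and pq: "0 \<le> p" "q \<le> 1" "m * p + c = 0" "m * q + c = 1"
    and \<sigma>: "\<And>s. s \<in> {p<..<q} \<Longrightarrow> \<sigma> s = \<sigma>1 (m * s + c)"
    and U: "\<And>s. s \<in> {p<..<q} \<Longrightarrow> U s = V (m * s + c)"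
    and \<sigma>1: "regular_curve \<sigma>1" and V: "V \<in> periodic_H1_fields A \<sigma>1"
    and int: "index_density \<sigma>1 V integrable_on {0..1}"
  shows "(index_density \<sigma> U has_integral m * index_form A g \<sigma>1 V V) {p..q}"
proof -
  have "(index_density \<sigma>1 V has_integral index_form A g \<sigma>1 V V) {m * p + c..m * q + c}"
    using int by (simp add: pq index_form_density integrable_integral)
  \<comment> \<open>The substitution contributes \<open>1 / m\<close> and the density
    \<open>m\<close> squared, in total \<open>m\<close>.\<close>
  from has_integral_mult_right[OF has_integral_affine_real[OF this m], of "m\<^sup>2"]
  have I: "((\<lambda>t. m\<^sup>2 * index_density \<sigma>1 V (m * t + c)) has_integral m * index_form A g \<sigma>1 V V) {p..q}"
    using m by (simp add: power2_eq_square field_simps)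
  obtain E where E: "negligible E"
    "\<And>t. t \<in> {0..1} - E \<Longrightarrow> regular_at \<sigma>1 t \<and> differentiable_field_at \<sigma>1 V t"
    using periodic_differentiable_ae[OF \<sigma>1 V] by blast
  \<comment> \<open>The end points are excluded, since the rescaling rule needs an open interval
    around \<open>t\<close>.\<close>
  have neg: "negligible ({t. m * t + c \<in> E} \<union> {p, q})"
    by (simp add: negligible_affine_preimage[OF E(1) m])
  show ?thesis
  proof (rule has_integral_spike[OF neg _ I])
    fix t assume t: "t \<in> {p..q} - ({t. m * t + c \<in> E} \<union> {p, q})"
    then have tpq: "t \<in> {p<..<q}" by auto
    have "m * p \<le> m * t" "m * t \<le> m * q" using t m by auto
    then have "m * t + c \<in> {0..1} - E" using pq t by auto
    then have good: "regular_at \<sigma>1 (m * t + c)" "differentiable_field_at \<sigma>1 V (m * t + c)" using E by auto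
    show "index_density \<sigma> U t = m\<^sup>2 * index_density \<sigma>1 V (m * t + c)"
      by (rule index_density_rescale[OF m tpq pq(1,2) \<sigma> good(1) U good(2)])
  qed
qed

end

section \<open>Pinned fields\<close>

locale lorentzian_field = lorentzian A g
  for A :: "('m::{t2_space, second_countable_topology}, 'e::euclidean_space) chart set"
    and g :: "('m, 'e) metric" +
  fixes Y :: "'m \<Rightarrow> ('m, 'e) tangent"
  assumes Y: "smooth_vector_field A Y"
begin

lemma Y_in: "Y p \<in> tangent_space A p"
  using Y by (simp add: smooth_vector_field_def)

lemma Y_differentiable_field:
  assumes r: "regular_at \<sigma> t" shows "differentiable_field_at \<sigma> (\<lambda>s. Y (\<sigma> s)) t"
proof -
  obtain c where c: "c \<in> A" "\<sigma> t \<in> fst c" using chart_at .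
  let ?Yc = "\<lambda>x. Y (chart_inv c x) c"
  have "smooth_on (snd c ` fst c) ?Yc" using Y c by (simp add: smooth_vector_field_def)
  from smooth_on_has_derivative[OF this chart_open(2)[OF c(1)]]
  have "(?Yc has_derivative frechet_derivative ?Yc (at (snd c (\<sigma> t)))) (at (snd c (\<sigma> t)))" using c by blast
  moreover have "((\<lambda>s. snd c (\<sigma> s)) has_derivative (\<lambda>h. h *\<^sub>R velocity A \<sigma> t c)) (at t)"
    using has_vector_derivative_velocity[OF r c] by (simp add: has_vector_derivative_def comp_def)
  ultimately have "((\<lambda>s. ?Yc (snd c (\<sigma> s))) has_derivative
      (\<lambda>h. frechet_derivative ?Yc (at (snd c (\<sigma> t))) (h *\<^sub>R velocity A \<sigma> t c))) (at t)"
    by (rule has_derivative_compose[rotated])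
  moreover have "eventually (\<lambda>s. ?Yc (snd c (\<sigma> s)) = Y (\<sigma> s) c) (nhds t)"
    using regular_eventually_chart[OF r c] by eventually_elim (simp add: chart_inv1 c)
  ultimately have "(\<lambda>s. Y (\<sigma> s) c) differentiable (at t)"
    unfolding differentiable_def by (intro exI) (rule has_derivative_transform_nhds)
  then show ?thesis by (intro differentiable_field_atI[OF r c]) (simp_all add: Y_in)
qed

text \<open>For Killing \<open>Y\<close> this is the derivative of \<open>g(\<sigma>', Y)\<close> in
  direction \<open>V\<close>; skew-symmetry of the covariant differential of \<open>Y\<close> gives
  the second term its form. Noether's theorem makes \<open>g(\<sigma>', Y)\<close> constant along
  geodesics, hence the name.\<close>

definition noether :: "(real \<Rightarrow> 'm) \<Rightarrow> (real \<Rightarrow> ('m, 'e) tangent) \<Rightarrow> real \<Rightarrow> real" where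
  "noether \<sigma> V t = g (\<sigma> t) (cov_deriv A g \<sigma> V t) (Y (\<sigma> t))
    - g (\<sigma> t) (V t) (cov_deriv A g \<sigma> (\<lambda>s. Y (\<sigma> s)) t)"

lemma tangent_N_iff:
  "V \<in> tangent_N A g Y \<sigma> \<longleftrightarrow> V \<in> periodic_H1_fields A \<sigma> \<and>
    (\<exists>k E. negligible E \<and> (\<forall>t\<in>{0..1} - E. noether \<sigma> V t = k))"
  unfolding tangent_N_def AE_lebesgue_interval_iff noether_def by blast

lemma noether_linear:
  assumes r: "regular_at \<sigma> t" and V: "differentiable_field_at \<sigma> V t" and W: "differentiable_field_at \<sigma> W t"
  shows "noether \<sigma> (a *\<^sub>R V + b *\<^sub>R W) t = a * noether \<sigma> V t + b * noether \<sigma> W t"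
proof -
  have T: "V t \<in> tangent_space A (\<sigma> t)" "W t \<in> tangent_space A (\<sigma> t)"
    using V W eventually_nhds_x_imp_x unfolding differentiable_field_at_def by fast+
  have sum: "(a *\<^sub>R V + b *\<^sub>R W) t = a *\<^sub>R V t + b *\<^sub>R W t" by (simp add: scaleR_fun_apply)
  show ?thesis
    unfolding noether_def cov_deriv_linear[OF assms] sum
    using g_linear[OF cov_deriv_in[OF r V] cov_deriv_in[OF r W] Y_in, of a b]
      g_linear[OF T cov_deriv_in[OF r Y_differentiable_field[OF r]], of a b]
    by (simp add: algebra_simps)
qed

lemma noether_zero: "regular_at \<sigma> t \<Longrightarrow> noether \<sigma> 0 t = 0"
  using noether_linear[OF _ zero_differentiable_field zero_differentiable_field, of \<sigma> t 0 0] by simp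

text \<open>Each term contains exactly one covariant derivative, hence the first power of
  \<open>m\<close>. In particular the value \<open>0\<close> survives reparametrization.\<close>

lemma noether_rescale:
  assumes m: "m > 0" and t: "t \<in> {p<..<q}" "0 \<le> p" "q \<le> 1"
    and \<sigma>: "\<And>s. s \<in> {p<..<q} \<Longrightarrow> \<sigma> s = \<sigma>1 (m * s + c)"
    and r: "regular_at \<sigma>1 (m * t + c)"
    and U: "\<And>s. s \<in> {p<..<q} \<Longrightarrow> U s = V (m * s + c)"
    and V: "differentiable_field_at \<sigma>1 V (m * t + c)"
  shows "noether \<sigma> U t = m * noether \<sigma>1 V (m * t + c)"
proof -
  let ?u = "m * t + c"
  have \<sigma>t: "\<sigma> t = \<sigma>1 ?u" and Ut: "U t = V ?u" using \<sigma> U t by simp_all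
  have Vu: "V ?u \<in> tangent_space A (\<sigma>1 ?u)"
    using V eventually_nhds_x_imp_x unfolding differentiable_field_at_def by fast
  have cU: "cov_deriv A g \<sigma> U t = m *\<^sub>R cov_deriv A g \<sigma>1 V ?u"
    by (rule cov_deriv_rescale[OF m t \<sigma> r U V])
  have cY: "cov_deriv A g \<sigma> (\<lambda>s. Y (\<sigma> s)) t = m *\<^sub>R cov_deriv A g \<sigma>1 (\<lambda>s. Y (\<sigma>1 s)) ?u"
    by (rule cov_deriv_rescale[OF m t \<sigma> r _ Y_differentiable_field[OF r]]) (simp_all add: \<sigma>)
  show ?thesis
    unfolding noether_def cU cY \<sigma>t Ut
    using g_scaleR(1)[OF cov_deriv_in[OF r V] Y_in, of m]
      g_scaleR(2)[OF cov_deriv_in[OF r Y_differentiable_field[OF r]] Vu, of m]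
    by (simp add: right_diff_distrib)
qed

definition pinned :: "(real \<Rightarrow> 'm) \<Rightarrow> (real \<Rightarrow> ('m, 'e) tangent) set" where
  "pinned \<sigma> = {V \<in> periodic_H1_fields A \<sigma>. V 0 = 0 \<and>
    (\<exists>E. negligible E \<and> (\<forall>t\<in>{0..1} - E. noether \<sigma> V t = 0))}"

lemma pinned_subset: "pinned \<sigma> \<subseteq> tangent_N A g Y \<sigma>"
  unfolding pinned_def tangent_N_iff subset_iff by blast

lemma pinned_periodic: "V \<in> pinned \<sigma> \<Longrightarrow> V \<in> periodic_H1_fields A \<sigma>"
  by (simp add: pinned_def)

lemma pinned_outside: assumes "V \<in> pinned \<sigma>" "t \<le> 0 \<or> 1 \<le> t" shows "V t = 0"
proof -
  have "V 0 = 0" "V 1 = 0" using assms(1) by (auto simp: pinned_def periodic_H1_fields_def)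
  moreover have "V t = 0" if "t \<notin> {0..1}" using periodic_outside[OF pinned_periodic[OF assms(1)] that] .
  ultimately show ?thesis using assms(2) by (metis atLeastAtMost_iff order_antisym)
qed

lemma noether_linear_ae:
  assumes \<sigma>: "regular_curve \<sigma>" and V: "V \<in> periodic_H1_fields A \<sigma>" and W: "W \<in> periodic_H1_fields A \<sigma>"
  shows "\<exists>E. negligible E \<and>
    (\<forall>t\<in>{0..1} - E. noether \<sigma> (a *\<^sub>R V + b *\<^sub>R W) t = a * noether \<sigma> V t + b * noether \<sigma> W t)"
proof -
  obtain E1 where "negligible E1" "\<And>t. t \<in> {0..1} - E1 \<Longrightarrow> regular_at \<sigma> t \<and> differentiable_field_at \<sigma> V t"
    using periodic_differentiable_ae[OF \<sigma> V] by blast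
  moreover obtain E2 where "negligible E2" "\<And>t. t \<in> {0..1} - E2 \<Longrightarrow> regular_at \<sigma> t \<and> differentiable_field_at \<sigma> W t"
    using periodic_differentiable_ae[OF \<sigma> W] by blast
  ultimately show ?thesis
    by (intro exI[of _ "E1 \<union> E2"]) (auto intro!: noether_linear)
qed

lemma subspace_pinned:
  assumes \<sigma>: "regular_curve \<sigma>" shows "subspace (pinned \<sigma>)"
proof -
  have lin: "a *\<^sub>R V + b *\<^sub>R W \<in> pinned \<sigma>" if V: "V \<in> pinned \<sigma>" and W: "W \<in> pinned \<sigma>" for a b V W
  proof -
    note P = subspace_periodic_H1_fields[of \<sigma>]
    have "a *\<^sub>R V + b *\<^sub>R W \<in> periodic_H1_fields A \<sigma>"
      using pinned_periodic[OF V] pinned_periodic[OF W] by (intro subspace_add[OF P] subspace_scale[OF P])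
    moreover have "(a *\<^sub>R V + b *\<^sub>R W) 0 = 0"
      using pinned_outside[OF V, of 0] pinned_outside[OF W, of 0] by (simp add: scaleR_fun_apply)
    moreover
    obtain E where E: "negligible E"
      "\<And>t. t \<in> {0..1} - E \<Longrightarrow> noether \<sigma> (a *\<^sub>R V + b *\<^sub>R W) t = a * noether \<sigma> V t + b * noether \<sigma> W t"
      using noether_linear_ae[OF \<sigma> pinned_periodic[OF V] pinned_periodic[OF W], of a b] by blast
    obtain E1 where E1: "negligible E1" "\<And>t. t \<in> {0..1} - E1 \<Longrightarrow> noether \<sigma> V t = 0"
      using V by (auto simp: pinned_def)
    obtain E2 where "negligible E2" "\<And>t. t \<in> {0..1} - E2 \<Longrightarrow> noether \<sigma> W t = 0"
      using W by (auto simp: pinned_def)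
    then have "\<exists>E. negligible E \<and> (\<forall>t\<in>{0..1} - E. noether \<sigma> (a *\<^sub>R V + b *\<^sub>R W) t = 0)"
      using E E1 by (intro exI[of _ "E \<union> E1 \<union> E2"]) simp
    ultimately show ?thesis by (simp add: pinned_def)
  qed
  obtain E where "negligible E" "\<And>t. t \<in> {0..1} - E \<Longrightarrow> regular_at \<sigma> t"
    using \<sigma> unfolding regular_curve_def by blast
  then have 0: "0 \<in> pinned \<sigma>"
    using subspace_0[OF subspace_periodic_H1_fields] noether_zero unfolding pinned_def by auto
  show ?thesis
    unfolding subspace_def using 0 lin[of _ _ 1 1] lin[of _ 0 _ 0] by auto
qed

text \<open>The loss counts the coordinates of \<open>V 0\<close> in one chart and the constant of
  \<open>V\<close>, each a linear functional on a negative definite subspace.\<close>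

lemma pinned_neg_index:
  assumes \<sigma>: "regular_curve \<sigma>" and n: "enat n \<le> neg_index (tangent_N A g Y \<sigma>) B"
  shows "enat (n - (DIM('e) + 1)) \<le> neg_index (pinned \<sigma>) B"
proof -
  have 0: "0 \<in> pinned \<sigma>" using subspace_0[OF subspace_pinned[OF \<sigma>]] .
  then have "0 \<in> tangent_N A g Y \<sigma>" using pinned_subset by blast
  with n obtain W where W: "subspace W" "W \<subseteq> tangent_N A g Y \<sigma>" "negative_definite W B" "n \<le> dim W"
    by (auto simp: le_neg_index_iff)
  obtain c where c: "c \<in> A" "\<sigma> 0 \<in> fst c" using chart_at .
  \<comment> \<open>The chosen value is unique: two such constants agree at any parameter outside
    both exceptional sets.\<close>
  define k where "k V = (SOME k. \<exists>E. negligible E \<and> (\<forall>t\<in>{0..1} - E. noether \<sigma> V t = k))" for V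
  have k: "\<exists>E. negligible E \<and> (\<forall>t\<in>{0..1} - E. noether \<sigma> V t = k V)" if "V \<in> W" for V
  proof -
    have "\<exists>k E. negligible E \<and> (\<forall>t\<in>{0..1} - E. noether \<sigma> V t = k)"
      using that W(2) tangent_N_iff by blast
    then show ?thesis unfolding k_def by (rule someI_ex)
  qed
  have klin: "k (a *\<^sub>R U + b *\<^sub>R V) = a * k U + b * k V" if UV: "U \<in> W" "V \<in> W" for a b U V
  proof -
    have "a *\<^sub>R U + b *\<^sub>R V \<in> W" using UV W(1) by (simp add: subspace_add subspace_scale)
    from k[OF this] obtain E0 where E0: "negligible E0"
      "\<And>t. t \<in> {0..1} - E0 \<Longrightarrow> noether \<sigma> (a *\<^sub>R U + b *\<^sub>R V) t = k (a *\<^sub>R U + b *\<^sub>R V)" by blast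
    obtain E1 where E1: "negligible E1" "\<And>t. t \<in> {0..1} - E1 \<Longrightarrow> noether \<sigma> U t = k U" using k[OF UV(1)] by blast
    obtain E2 where E2: "negligible E2" "\<And>t. t \<in> {0..1} - E2 \<Longrightarrow> noether \<sigma> V t = k V" using k[OF UV(2)] by blast
    have "U \<in> periodic_H1_fields A \<sigma>" "V \<in> periodic_H1_fields A \<sigma>" using UV W(2) tangent_N_iff by blast+
    from noether_linear_ae[OF \<sigma> this, of a b]
    obtain E where E: "negligible E" "\<And>t. t \<in> {0..1} - E \<Longrightarrow>
        noether \<sigma> (a *\<^sub>R U + b *\<^sub>R V) t = a * noether \<sigma> U t + b * noether \<sigma> V t" by blast
    \<comment> \<open>A single parameter outside all four exceptional sets decides the identity
      between the constants.\<close>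
    have "negligible (E0 \<union> E1 \<union> E2 \<union> E)" using E0 E1 E2 E by simp
    then obtain t where "t \<in> {0..1} - (E0 \<union> E1 \<union> E2 \<union> E)" by (rule interval_diff_negligible_nonempty)
    then show ?thesis using E0(2)[of t] E1(2)[of t] E2(2)[of t] E(2)[of t] by simp
  qed
  \<comment> \<open>\<open>None\<close> stands for the constant, \<open>Some b\<close> for a
    component of \<open>V 0\<close> in the chart \<open>c\<close>.\<close>
  define \<phi> where "\<phi> i V = (case i of None \<Rightarrow> k V | Some b \<Rightarrow> V 0 c \<bullet> b)" for i :: "'e option" and V
  let ?I = "insert None (Some ` Basis) :: 'e option set"
  let ?K = "{V \<in> W. \<forall>i\<in>?I. \<phi> i V = 0}"
  have K: "subspace ?K \<and> dim W \<le> dim ?K + card ?I"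
    by (rule dim_kernel_family_ge[OF _ W(1)])
      (auto simp: \<phi>_def klin scaleR_fun_apply inner_add_left)
  have "card ?I = DIM('e) + 1" by (subst card_insert_disjoint) (auto simp: card_image)
  then have dimK: "n - (DIM('e) + 1) \<le> dim ?K" using K W(4) by linarith
  have "?K \<subseteq> pinned \<sigma>"
  proof
    fix V assume V: "V \<in> ?K"
    then have "k V = 0" and b: "\<And>b. b \<in> Basis \<Longrightarrow> V 0 c \<bullet> b = 0" by (auto simp: \<phi>_def)
    have per: "V \<in> periodic_H1_fields A \<sigma>" using V W(2) tangent_N_iff by blast
    have "V 0 c = 0" by (rule euclidean_eqI) (simp add: b)
    moreover have "V 0 \<in> tangent_space A (\<sigma> 0)" using periodic_tangent[OF per] by simp
    from tangent_eq[OF this c] have "coord_vec A c (\<sigma> 0) (V 0 c) = V 0" .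
    ultimately have "V 0 = 0"
      using coord_vec_linear[OF c, of 0 0 0 0] by simp
    moreover have "\<exists>E. negligible E \<and> (\<forall>t\<in>{0..1} - E. noether \<sigma> V t = 0)"
      using k[of V] V \<open>k V = 0\<close> by auto
    ultimately show "V \<in> pinned \<sigma>" using per by (simp add: pinned_def)
  qed
  moreover have "negative_definite ?K B" using W(3) by blast
  ultimately show ?thesis
    unfolding le_neg_index_iff[OF 0] using conjunct1[OF K] dimK by (intro exI[of _ ?K] conjI)
qed

text \<open>Pinned fields vanish outside the open unit interval, so \<open>V (m * t + c)\<close>
  already contains the extension by zero; \<open>{p..q}\<close> is the preimage of
  \<open>[0,1]\<close>. Vanishing at both ends makes the extension continuous, and the constant
  \<open>0\<close> also holds where the field is zero.\<close>

lemma embed_pinned: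
  assumes m: "m > 0" and pq: "0 \<le> p" "q \<le> 1" "m * p + c = 0" "m * q + c = 1"
    and \<sigma>: "\<And>s. s \<in> {p..q} \<Longrightarrow> \<sigma> s = \<sigma>1 (m * s + c)"
    and reg: "regular_curve \<sigma>" "regular_curve \<sigma>1" and V: "V \<in> pinned \<sigma>1"
  shows "(\<lambda>t. V (m * t + c)) \<in> pinned \<sigma>"
proof -
  let ?U = "\<lambda>t. V (m * t + c)"
  note per = pinned_periodic[OF V]
  have mono: "m * s + c \<le> m * t + c \<longleftrightarrow> s \<le> t" for s t using m by simp
  have "p < q" using m pq by (metis add.commute add_le_cancel_left mult_le_cancel_left_pos not_le not_one_le_zero)
  have out: "?U t = 0" if "t \<le> p \<or> q \<le> t" for t
    using pinned_outside[OF V, of "m * t + c"] mono[of t p] mono[of q t] that pq by auto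
  have ins: "m * t + c \<in> {0..1}" if "t \<in> {p..q}" for t
    using mono[of p t] mono[of t q] that pq by auto
  have "?U \<in> periodic_H1_fields A \<sigma>"
    unfolding periodic_H1_fields_def
  proof (intro CollectI conjI ballI allI impI)
    show "?U t \<in> tangent_space A (\<sigma> t)" if "t \<in> {0..1}" for t
    proof (cases "t \<in> {p..q}")
      case True
      then show ?thesis using periodic_tangent[OF per ins[OF True]] \<sigma> by simp
    next
      case False
      then show ?thesis using out[of t] subspace_0[OF subspace_tangent_space] by auto
    qed
    show "?U t = 0" if "t \<notin> {0..1}" for t using that pq by (intro out) auto
    show "?U 0 = ?U 1" using out[of 0] out[of 1] pq by simp
    fix d a b assume d: "d \<in> A" and ab: "0 \<le> a \<and> a \<le> b \<and> b \<le> 1 \<and> \<sigma> ` {a..b} \<subseteq> fst d"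
    show "H1_on a b (\<lambda>t. ?U t d)"
    proof (cases "b \<le> p \<or> q \<le> a")
      case True
      then have "?U t d = 0" if "t \<in> {a..b}" for t using out[of t] that by auto
      then show ?thesis using ab by (intro H1_on_zero) auto
    next
      case False
      \<comment> \<open>The interval is cut at \<open>p\<close> and \<open>q\<close>. The field
        vanishes on the outer pieces, which may degenerate to points.\<close>
      define a' b' where "a' = max a p" and "b' = min b q"
      have ord: "a \<le> a'" "a' \<le> b'" "b' \<le> b" "p \<le> a'" "b' \<le> q"
        using False ab \<open>p < q\<close> by (auto simp: a'_def b'_def)
      have "H1_on (m * a' + c) (m * b' + c) (\<lambda>t. V t d)"
      proof (rule periodic_H1[OF per d])
        show "0 \<le> m * a' + c" "m * a' + c \<le> m * b' + c" "m * b' + c \<le> 1"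
          using ins[of a'] ins[of b'] ord mono by auto
        show "\<sigma>1 ` {m * a' + c..m * b' + c} \<subseteq> fst d"
        proof
          fix y assume "y \<in> \<sigma>1 ` {m * a' + c..m * b' + c}"
          then obtain u where u: "m * a' + c \<le> u" "u \<le> m * b' + c" "y = \<sigma>1 u" by auto
          define s where "s = (u - c) / m"
          have us: "u = m * s + c" using m by (simp add: s_def)
          have s: "a' \<le> s" "s \<le> b'" using u(1,2) unfolding us mono by auto
          then have "\<sigma> s = y" using \<sigma>[of s] ord u(3) us by auto
          moreover have "s \<in> {a..b}" using s ord by auto
          ultimately show "y \<in> fst d" using ab by blast
        qed
      qed
      then have mid: "H1_on a' b' (\<lambda>t. ?U t d)" by (rule H1_on_affine[OF _ m])
      have left: "H1_on a a' (\<lambda>t. ?U t d)"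
      proof (cases "a = a'")
        case True
        then show ?thesis by (auto simp: H1_on_def intro!: exI[of _ "\<lambda>_. 0"])
      next
        case False
        then have "a' = p" by (auto simp: a'_def)
        then show ?thesis using out ord by (intro H1_on_zero) auto
      qed
      have right: "H1_on b' b (\<lambda>t. ?U t d)"
      proof (cases "b = b'")
        case True
        then show ?thesis by (auto simp: H1_on_def intro!: exI[of _ "\<lambda>_. 0"])
      next
        case False
        then have "b' = q" by (auto simp: b'_def)
        then show ?thesis using out ord by (intro H1_on_zero) auto
      qed
      show ?thesis
        using H1_on_glue[OF _ _ left H1_on_glue[OF _ _ mid right]] ord by auto
    qed
  qed
  moreover have "\<exists>E. negligible E \<and> (\<forall>t\<in>{0..1} - E. noether \<sigma> ?U t = 0)"
  proof -
    obtain E0 where E0: "negligible E0" "\<And>t. t \<in> {0..1} - E0 \<Longrightarrow> regular_at \<sigma> t"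
      using reg(1) unfolding regular_curve_def by blast
    obtain E1 where E1: "negligible E1"
      "\<And>t. t \<in> {0..1} - E1 \<Longrightarrow> regular_at \<sigma>1 t \<and> differentiable_field_at \<sigma>1 V t"
      using periodic_differentiable_ae[OF reg(2) per] by blast
    obtain E2 where E2: "negligible E2" "\<And>t. t \<in> {0..1} - E2 \<Longrightarrow> noether \<sigma>1 V t = 0"
      using V by (auto simp: pinned_def)
    \<comment> \<open>At \<open>p\<close> and \<open>q\<close> the extended field may have a corner,
      so these parameters are exceptional too.\<close>
    define E where "E = E0 \<union> {t. m * t + c \<in> E1 \<union> E2} \<union> {0, 1, p, q}"
    have "negligible {t. m * t + c \<in> E1 \<union> E2}"
      by (rule negligible_affine_preimage[OF _ m]) (use E1 E2 in simp)
    then have "negligible E" unfolding E_def using E0 by simp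
    moreover have "noether \<sigma> ?U t = 0" if t: "t \<in> {0..1} - E" for t
    proof (cases "t \<in> {p<..<q}")
      case True
      then have "m * t + c \<in> {0..1} - E1" "m * t + c \<in> {0..1} - E2"
        using ins[of t] t by (auto simp: E_def)
      then have good: "regular_at \<sigma>1 (m * t + c)" "differentiable_field_at \<sigma>1 V (m * t + c)"
        "noether \<sigma>1 V (m * t + c) = 0" using E1 E2 by auto
      have "noether \<sigma> ?U t = m * noether \<sigma>1 V (m * t + c)"
        by (rule noether_rescale[OF m True pq(1,2) _ good(1) _ good(2)]) (auto simp: \<sigma>)
      then show ?thesis using good by simp
    next
      case False
      have r: "regular_at \<sigma> t" using t E0 by (auto simp: E_def)
      \<comment> \<open>Here the field vanishes on a neighbourhood of \<open>t\<close>, so its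
        covariant derivative is that of the zero field.\<close>
      have "t < p \<or> q < t" using False t by (auto simp: E_def)
      then have "eventually (\<lambda>s. s \<in> {..<p} \<union> {q<..}) (nhds t)"
        by (intro eventually_nhds_in_open) auto
      then have ev: "eventually (\<lambda>s. ?U s = 0) (nhds t)"
        by eventually_elim (auto intro!: out)
      have Ut: "?U t = 0" using eventually_nhds_x_imp_x[OF ev] .
      have "cov_deriv A g \<sigma> ?U t = cov_deriv A g \<sigma> 0 t"
      proof
        fix d
        have "eventually (\<lambda>s. 0 = ?U s d) (nhds t)" using ev by eventually_elim simp
        from has_derivative_transform_nhds[OF has_derivative_const this]
        have "((\<lambda>s. ?U s d) has_vector_derivative 0) (at t)" by (simp add: has_vector_derivative_def)
        then have "vector_derivative (\<lambda>s. ?U s d) (at t) = 0" by (rule vector_derivative_at)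
        then show "cov_deriv A g \<sigma> ?U t d = cov_deriv A g \<sigma> 0 t d"
          using regular_at_interval[OF r] Ut by (simp add: cov_deriv_def at_within_01)
      qed
      then show ?thesis using noether_zero[OF r] Ut by (simp add: noether_def)
    qed
    ultimately show ?thesis by blast
  qed
  moreover have "?U 0 = 0" using out[of 0] pq by simp
  ultimately show ?thesis by (simp add: pinned_def)
qed

end

section \<open>Iterates\<close>

context lorentzian
begin

lemma geodesic_regular_at:
  assumes "geodesic A g \<gamma>" "0 < t" "t < 1" shows "regular_at \<gamma> t"
proof -
  have "isCont \<gamma> t"
    using assms continuous_on_interior[of "{0..1}" \<gamma> t] by (simp add: geodesic_def)
  moreover have "(snd c \<circ> \<gamma>) differentiable (at t)" if "c \<in> A" "\<gamma> t \<in> fst c" for c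
  proof -
    have "t \<in> {0..1}" using assms(2,3) by simp
    then have "(snd c \<circ> \<gamma>) differentiable (at t within {0..1})"
      using assms(1) that unfolding geodesic_def by blast
    then show ?thesis using at_within_01[OF assms(2,3)] by simp
  qed
  ultimately show ?thesis using assms(2,3) by (simp add: regular_at_def)
qed

text \<open>Between consecutive multiples of \<open>1 / N\<close> the iterate is an affine copy of
  \<open>\<gamma>\<close>; the multiples themselves form a countable, hence negligible, set.\<close>

lemma regular_curve_iterate:
  assumes \<gamma>: "\<And>t. 0 < t \<Longrightarrow> t < 1 \<Longrightarrow> regular_at \<gamma> t" and N: "N > 0"
  shows "regular_curve (iterate N \<gamma>)"
proof -
  define E where "E = range (\<lambda>k::int. of_int k / real N)"
  have "negligible E" unfolding E_def by (simp add: countable_imp_null_set_lborel null_sets_completionI negligible_iff_null_sets)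
  moreover have "regular_at (iterate N \<gamma>) t" if t: "t \<in> {0..1} - E" for t
  proof -
    define k where "k = \<lfloor>real N * t\<rfloor>"
    have ne: "real N * t \<noteq> of_int j" for j
    proof
      assume "real N * t = of_int j"
      then have "t = of_int j / real N" using N by (simp add: field_simps)
      then show False using t by (auto simp: E_def)
    qed
    have k: "of_int k < real N * t" "real N * t < of_int k + 1"
      using ne[of k] floor_correct[of "real N * t"] by (auto simp: k_def less_le[of "of_int _"])
    have "real N * t \<le> real N * 1" using t by (intro mult_left_mono) auto
    then have "real N * t < real N" using ne[of "int N"] by simp
    with k(1) have "real_of_int k < of_int (int N)" by simp
    then have kN: "0 \<le> k" "k + 1 \<le> int N" using t by (auto simp: k_def)
    let ?p = "of_int k / real N" and ?q = "(of_int k + 1) / real N"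
    have tpq: "t \<in> {?p<..<?q}" using k N by (simp add: field_simps)
    have "of_int k + 1 \<le> real N" using kN(2) by linarith
    then have pq: "0 \<le> ?p" "?q \<le> 1" using kN N by (auto simp: field_simps)
    have \<sigma>: "iterate N \<gamma> s = \<gamma> (real N * s + (- of_int k))" if "s \<in> {?p<..<?q}" for s
    proof -
      have "of_int k < real N * s" "real N * s < of_int k + 1" using that N by (auto simp: field_simps)
      then have "\<lfloor>real N * s\<rfloor> = k" by (simp add: floor_unique)
      then show ?thesis by (simp add: iterate_def frac_def)
    qed
    have r: "regular_at \<gamma> (real N * t + (- of_int k))" by (rule \<gamma>) (use k in auto)
    show ?thesis by (rule regular_rescale[OF _ tpq pq \<sigma> r]) (use N in auto)
  qed
  ultimately show ?thesis unfolding regular_curve_def by blast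
qed

end

context lorentzian_field
begin

text \<open>The first \<open>r\<close> turns occupy \<open>[0,\<theta>]\<close> and the last
  \<open>s\<close> turns \<open>[\<theta>,1]\<close>. Fields extended by zero from the two parts
  have supports that meet at most in \<open>\<theta>\<close>, so the index form of a sum has no
  mixed terms.\<close>

lemma pinned_neg_index_superadditive:
  assumes \<gamma>: "\<And>t. 0 < t \<Longrightarrow> t < 1 \<Longrightarrow> regular_at \<gamma> t" and rs: "r > 0" "s > 0"
    and n1: "enat n1 \<le> neg_index (pinned (iterate r \<gamma>)) (index_form A g (iterate r \<gamma>))"
    and n2: "enat n2 \<le> neg_index (pinned (iterate s \<gamma>)) (index_form A g (iterate s \<gamma>))"
  shows "enat (n1 + n2) \<le> neg_index (pinned (iterate (r + s) \<gamma>)) (index_form A g (iterate (r + s) \<gamma>))"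
proof -
  let ?\<sigma> = "iterate (r + s) \<gamma>" and ?\<sigma>1 = "iterate r \<gamma>" and ?\<sigma>2 = "iterate s \<gamma>"
  \<comment> \<open>\<open>m1\<close> and \<open>m2\<close> stretch the two parts to length
    \<open>1\<close>; \<open>c2\<close> is determined by
    \<open>m2 * \<theta> + c2 = 0\<close>.\<close>
  define \<theta> where "\<theta> = real r / real (r + s)"
  define m1 where "m1 = real (r + s) / real r"
  define m2 where "m2 = real (r + s) / real s"
  define c2 where "c2 = - (real r / real s)"
  have m: "m1 > 0" "m2 > 0" using rs by (simp_all add: m1_def m2_def)
  have \<theta>: "0 < \<theta>" "\<theta> < 1" using rs by (simp_all add: \<theta>_def)
  have pq1: "m1 * 0 + 0 = 0" "m1 * \<theta> + 0 = 1" using rs by (simp_all add: m1_def \<theta>_def)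
  have pq2: "m2 * \<theta> + c2 = 0" "m2 * 1 + c2 = 1"
    by (use rs in \<open>simp add: m2_def \<theta>_def c2_def del: of_nat_add\<close>)
      (use rs in \<open>simp add: m2_def c2_def add_divide_distrib\<close>)
  have reg: "regular_curve ?\<sigma>" "regular_curve ?\<sigma>1" "regular_curve ?\<sigma>2"
    using rs by (auto intro!: regular_curve_iterate \<gamma>)
  have s1: "?\<sigma> t = ?\<sigma>1 (m1 * t + 0)" for t
    using rs by (simp add: iterate_def m1_def)
  \<comment> \<open>In terms of turns the shift is the integer \<open>r\<close>, which
    \<open>frac\<close> does not see.\<close>
  have s2: "?\<sigma> t = ?\<sigma>2 (m2 * t + c2)" for t
  proof -
    have "real s * (m2 * t + c2) = real (r + s) * t - of_int (int r)"
      using rs by (simp add: m2_def c2_def field_simps)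
    then have "frac (real s * (m2 * t + c2)) = frac (real (r + s) * t)"
      by (simp only: frac_def floor_diff_of_int of_int_diff)
    then show ?thesis by (simp add: iterate_def)
  qed
  define f1 where "f1 V = (\<lambda>t. V (m1 * t + 0))" for V :: "real \<Rightarrow> ('m, 'e) tangent"
  define f2 where "f2 V = (\<lambda>t. V (m2 * t + c2))" for V :: "real \<Rightarrow> ('m, 'e) tangent"
  have lin: "linear f1" "linear f2"
    by (auto intro!: linearI simp: f1_def f2_def fun_eq_iff scaleR_fun_apply)
  have in1: "f1 V \<in> pinned ?\<sigma>" if "V \<in> pinned ?\<sigma>1" for V
    unfolding f1_def
    by (rule embed_pinned[OF m(1) order_refl _ pq1 _ reg(1,2) that]) (use \<theta> s1 in auto)
  have in2: "f2 V \<in> pinned ?\<sigma>" if "V \<in> pinned ?\<sigma>2" for V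
    unfolding f2_def
    by (rule embed_pinned[OF m(2) _ order_refl pq2 _ reg(1,3) that]) (use \<theta> s2 in auto)
  have left: "(f1 V1 + f2 V2) t = V1 (m1 * t + 0)" if "V2 \<in> pinned ?\<sigma>2" "t \<le> \<theta>" for V1 V2 t
  proof -
    have "m2 * t \<le> m2 * \<theta>" using that m by simp
    then have "V2 (m2 * t + c2) = 0" using pq2 by (intro pinned_outside[OF that(1)]) linarith
    then show ?thesis by (simp add: f1_def f2_def)
  qed
  have right: "(f1 V1 + f2 V2) t = V2 (m2 * t + c2)" if "V1 \<in> pinned ?\<sigma>1" "\<theta> \<le> t" for V1 V2 t
  proof -
    have "m1 * \<theta> \<le> m1 * t" using that m by simp
    then have "V1 (m1 * t + 0) = 0" using pq1 by (intro pinned_outside[OF that(1)]) linarith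
    then show ?thesis by (simp add: f1_def f2_def)
  qed
  show ?thesis
  proof (rule neg_index_direct_sum[where ?f1.0=f1 and ?f2.0=f2, OF _ _ _ lin _ _ _ n1 n2])
    show "0 \<in> pinned ?\<sigma>1" "0 \<in> pinned ?\<sigma>2" "0 \<in> pinned ?\<sigma>"
      using reg by (simp_all add: subspace_0[OF subspace_pinned])
    fix V1 V2 assume V1: "V1 \<in> pinned ?\<sigma>1" and V2: "V2 \<in> pinned ?\<sigma>2"
    show "f1 V1 + f2 V2 \<in> pinned ?\<sigma>"
      by (rule subspace_add[OF subspace_pinned[OF reg(1)] in1[OF V1] in2[OF V2]])
    show "V1 = 0 \<and> V2 = 0" if z: "f1 V1 + f2 V2 = 0"
    proof -
      \<comment> \<open>Every \<open>u \<le> 1\<close> is \<open>m1 * t\<close> for some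
        \<open>t \<le> \<theta>\<close>, where the second summand vanishes.\<close>
      have "V1 u = 0" for u
      proof (cases "u \<le> 1")
        case True
        have "m1 * (u / m1) \<le> m1 * \<theta>" using True m pq1 by simp
        then have "u / m1 \<le> \<theta>" using m by (simp only: mult_le_cancel_left_pos)
        from left[OF V2 this, of V1] z m show ?thesis by simp
      next
        case False
        then show ?thesis by (intro pinned_outside[OF V1]) simp
      qed
      moreover have "V2 u = 0" for u
      proof (cases "0 \<le> u")
        case True
        have "m2 * \<theta> \<le> m2 * ((u - c2) / m2)" using True m pq2 by simp
        then have "\<theta> \<le> (u - c2) / m2" using m by (simp only: mult_le_cancel_left_pos)
        from right[OF V1 this, of V2] z m show ?thesis by simp
      next
        case False
        then show ?thesis by (intro pinned_outside[OF V2]) simp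
      qed
      ultimately show ?thesis by (simp add: fun_eq_iff)
    qed
    assume d: "V1 = 0 \<or> index_form A g ?\<sigma>1 V1 V1 < 0" "V2 = 0 \<or> index_form A g ?\<sigma>2 V2 V2 < 0"
      and ne: "V1 \<noteq> 0 \<or> V2 \<noteq> 0"
    let ?U = "f1 V1 + f2 V2"
    \<comment> \<open>Integrability on each part comes from the sign conditions \<open>d\<close>;
      without it the two integrals could not be added.\<close>
    have "(index_density ?\<sigma> ?U has_integral m1 * index_form A g ?\<sigma>1 V1 V1) {0..\<theta>}"
      by (rule index_density_has_integral_rescale[OF m(1) order_refl _ pq1 s1 _ reg(2) pinned_periodic[OF V1]
            index_density_integrable[OF reg(2) d(1)]]) (use \<theta> left[OF V2] in auto)
    moreover have "(index_density ?\<sigma> ?U has_integral m2 * index_form A g ?\<sigma>2 V2 V2) {\<theta>..1}"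
      by (rule index_density_has_integral_rescale[OF m(2) _ order_refl pq2 s2 _ reg(3) pinned_periodic[OF V2]
            index_density_integrable[OF reg(3) d(2)]]) (use \<theta> right[OF V1] in auto)
    ultimately have "(index_density ?\<sigma> ?U has_integral
        m1 * index_form A g ?\<sigma>1 V1 V1 + m2 * index_form A g ?\<sigma>2 V2 V2) {0..1}"
      using \<theta> by (intro has_integral_combine[of 0 \<theta> 1]) auto
    then have I: "index_form A g ?\<sigma> ?U ?U =
        m1 * index_form A g ?\<sigma>1 V1 V1 + m2 * index_form A g ?\<sigma>2 V2 V2"
      unfolding index_form_density[of ?\<sigma>] by (rule integral_unique)
    have le: "index_form A g ?\<sigma>1 V1 V1 \<le> 0" "index_form A g ?\<sigma>2 V2 V2 \<le> 0"
      using d index_form_zero[OF reg(2)] index_form_zero[OF reg(3)] by auto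
    then have le': "m1 * index_form A g ?\<sigma>1 V1 V1 \<le> 0" "m2 * index_form A g ?\<sigma>2 V2 V2 \<le> 0"
      using m by (simp_all add: mult_nonneg_nonpos)
    have "m1 * index_form A g ?\<sigma>1 V1 V1 < 0 \<or> m2 * index_form A g ?\<sigma>2 V2 V2 < 0"
      using d ne m by (auto simp: mult_pos_neg)
    then show "index_form A g ?\<sigma> ?U ?U < 0" unfolding I using le' by linarith
  qed
qed

end

lemma enat_eq_infinityI:
  assumes "\<And>n. enat n \<le> x" shows "x = \<infinity>"
proof (cases x)
  case (enat k)
  then show ?thesis using assms[of "Suc k"] by simp
qed

theorem corollary6p8:
  fixes A :: "('m::{t2_space, second_countable_topology}, 'e::euclidean_space) chart set"
    and g :: "('m, 'e) metric"
    and Y :: "'m \<Rightarrow> ('m, 'e) tangent"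
    and \<gamma> :: "real \<Rightarrow> 'm"
  assumes "lorentzian_manifold A g"
    and "killing_field A g Y" and "timelike g Y"
    and "closed_geodesic A g \<gamma>"
    and "\<not> (\<exists>B::nat. \<forall>N\<ge>1. morse_index A g Y (iterate N \<gamma>) \<le> enat B)"
  shows "\<exists>\<alpha>>0. \<exists>\<beta>>0. \<exists>s\<^sub>0::nat. \<forall>s\<ge>s\<^sub>0. \<forall>r>0.
    ereal_of_enat (morse_index A g Y (iterate (r + s) \<gamma>))
      \<ge> ereal_of_enat (morse_index A g Y (iterate r \<gamma>)) + ereal (real s * \<alpha> - \<beta>)"
proof -
  interpret lorentzian_field A g Y
    using assms(1,2)
    by unfold_locales (auto simp: lorentzian_manifold_def killing_field_def)
  have \<gamma>: "regular_at \<gamma> t" if "0 < t" "t < 1" for t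
    using assms(4) geodesic_regular_at[OF _ that] by (simp add: closed_geodesic_def)
  define \<mu> where "\<mu> N = morse_index A g Y (iterate N \<gamma>)" for N
  define \<nu> where "\<nu> N = neg_index (pinned (iterate N \<gamma>)) (index_form A g (iterate N \<gamma>))" for N
  let ?d = "DIM('e) + 1"
  have \<nu>\<mu>: "\<nu> N \<le> \<mu> N" for N
    unfolding \<nu>_def \<mu>_def morse_index_def by (rule neg_index_mono[OF pinned_subset])
  have \<mu>\<nu>: "enat (n - ?d) \<le> \<nu> N" if "enat n \<le> \<mu> N" "N > 0" for n N
    using pinned_neg_index[OF regular_curve_iterate[OF \<gamma> that(2)]] that(1)
    unfolding \<nu>_def \<mu>_def morse_index_def by simp
  have super: "enat (n1 + n2) \<le> \<nu> (r + s)" if "enat n1 \<le> \<nu> r" "enat n2 \<le> \<nu> s" "r > 0" "s > 0" for n1 n2 r s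
    using pinned_neg_index_superadditive[OF \<gamma> that(3,4)] that(1,2) unfolding \<nu>_def by simp
  \<comment> \<open>An index of at least \<open>?d + 1\<close> leaves at least one dimension after
    pinning.\<close>
  obtain N where N: "N \<ge> 1" "\<not> \<mu> N \<le> enat ?d"
    using assms(5) unfolding \<mu>_def by blast
  then have "enat (Suc ?d) \<le> \<mu> N" by (simp add: Suc_ile_eq)
  from \<mu>\<nu>[OF this] N have \<nu>N: "enat 1 \<le> \<nu> N" by simp
  \<comment> \<open>Each step splits off a block of \<open>N\<close> turns. The case
    \<open>s = N\<close> is separate, because the remainder would be a zeroth iterate, to which
    \<open>super\<close> does not apply.\<close>
  have growth: "enat j \<le> \<nu> s" if "s > 0" "j * N \<le> s" for j s
    using that
  proof (induction j arbitrary: s)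
    case 0
    then show ?case by (simp add: enat_0)
  next
    case (Suc j)
    show ?case
    proof (cases "s = N")
      case True
      with Suc.prems N have "j = 0" by simp
      then show ?thesis using \<nu>N True by simp
    next
      case False
      then have s: "0 < s - N" "j * N \<le> s - N" using Suc.prems by auto
      from super[OF Suc.IH[OF s] \<nu>N] s N show ?thesis by simp
    qed
  qed
  \<comment> \<open>Truncated subtraction is harmless: for \<open>n < ?d\<close> the first factor
    contributes the trivial bound \<open>0\<close>.\<close>
  have main: "enat (n - ?d + s div N) \<le> \<mu> (r + s)" if "enat n \<le> \<mu> r" "r > 0" "s > 0" for n r s
  proof -
    have "enat (n - ?d + s div N) \<le> \<nu> (r + s)"
      using super[OF \<mu>\<nu>[OF that(1,2)] growth[OF that(3), of "s div N"] that(2,3)] by simp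
    then show ?thesis using \<nu>\<mu> order_trans by blast
  qed
  \<comment> \<open>The slope is \<open>1 / N\<close>. In \<open>\<beta> = ?d + 1\<close> the part
    \<open>?d\<close> pays for pinning and the \<open>1\<close> for rounding in
    \<open>s div N\<close>. The threshold \<open>1\<close> for \<open>s\<close> ensures that the
    second factor is a genuine iterate.\<close>
  have "ereal_of_enat (\<mu> r) + ereal (real s * (1 / real N) - (real ?d + 1)) \<le> ereal_of_enat (\<mu> (r + s))"
    if rs: "r > 0" "s \<ge> 1" for r s
  proof (cases "\<mu> r")
    case (enat n)
    have "s = s div N * N + s mod N" by simp
    moreover have "s mod N < N" using N by simp
    ultimately have "s \<le> s div N * N + N" by linarith
    then have "real s \<le> real (s div N * N + N)" by (rule of_nat_mono)
    then have "real s / real N \<le> real (s div N) + 1" using N by (simp add: field_simps)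
    moreover have "real n - real ?d \<le> real (n - ?d)" by linarith
    ultimately have "real n + (real s * (1 / real N) - (real ?d + 1)) \<le> real (n - ?d + s div N)"
      by simp
    then have "ereal_of_enat (\<mu> r) + ereal (real s * (1 / real N) - (real ?d + 1)) \<le> ereal_of_enat (enat (n - ?d + s div N))"
      by (simp add: enat)
    also have "\<dots> \<le> ereal_of_enat (\<mu> (r + s))"
      using main[of n r s] rs enat by (simp only: ereal_of_enat_le_iff)
    finally show ?thesis .
  next
    case infinity
    \<comment> \<open>If \<open>\<mu> r\<close> is infinite, \<open>main\<close> applies with every
      natural number; starting from \<open>n + ?d\<close> compensates the loss.\<close>
    have "enat n \<le> \<mu> (r + s)" for n
    proof -
      have "enat n \<le> enat (n + ?d - ?d + s div N)" by simp
      also have "\<dots> \<le> \<mu> (r + s)" using main[of "n + ?d" r s] rs infinity by simp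
      finally show ?thesis .
    qed
    then have "\<mu> (r + s) = \<infinity>" by (rule enat_eq_infinityI)
    then show ?thesis by simp
  qed
  moreover have "1 / real N > 0" "real ?d + 1 > 0" using N by auto
  ultimately show ?thesis unfolding \<mu>_def by blast
qed

end
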